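(* Let $L$ be an (oriented) virtual link diagram with arrow polynomial $\langle L\rangle_A$. Suppose that $\langle L\rangle_A$ contains a summand with the monomial $K_{i_1}K_{i_2}\cdots K_{i_n}$ ($n\ge 1$), where $i_j\neq i_k$ for all $j\neq k$ in $\{1,2,\dots,n\}$. Then $n$ determines a lower bound on the minimal genus of a surface in which $L$ embeds: if $n>1$ then the minimal genus of $L$ is $1$ or greater, and for any positive integer $g$, if $n\ge 3g-3$ then the minimal genus of $L$ is $g$ or higher.
   Context: A virtual link diagram is a generic collection of closed curves in the plane whose double points are either classical crossings (with over/under information) or virtual crossings (without). A virtual link is an equivalence class of diagrams under the classical and virtual Reidemeister moves. Diagrams are oriented. States. A state $S$ of a diagram $L$ is obtained by choosing, at every classical crossing, one of two planar smoothings: the oriented smoothing, which joins each incoming end to an outgoing end without crossing, or the disoriented smoothing, which joins the two incoming ends by one arc and the two outgoing ends by another disjoint arc. In a disoriented smoothing each of the two arcs carries one vertex, called a cusp, which points, transversally to its arc, toward the other arc of the same smoothing. At a positive crossing the oriented smoothing has coefficient $A$ and the disoriented one $A^{-1}$; at a negative crossing the oriented smoothing has coefficient $A^{-1}$ and the disoriented one $A$. The state is a collection of $|S|$ closed curves (loops) decorated with cusps, possibly with virtual crossings. Reduction. Traverse a loop $C$; each cusp points to the left or right of the direction of traversal. Two (cyclically) adjacent cusps pointing to the same side cancel; adjacent cusps pointing to opposite sides do not. Let $m$ be the number of cusps left after all cancellations ($m$ is even) and $a(C)=m/2$. Put $\langle C\rangle=1$ if $a(C)=0$ and $\langle C\rangle=K_{a(C)}$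 if $a(C)>0$, where $K_1,K_2,\dots$ are independent commuting variables. Put $\langle S\rangle=\prod_{C}\langle C\rangle$ over the loops $C$ of $S$. Arrow polynomial. With $d=-A^2-A^{-2}$, and $\alpha$, $\beta$ the numbers of smoothings in $S$ with coefficients $A$, $A^{-1}$ respectively, $$\langle L\rangle_A=\sum_S A^{\alpha-\beta}d^{|S|-1}\langle S\rangle\in\mathbb{Z}[A,A^{-1},K_1,K_2,\dots],$$ the sum being over all states of $L$. A summand with the monomial $K_{i_1}\cdots K_{i_n}$ is a term $cA^mK_{i_1}\cdots K_{i_n}$ occurring with non-zero integer coefficient $c$. Surfaces. Virtual links correspond bijectively to equivalence classes of links in thickened closed oriented surfaces $F\times I$ (equivalently, link diagrams on closed oriented surfaces $F$), modulo $1$-handle stabilization (and destabilization) and Dehn twists (homeomorphisms); such a pair is called a representation of the virtual link. The minimal genus of a virtual link is the minimum genus of a surface $F$ over all its representations. *)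

theory Defs
  imports
    "HOL-Library.Poly_Mapping"
    "HOL-Library.Product_Plus"
    "HOL-Library.Disjoint_Sets"
    "HOL-Combinatorics.Orbits"
    "HOL-Combinatorics.Cycles"
begin

section \<open>Oriented link diagrams on oriented surfaces\<close>

text \<open>
  An oriented diagram is recorded by finitely many points on its curves: \<open>nxt\<close> sends a point to
  the next one in the direction of the orientation, so that the curves are the cycles of \<open>nxt\<close>.
  A double point accounts for two points, one on each of its two strands. The points at no double
  point are markers without meaning of their own; a simple closed curve that meets nothing is a
  cycle of markers. The arc from \<open>p\<close> to \<open>nxt p\<close> is called the arc \<open>p\<close>.

  In \<open>Crossing k a b\<close> the pair (direction of the strand at \<open>a\<close>, direction of the strand at \<open>b\<close>) is a
  positive basis: the strand at \<open>b\<close> crosses the one at \<open>a\<close> from its right to its left. Hence \<open>a\<close> is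
  the overpass of a positive crossing and \<open>b\<close> is the overpass of a negative one. A virtual crossing
  has no over/under information.
\<close>

datatype kind = Positive | Negative | Virtual

datatype crossing = Crossing (ckind: kind) (pt1: nat) (pt2: nat)

definition ends :: "crossing \<Rightarrow> nat set" where
  "ends c = {pt1 c, pt2 c}"

definition other :: "crossing \<Rightarrow> nat \<Rightarrow> nat" where
  "other c q = (if q = pt1 c then pt2 c else pt1 c)"

record diagram =
  points :: "nat set"
  nxt :: "nat \<Rightarrow> nat"
  crossings :: "crossing set"

definition is_diagram :: "diagram \<Rightarrow> bool" where
  "is_diagram D \<longleftrightarrow>
     finite (points D) \<and> points D \<noteq> {} \<and> nxt D permutes points D \<and>
     (\<forall>c\<in>crossings D. ends c \<subseteq> points D \<and> pt1 c \<noteq> pt2 c) \<and>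
     (\<forall>c\<in>crossings D. \<forall>c'\<in>crossings D. c \<noteq> c' \<longrightarrow> ends c \<inter> ends c' = {})"

definition classical_crossings :: "diagram \<Rightarrow> crossing set" where
  "classical_crossings D = {c \<in> crossings D. ckind c \<noteq> Virtual}"

definition crossing_at :: "diagram \<Rightarrow> nat \<Rightarrow> crossing option" where
  "crossing_at D q =
     (if \<exists>c\<in>crossings D. q \<in> ends c then Some (THE c. c \<in> crossings D \<and> q \<in> ends c) else None)"

text \<open>
  \<open>(p, True)\<close> is the arc \<open>p\<close> traversed along its orientation, \<open>(p, False)\<close> the same arc traversed
  backwards. \<open>head\<close> is the point reached by such a traversal, and \<open>leave D q f\<close> departs from \<open>q\<close>
  along (\<open>f\<close>) or against (\<open>\<not> f\<close>) the orientation.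
\<close>

definition head :: "diagram \<Rightarrow> nat \<times> bool \<Rightarrow> nat" where
  "head D x = (if snd x then nxt D (fst x) else fst x)"

definition leave :: "diagram \<Rightarrow> nat \<Rightarrow> bool \<Rightarrow> nat \<times> bool" where
  "leave D q f = (if f then (q, True) else (inv (nxt D) q, False))"

text \<open>
  A neighbourhood \<open>N\<close> of the diagram is an oriented ribbon surface. Its boundary circles are obtained
  by walking along the left side of the traversed arcs and turning left at every double point: when
  the traveller arrives at \<open>pt1 c\<close>, the other strand leaves to the left if he walks along the
  orientation and to the right if he walks against it; at \<open>pt2 c\<close> it is the other way round.
\<close>

definition face_step :: "diagram \<Rightarrow> nat \<times> bool \<Rightarrow> nat \<times> bool" where
  "face_step D x =
     (case crossing_at D (head D x) of
        None \<Rightarrow> leave D (head D x) (snd x)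
      | Some c \<Rightarrow> leave D (other c (head D x)) (snd x \<longleftrightarrow> head D x = pt1 c))"

definition boundary_circles :: "diagram \<Rightarrow> (nat \<times> bool) set set" where
  "boundary_circles D = orbit (face_step D) ` (points D \<times> UNIV)"

text \<open>
  A diagram on a closed oriented surface \<open>F\<close>, up to homeomorphism: the components of \<open>F - N\<close> are
  compact connected oriented surfaces, each one determined by the set of boundary circles of \<open>N\<close> to
  which it is glued and by its genus. They need not be discs.
\<close>

record surface_diagram =
  pattern :: diagram
  regions :: "(nat \<times> bool) set set set"
  region_genus :: "(nat \<times> bool) set set \<Rightarrow> nat"

definition surface_adjacent :: "surface_diagram \<Rightarrow> nat \<Rightarrow> nat \<Rightarrow> bool" where
  "surface_adjacent F p q \<longleftrightarrow>
     q = nxt (pattern F) p \<or>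
     (\<exists>c\<in>crossings (pattern F). p \<in> ends c \<and> q \<in> ends c) \<or>
     (\<exists>R\<in>regions F. p \<in> fst ` \<Union>R \<and> q \<in> fst ` \<Union>R)"

definition surface_connected :: "surface_diagram \<Rightarrow> bool" where
  "surface_connected F \<longleftrightarrow>
     (\<forall>p\<in>points (pattern F). \<forall>q\<in>points (pattern F). equivclp (surface_adjacent F) p q)"

definition is_surface_diagram :: "surface_diagram \<Rightarrow> bool" where
  "is_surface_diagram F \<longleftrightarrow>
     is_diagram (pattern F) \<and> partition_on (boundary_circles (pattern F)) (regions F) \<and>
     surface_connected F"

text \<open>
  \<open>N\<close> deformation retracts to the graph with one vertex for each double point and each marker and
  one edge for each arc, so \<open>\<chi>(N) = |points| - |crossings| - |points|\<close>; a component of \<open>F - N\<close> of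
  genus \<open>h\<close> with \<open>b\<close> boundary circles has Euler characteristic \<open>2 - 2 h - b\<close>. For a surface diagram
  \<open>F\<close> is closed, connected and oriented, so the division by two below is exact.
\<close>

definition euler_char :: "surface_diagram \<Rightarrow> int" where
  "euler_char F =
     (\<Sum>R\<in>regions F. 2 - 2 * int (region_genus F R) - int (card R))
     - int (card (crossings (pattern F)))"

definition genus :: "surface_diagram \<Rightarrow> nat" where
  "genus F = nat ((2 - euler_char F) div 2)"

section \<open>Virtual links\<close>

text \<open>A diagram in the plane, equivalently on the sphere.\<close>

definition virtual_link_diagram :: "diagram \<Rightarrow> bool" where
  "virtual_link_diagram D \<longleftrightarrow> (\<exists>F. is_surface_diagram F \<and> pattern F = D \<and> genus F = 0)"

text \<open>Changes of the names and of the number of the points which do not alter the diagram.\<close>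

definition relabelling :: "diagram \<Rightarrow> diagram \<Rightarrow> bool" where
  "relabelling D D' \<longleftrightarrow>
     (\<exists>f. bij_betw f (points D) (points D') \<and>
          (\<forall>p\<in>points D. nxt D' (f p) = f (nxt D p)) \<and>
          crossings D' = (\<lambda>c. Crossing (ckind c) (f (pt1 c)) (f (pt2 c))) ` crossings D)"

definition add_marker :: "diagram \<Rightarrow> diagram \<Rightarrow> bool" where
  "add_marker D D' \<longleftrightarrow>
     (\<exists>p\<in>points D. \<exists>m. m \<notin> points D \<and>
        D' = \<lparr>points = insert m (points D), nxt = (nxt D)(m := nxt D p, p := m),
              crossings = crossings D\<rparr>)"

definition same_diagram :: "diagram \<Rightarrow> diagram \<Rightarrow> bool" where
  "same_diagram =
     equivclp (\<lambda>D D'. is_diagram D \<and> is_diagram D' \<and> (relabelling D D' \<or> add_marker D D'))"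

text \<open>
  The Reidemeister moves. Removed double points leave two markers behind. The monogon, the bigon and
  the triangle in which the moves take place are automatically boundary circles of \<open>N\<close>. In the first
  two moves the virtual variants are those with crossings of kind \<open>Virtual\<close>.
\<close>

definition reidemeister1 :: "diagram \<Rightarrow> diagram \<Rightarrow> bool" where
  "reidemeister1 D D' \<longleftrightarrow>
     (\<exists>c\<in>crossings D. (nxt D (pt1 c) = pt2 c \<or> nxt D (pt2 c) = pt1 c) \<and>
        D' = D\<lparr>crossings := crossings D - {c}\<rparr>)"

text \<open>
  One strand runs through \<open>p\<close> and \<open>p'\<close>, the other one through \<open>q\<close> and \<open>q'\<close>; the orders in which they
  do so are arbitrary, and the kinds ensure that the same strand is over at both crossings.
\<close>

definition reidemeister2 :: "diagram \<Rightarrow> diagram \<Rightarrow> bool" where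
  "reidemeister2 D D' \<longleftrightarrow>
     (\<exists>k k' p p' q q'.
        (k, k') \<in> {(Positive, Negative), (Negative, Positive), (Virtual, Virtual)} \<and>
        distinct [p, p', q, q'] \<and>
        {Crossing k p q, Crossing k' q' p'} \<subseteq> crossings D \<and>
        (nxt D p = p' \<or> nxt D p' = p) \<and> (nxt D q = q' \<or> nxt D q' = q) \<and>
        D' = D\<lparr>crossings := crossings D - {Crossing k p q, Crossing k' q' p'}\<rparr>)"

text \<open>
  The strand \<open>x\<close> meets \<open>y\<close> at \<open>x1, y1\<close> and \<open>z\<close> at \<open>x2, z1\<close>, while \<open>y\<close> meets \<open>z\<close> at \<open>y2, z2\<close>. The
  Booleans \<open>ex, ey, ez\<close> tell whether the orientation runs from the first to the second of the two
  points of a strand, \<open>s1, s2, s3\<close> tell which strand is \<open>pt1\<close> of a crossing, and \<open>t\<close> is the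
  orientation of the triangle (\<open>xy\<close>, \<open>xz\<close>, \<open>yz\<close>): reading \<open>True\<close> as \<open>1\<close> and \<open>False\<close> as \<open>-1\<close>, the
  three signs are \<open>t * ex * ey\<close>, \<open>t * ex * ez\<close> and \<open>t * ey * ez\<close>. Either all crossings are classical with
  \<open>x\<close> above \<open>y\<close> above \<open>z\<close>, or \<open>x\<close> has virtual crossings with \<open>y\<close> and \<open>z\<close> (the purely virtual and the
  mixed move). The move exchanges the order of the two double points on each of the three strands.
\<close>

definition follows :: "diagram \<Rightarrow> bool \<Rightarrow> nat \<Rightarrow> nat \<Rightarrow> bool" where
  "follows D e p q \<longleftrightarrow> (if e then nxt D p = q else nxt D q = p)"

definition oriented_crossing :: "bool \<Rightarrow> kind \<Rightarrow> nat \<Rightarrow> nat \<Rightarrow> crossing" where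
  "oriented_crossing s k p q = (if s then Crossing k p q else Crossing k q p)"

definition over_kind :: "bool \<Rightarrow> kind" where
  "over_kind s = (if s then Positive else Negative)"

definition reidemeister3 :: "diagram \<Rightarrow> diagram \<Rightarrow> bool" where
  "reidemeister3 D D' \<longleftrightarrow>
     (\<exists>x1 x2 y1 y2 z1 z2 ex ey ez t s1 s2 s3 k1 k2 k3.
        distinct [x1, x2, y1, y2, z1, z2] \<and>
        follows D ex x1 x2 \<and> follows D ey y1 y2 \<and> follows D ez z1 z2 \<and>
        (s1 \<longleftrightarrow> (t \<longleftrightarrow> (ex \<longleftrightarrow> ey))) \<and> (s2 \<longleftrightarrow> (t \<longleftrightarrow> (ex \<longleftrightarrow> ez))) \<and> (s3 \<longleftrightarrow> (t \<longleftrightarrow> (ey \<longleftrightarrow> ez))) \<and>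
        (k1 = over_kind s1 \<and> k2 = over_kind s2 \<and> k3 = over_kind s3 \<or>
         k1 = Virtual \<and> k2 = Virtual) \<and>
        (let old = {oriented_crossing s1 k1 x1 y1, oriented_crossing s2 k2 x2 z1,
                    oriented_crossing s3 k3 y2 z2};
             new = {oriented_crossing s1 k1 x2 y2, oriented_crossing s2 k2 x1 z2,
                    oriented_crossing s3 k3 y1 z1}
         in old \<subseteq> crossings D \<and> D' = D\<lparr>crossings := crossings D - old \<union> new\<rparr>))"

definition virtual_equivalent :: "diagram \<Rightarrow> diagram \<Rightarrow> bool" where
  "virtual_equivalent =
     equivclp (\<lambda>D D'. virtual_link_diagram D \<and> virtual_link_diagram D' \<and>
       (relabelling D D' \<or> add_marker D D' \<or>
        reidemeister1 D D' \<or> reidemeister2 D D' \<or> reidemeister3 D D'))"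

section \<open>Representations on surfaces and the minimal genus\<close>

text \<open>
  A link diagram on a surface (with classical crossings only) determines a virtual link: immerse the
  ribbon neighbourhood of the diagram in the plane, preserving the orientation; the double points
  created in this way become virtual crossings. Conversely, the surface diagram is recovered from the
  planar one by forgetting the virtual crossings, whose points turn into markers.
\<close>

definition forget_virtual :: "diagram \<Rightarrow> diagram" where
  "forget_virtual D = D\<lparr>crossings := classical_crossings D\<rparr>"

definition represents :: "surface_diagram \<Rightarrow> diagram \<Rightarrow> bool" where
  "represents F L \<longleftrightarrow>
     is_surface_diagram F \<and> (\<forall>c\<in>crossings (pattern F). ckind c \<noteq> Virtual) \<and>
     (\<exists>P. virtual_link_diagram P \<and> virtual_equivalent P L \<and>
          same_diagram (forget_virtual P) (pattern F))"

text \<open>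
  Every virtual link diagram \<open>L\<close> has a representation: take \<open>forget_virtual L\<close> and glue one single
  region to all boundary circles.
\<close>

definition minimal_genus :: "diagram \<Rightarrow> nat" where
  "minimal_genus L = (LEAST g. \<exists>F. represents F L \<and> genus F = g)"

section \<open>The arrow polynomial\<close>

text \<open>
  The ring of polynomials over the integers in \<open>A\<close>, its inverse, and \<open>K\<^sub>1, K\<^sub>2, \<dots>\<close>:
  the exponent \<open>(k, \<mu>)\<close> stands for \<open>A\<^sup>k\<close> times the monomial in the \<open>K\<^sub>i\<close> with exponents \<open>\<mu>\<close>.
\<close>

type_synonym arrow_ring = "(int \<times> (nat \<Rightarrow>\<^sub>0 nat)) \<Rightarrow>\<^sub>0 int"

definition A_pow :: "int \<Rightarrow> arrow_ring" where
  "A_pow k = Poly_Mapping.single (k, 0) 1"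

definition K_var :: "nat \<Rightarrow> arrow_ring" where
  "K_var i = Poly_Mapping.single (0, Poly_Mapping.single i 1) 1"

definition d_poly :: arrow_ring where
  "d_poly = - A_pow 2 - A_pow (- 2)"

text \<open>
  A state is the set \<open>S\<close> of the classical crossings with the oriented smoothing. Arriving along
  (against) the orientation, one leaves on the other strand along (against) the orientation at an
  oriented smoothing and the opposite way at a disoriented one.
\<close>

definition states :: "diagram \<Rightarrow> crossing set set" where
  "states D = Pow (classical_crossings D)"

definition state_step :: "diagram \<Rightarrow> crossing set \<Rightarrow> nat \<times> bool \<Rightarrow> nat \<times> bool" where
  "state_step D S x =
     (case crossing_at D (head D x) of
        None \<Rightarrow> leave D (head D x) (snd x)
      | Some c \<Rightarrow>
          if ckind c = Virtual then leave D (head D x) (snd x)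
          else leave D (other c (head D x)) (snd x \<longleftrightarrow> c \<in> S))"

text \<open>A loop is given by the set of its arcs; every arc lies on exactly one loop.\<close>

definition loops :: "diagram \<Rightarrow> crossing set \<Rightarrow> nat set set" where
  "loops D S = (\<lambda>p. fst ` orbit (state_step D S) (p, True)) ` points D"

text \<open>
  The cusps, \<open>True\<close> for left and \<open>False\<close> for right, met at the end of a traversed arc. At a
  disoriented smoothing the path which arrives at \<open>pt1 c\<close> turns right, so that the other arc of the
  smoothing, to which the cusp points, is on its left; at \<open>pt2 c\<close> it is on its right.
\<close>

definition cusps :: "diagram \<Rightarrow> crossing set \<Rightarrow> nat \<times> bool \<Rightarrow> bool list" where
  "cusps D S x =
     (case crossing_at D (head D x) of
        None \<Rightarrow> []
      | Some c \<Rightarrow> if ckind c = Virtual \<or> c \<in> S then [] else [head D x = pt1 c])"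

text \<open>
  The cusps met during one traversal of the loop \<open>C\<close>. The choice of the starting arc \<open>Min C\<close> and of
  the direction does not matter for the cyclic reduction below.
\<close>

definition cusp_word :: "diagram \<Rightarrow> crossing set \<Rightarrow> nat set \<Rightarrow> bool list" where
  "cusp_word D S C = concat (map (cusps D S) (support (state_step D S) (Min C, True)))"

inductive cancel :: "bool list \<Rightarrow> bool list \<Rightarrow> bool" where
  inner: "cancel (u @ [s, s] @ v) (u @ v)"
| cyclic: "cancel ([s] @ v @ [s]) v"

definition cusps_left :: "bool list \<Rightarrow> nat" where
  "cusps_left w = (THE m. \<exists>w'. cancel\<^sup>*\<^sup>* w w' \<and> (\<nexists>w''. cancel w' w'') \<and> m = length w')"

definition arrow_number :: "diagram \<Rightarrow> crossing set \<Rightarrow> nat set \<Rightarrow> nat" where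
  "arrow_number D S C = cusps_left (cusp_word D S C) div 2"

definition loop_value :: "diagram \<Rightarrow> crossing set \<Rightarrow> nat set \<Rightarrow> arrow_ring" where
  "loop_value D S C = (if arrow_number D S C = 0 then 1 else K_var (arrow_number D S C))"

definition state_value :: "diagram \<Rightarrow> crossing set \<Rightarrow> arrow_ring" where
  "state_value D S = (\<Prod>C\<in>loops D S. loop_value D S C)"

definition coeff_exponent :: "diagram \<Rightarrow> crossing set \<Rightarrow> int" where
  "coeff_exponent D S =
     (\<Sum>c\<in>classical_crossings D. if (c \<in> S) = (ckind c = Positive) then 1 else - 1)"

definition arrow_polynomial :: "diagram \<Rightarrow> arrow_ring" where
  "arrow_polynomial D =
     (\<Sum>S\<in>states D.
        A_pow (coeff_exponent D S) * d_poly ^ (card (loops D S) - 1) * state_value D S)"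

text \<open>The polynomial has a summand \<open>c A\<^sup>m K\<^sub>i\<^sub>1 \<cdots> K\<^sub>i\<^sub>n\<close> with \<open>c \<noteq> 0\<close>.\<close>

definition has_K_summand :: "arrow_ring \<Rightarrow> nat \<Rightarrow> (nat \<Rightarrow> nat) \<Rightarrow> bool" where
  "has_K_summand f n i \<longleftrightarrow>
     (\<exists>m. Poly_Mapping.lookup f (m, \<Sum>j\<in>{1..n}. Poly_Mapping.single (i j) 1) \<noteq> 0)"

end

theory Submission
  imports Defs
begin

text \<open>
  Two facts combine. First, the polynomial changes only by a unit
  \<open>\<plusminus>A\<^sup>k\<close> under the moves, so the monomials in the
  \<open>K\<^sub>i\<close> that occur in it belong to the virtual link, and \<open>L\<close> may
  be replaced by the pattern of a surface diagram of minimal genus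
  (\<open>K_occurs_representation\<close>). Secondly, on a surface the loops of a state are
  disjoint simple closed curves, and twice the arrow number of a loop is, up to sign, the sum of
  its cusps counted with a sign, a homological quantity. A monomial
  \<open>K\<^sub>i\<^sub>1\<cdots>K\<^sub>i\<^sub>n\<close> with distinct indices therefore
  provides \<open>n\<close> disjoint loops with distinct non-zero arrow numbers.

  Cut the surface along these \<open>n\<close> loops. The signed cusp sums of the boundary
  circles of a piece add up to zero. Every piece has a boundary circle, since the surface is
  connected and \<open>n \<ge> 1\<close>; none has just one, and if a piece has two, these have
  the same arrow number, so they are the two sides of one loop; such a piece is glued to nothing
  but itself, and \<open>n = 1\<close> because the surface is connected. Otherwise each of the
  \<open>V\<close> pieces has at least three of the \<open>2n\<close> circles, \<open>3V \<le>
  2n\<close>. The Euler characteristic is additive and that of a piece is at most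
  \<open>2\<close> minus the number of its circles, so \<open>2 - 2g \<le> 2V - 2n\<close>, and
  the two inequalities give \<open>n + 3 \<le> 3g\<close> (\<open>genus_bound_state\<close>). In
  the exceptional case \<open>V = n = 1\<close> and \<open>g \<ge> 1\<close>.

  For the invariance a state is described by two fixed-point free involutions on the ends of the
  arcs, one running along the arcs and one through the smoothings. The cusps, which depend on
  the state, are turned into the increments along the arcs of one integer potential on the ends,
  which does not (\<open>potential_smoothing\<close>). If the potential is level along an arc,
  the arc can be shrunk to a point (\<open>loop_product_bypass\<close>), and shrinking the arcs
  inside the disc of a Reidemeister move leaves exactly Kauffman's calculations for the
  unoriented bracket (\<open>kink_local\<close>, \<open>bigon_local\<close>,
  \<open>slide_local\<close>, \<open>triangle_local\<close>). The potentials of the two diagrams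
  of a move differ, but only by amounts that are invisible to every loop
  (\<open>loop_product_potential\<close>).

  For the surface, the components of a complement are encoded as labels of the directed arcs,
  constant along the boundary circles. The complement of the loops of a state arises from the
  regions of the diagram by adding one band at each crossing (\<open>cut_labels\<close>), and
  gluing the two sides of an unwanted loop joins two labels at most
  (\<open>join_loop_sides\<close>). All that is needed of Euler characteristics is that a band
  lowers twice the number of components minus the number of circles by at most one
  (\<open>band_euler\<close>).
\<close>

section \<open>Cycles of a permutation of a finite set\<close>

lemma orbit_subset_closed:
  assumes "T ` E \<subseteq> E" "e \<in> E"
  shows "orbit T e \<subseteq> E"
proof
  fix y assume "y \<in> orbit T e"
  then show "y \<in> E" by induct (use assms in auto)
qed

lemma orbit_subset_bij: "bij_betw T E E \<Longrightarrow> e \<in> E \<Longrightarrow> orbit T e \<subseteq> E"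
  by (rule orbit_subset_closed) (auto simp: bij_betw_def)

lemma self_in_orbit:
  assumes "finite E" "bij_betw T E E" "e \<in> E"
  shows "e \<in> orbit T e"
proof -
  let ?g = "perm_restrict T E"
  have "bij_betw ?g E E"
    using assms(2) by (subst bij_betw_cong[of _ _ T]) (auto simp: perm_restrict_def)
  then have "?g permutes E" by (rule bij_imp_permutes) (auto simp: perm_restrict_def)
  then have "e \<in> orbit ?g e"
    using assms(1) by (intro permutation_self_in_orbit) (auto simp: permutation_permutes)
  also have "orbit ?g e = orbit T e"
    using assms by (intro orbit_cong0[of _ E]) (auto simp: perm_restrict_def bij_betw_def)
  finally show ?thesis .
qed

lemma orbit_eq_if_mem:
  assumes "finite E" "bij_betw T E E" "e \<in> E" "y \<in> orbit T e"
  shows "orbit T y = orbit T e"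
  using self_in_orbit[OF assms(1-3)] assms(4) by (meson orbit_swap orbit_trans subset_antisym subsetI)

lemma bij_betw_orbit:
  assumes "finite E" "bij_betw T E E" "e \<in> E"
  shows "bij_betw T (orbit T e) (orbit T e)"
proof -
  have sub: "orbit T e \<subseteq> E" by (rule orbit_subset_bij[OF assms(2,3)])
  have "inj_on T (orbit T e)" using assms(2) sub by (auto simp: bij_betw_def intro: inj_on_subset)
  moreover have "T ` orbit T e \<subseteq> orbit T e" by (auto intro: orbit.step)
  ultimately show ?thesis
    using endo_inj_surj[of "orbit T e" T] finite_subset[OF sub assms(1)] by (simp add: bij_betw_def)
qed

lemma sum_orbit_shift:
  assumes "finite E" "bij_betw T E E" "e \<in> E"
  shows "(\<Sum>x\<in>orbit T e. g (T x)) = (\<Sum>x\<in>orbit T e. g x)"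
  by (rule sum.reindex_bij_betw[OF bij_betw_orbit[OF assms]])

section \<open>Closed curves assembled from two pairings\<close>

definition pairing :: "'a set \<Rightarrow> ('a \<Rightarrow> 'a) \<Rightarrow> bool" where
  "pairing E \<mu> \<longleftrightarrow> (\<forall>e\<in>E. \<mu> e \<in> E \<and> \<mu> e \<noteq> e \<and> \<mu> (\<mu> e) = e)"

definition strands :: "'a set \<Rightarrow> ('a \<Rightarrow> 'a) \<Rightarrow> ('a \<Rightarrow> 'a) \<Rightarrow> bool" where
  "strands E \<alpha> \<mu> \<longleftrightarrow> finite E \<and> pairing E \<alpha> \<and> pairing E \<mu>"

text \<open>
  With \<open>\<alpha>\<close> running along the arcs and \<open>\<mu>\<close> through the
  smoothings, the orbit of \<open>\<alpha> \<circ> \<mu>\<close> consists of the ends at which a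
  traveller arrives. The ends of departure are included so that both directions of travel
  describe the same curve.
\<close>

definition loop_through :: "('a \<Rightarrow> 'a) \<Rightarrow> ('a \<Rightarrow> 'a) \<Rightarrow> 'a \<Rightarrow> 'a set" where
  "loop_through \<alpha> \<mu> e = orbit (\<alpha> \<circ> \<mu>) e \<union> \<alpha> ` orbit (\<alpha> \<circ> \<mu>) e"

text \<open>
  The increments of the potential \<open>u\<close> along the arcs stand for signed cusps.
  Reversing the direction changes the sign of the sum and the starting point is irrelevant,
  which justifies the absolute value and the arbitrary choice.
\<close>

definition turning :: "('a \<Rightarrow> 'a) \<Rightarrow> ('a \<Rightarrow> 'a) \<Rightarrow> ('a \<Rightarrow> int) \<Rightarrow> 'a set \<Rightarrow> int" where
  "turning \<alpha> \<mu> u C = \<bar>\<Sum>x\<in>orbit (\<alpha> \<circ> \<mu>) (SOME e. e \<in> C). u (\<alpha> x) - u x\<bar>"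

definition loop_product ::
    "(int \<Rightarrow> 'r::comm_monoid_mult) \<Rightarrow> 'a set \<Rightarrow> ('a \<Rightarrow> 'a) \<Rightarrow> ('a \<Rightarrow> 'a) \<Rightarrow> ('a \<Rightarrow> int) \<Rightarrow> 'r" where
  "loop_product f E \<alpha> \<mu> u = (\<Prod>C\<in>loop_through \<alpha> \<mu> ` E. f (turning \<alpha> \<mu> u C))"

lemma pairing_bij: "pairing E \<mu> \<Longrightarrow> bij_betw \<mu> E E"
  by (rule bij_betwI[of _ _ _ \<mu>]) (auto simp: pairing_def)

lemma walk_bij: "strands E \<alpha> \<mu> \<Longrightarrow> bij_betw (\<alpha> \<circ> \<mu>) E E"
  unfolding strands_def by (meson bij_betw_trans pairing_bij)

text \<open>Walking backwards exchanges the ends of arrival and the ends of departure.\<close>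

lemma walk_reverse:
  assumes "strands E \<alpha> \<mu>" "e \<in> E"
  shows "orbit (\<alpha> \<circ> \<mu>) (\<alpha> e) = \<alpha> ` orbit (\<alpha> \<circ> \<mu>) e"
proof -
  let ?T = "\<alpha> \<circ> \<mu>"
  have fin: "finite E" and \<alpha>: "\<And>e. e \<in> E \<Longrightarrow> \<alpha> e \<in> E \<and> \<alpha> (\<alpha> e) = e"
    and \<mu>: "\<And>e. e \<in> E \<Longrightarrow> \<mu> e \<in> E \<and> \<mu> (\<mu> e) = e"
    using assms by (auto simp: strands_def pairing_def)
  note bij = walk_bij[OF assms(1)]
  have turned: "\<alpha> (?T y) \<in> orbit ?T (\<alpha> y)" if "y \<in> E" for y
  proof -
    have "?T (\<alpha> (?T y)) = \<alpha> y" using that \<alpha> \<mu> by simp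
    then have "\<alpha> y \<in> orbit ?T (\<alpha> (?T y))" by (metis orbit.base)
    with orbit_eq_if_mem[OF fin bij _ this] self_in_orbit[OF fin bij, of "\<alpha> (?T y)"]
    show ?thesis using that \<alpha> \<mu> by simp
  qed
  have one: "\<alpha> ` orbit ?T e \<subseteq> orbit ?T (\<alpha> e)" if e: "e \<in> E" for e
  proof (clarify)
    fix y assume "y \<in> orbit ?T e"
    then show "\<alpha> y \<in> orbit ?T (\<alpha> e)"
    proof induct
      case base then show ?case by (rule turned[OF e])
    next
      case (step y)
      then have "y \<in> E" using orbit_subset_bij[OF bij e] by auto
      from turned[OF this] step(2) show ?case by (rule orbit_trans)
    qed
  qed
  have "orbit ?T (\<alpha> e) \<subseteq> \<alpha> ` orbit ?T e"
  proof
    fix y assume y: "y \<in> orbit ?T (\<alpha> e)"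
    then have "y \<in> E" using orbit_subset_bij[OF bij, of "\<alpha> e"] \<alpha> assms(2) by auto
    moreover have "\<alpha> y \<in> orbit ?T e" using one[of "\<alpha> e"] \<alpha> assms(2) y by auto
    ultimately show "y \<in> \<alpha> ` orbit ?T e" using \<alpha> by (metis imageI)
  qed
  with one[OF assms(2)] show ?thesis by auto
qed

lemma loop_through_subset:
  assumes "strands E \<alpha> \<mu>" "e \<in> E"
  shows "loop_through \<alpha> \<mu> e \<subseteq> E"
  using orbit_subset_bij[OF walk_bij[OF assms(1)] assms(2)] assms(1)
  by (auto simp: loop_through_def strands_def pairing_def)

lemma mem_loop_through:
  assumes "strands E \<alpha> \<mu>" "e \<in> E"
  shows "e \<in> loop_through \<alpha> \<mu> e"
  using self_in_orbit[OF _ walk_bij[OF assms(1)] assms(2)] assms(1)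
  by (auto simp: loop_through_def strands_def)

lemma orbit_in_loop:
  assumes "strands E \<alpha> \<mu>" "e \<in> E" "e' \<in> loop_through \<alpha> \<mu> e"
  shows "orbit (\<alpha> \<circ> \<mu>) e' = orbit (\<alpha> \<circ> \<mu>) e \<or>
         orbit (\<alpha> \<circ> \<mu>) e' = \<alpha> ` orbit (\<alpha> \<circ> \<mu>) e"
proof -
  let ?T = "\<alpha> \<circ> \<mu>"
  have fin: "finite E" using assms(1) by (simp add: strands_def)
  note bij = walk_bij[OF assms(1)]
  consider "e' \<in> orbit ?T e" | y where "y \<in> orbit ?T e" "e' = \<alpha> y"
    using assms(3) by (auto simp: loop_through_def)
  then show ?thesis
  proof cases
    case 1 then show ?thesis using orbit_eq_if_mem[OF fin bij assms(2)] by simp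
  next
    case 2
    then have "y \<in> E" using orbit_subset_bij[OF bij assms(2)] by auto
    then show ?thesis
      using walk_reverse[OF assms(1)] orbit_eq_if_mem[OF fin bij assms(2) 2(1)] 2(2) by simp
  qed
qed

lemma involution_image_image:
  assumes "pairing E \<alpha>" "O' \<subseteq> E"
  shows "\<alpha> ` \<alpha> ` O' = O'"
  using assms by (force simp: pairing_def image_image subset_iff)

lemma loop_through_eq:
  assumes "strands E \<alpha> \<mu>" "e \<in> E" "e' \<in> loop_through \<alpha> \<mu> e"
  shows "loop_through \<alpha> \<mu> e' = loop_through \<alpha> \<mu> e"
  using orbit_in_loop[OF assms] involution_image_image[of E \<alpha> "orbit (\<alpha> \<circ> \<mu>) e"]
    orbit_subset_bij[OF walk_bij[OF assms(1)] assms(2)] assms(1)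
  by (auto simp: loop_through_def strands_def)

lemma turning_loop:
  assumes st: "strands E \<alpha> \<mu>" and e: "e \<in> E"
  shows "turning \<alpha> \<mu> u (loop_through \<alpha> \<mu> e) = \<bar>\<Sum>x\<in>orbit (\<alpha> \<circ> \<mu>) e. u (\<alpha> x) - u x\<bar>"
proof -
  let ?T = "\<alpha> \<circ> \<mu>"
  define e' where "e' = (SOME x. x \<in> loop_through \<alpha> \<mu> e)"
  have "e' \<in> loop_through \<alpha> \<mu> e"
    unfolding e'_def using mem_loop_through[OF st e] by (rule someI)
  from orbit_in_loop[OF st e this] consider "orbit ?T e' = orbit ?T e"
    | "orbit ?T e' = \<alpha> ` orbit ?T e" by blast
  then have "\<bar>\<Sum>x\<in>orbit ?T e'. u (\<alpha> x) - u x\<bar> = \<bar>\<Sum>x\<in>orbit ?T e. u (\<alpha> x) - u x\<bar>"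
  proof cases
    case 2
    have sub: "orbit ?T e \<subseteq> E" by (rule orbit_subset_bij[OF walk_bij[OF st] e])
    have \<alpha>: "\<And>e. e \<in> E \<Longrightarrow> \<alpha> (\<alpha> e) = e" using st by (auto simp: strands_def pairing_def)
    have inj: "inj_on \<alpha> (orbit ?T e)" using sub \<alpha> by (metis inj_on_def subsetD)
    have "(\<Sum>x\<in>orbit ?T e'. u (\<alpha> x) - u x) = (\<Sum>x\<in>orbit ?T e. - (u (\<alpha> x) - u x))"
      unfolding 2 sum.reindex[OF inj] using sub \<alpha> by (intro sum.cong) auto
    then show ?thesis by (simp only: sum_negf abs_minus_cancel)
  qed simp
  then show ?thesis by (simp add: turning_def e'_def)
qed

lemma turning_of_member:
  assumes "strands E \<alpha> \<mu>" "C \<in> loop_through \<alpha> \<mu> ` E" "e \<in> C"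
  shows "turning \<alpha> \<mu> u C = \<bar>\<Sum>x\<in>orbit (\<alpha> \<circ> \<mu>) e. u (\<alpha> x) - u x\<bar>"
proof -
  obtain e0 where e0: "e0 \<in> E" "C = loop_through \<alpha> \<mu> e0" using assms(2) by auto
  then have "C = loop_through \<alpha> \<mu> e" "e \<in> E"
    using loop_through_eq[OF assms(1), of e0 e] loop_through_subset[OF assms(1), of e0] assms(3) by auto
  then show ?thesis using turning_loop[OF assms(1)] by simp
qed

lemma loop_product_iso:
  assumes st: "strands E \<alpha> \<mu>" and h: "bij_betw h E E'"
    and \<alpha>: "\<And>e. e \<in> E \<Longrightarrow> \<alpha>' (h e) = h (\<alpha> e)" and \<mu>: "\<And>e. e \<in> E \<Longrightarrow> \<mu>' (h e) = h (\<mu> e)"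
    and u: "\<And>e. e \<in> E \<Longrightarrow> u' (h e) = u e"
  shows "loop_product f E' \<alpha>' \<mu>' u' = loop_product f E \<alpha> \<mu> u"
proof -
  have inj: "inj_on h E" and E': "E' = h ` E" using h by (auto simp: bij_betw_def)
  have st': "strands E' \<alpha>' \<mu>'"
    using st inj \<alpha> \<mu> unfolding strands_def pairing_def E' by (auto simp: inj_on_eq_iff)
  have inE: "orbit (\<alpha> \<circ> \<mu>) e \<subseteq> E" if "e \<in> E" for e
    by (rule orbit_subset_bij[OF walk_bij[OF st] that])
  have orb: "orbit (\<alpha>' \<circ> \<mu>') (h e) = h ` orbit (\<alpha> \<circ> \<mu>) e" if e: "e \<in> E" for e
  proof (rule orbit_inverse[symmetric])
    show "e \<in> orbit (\<alpha> \<circ> \<mu>) e"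
      using self_in_orbit[OF _ walk_bij[OF st] e] st by (auto simp: strands_def)
    show "(\<alpha>' \<circ> \<mu>') (h x) = h ((\<alpha> \<circ> \<mu>) x)" if "x \<in> orbit (\<alpha> \<circ> \<mu>) e" for x
    proof -
      have "x \<in> E" "\<mu> x \<in> E" using that inE[OF e] st by (auto simp: strands_def pairing_def)
      then show ?thesis using \<alpha> \<mu> by simp
    qed
  qed
  have loop: "loop_through \<alpha>' \<mu>' (h e) = h ` loop_through \<alpha> \<mu> e" if e: "e \<in> E" for e
    unfolding loop_through_def orb[OF e] using inE[OF e] \<alpha>
    by (force simp: image_Un image_image)
  have loops: "loop_through \<alpha>' \<mu>' ` E' = (`) h ` (loop_through \<alpha> \<mu> ` E)"
    unfolding E' using loop by (force simp: image_image)
  have inj': "inj_on ((`) h) (loop_through \<alpha> \<mu> ` E)"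
    using loop_through_subset[OF st] inj by (force intro!: inj_onI simp: inj_on_image_eq_iff)
  have turn: "turning \<alpha>' \<mu>' u' (h ` C) = turning \<alpha> \<mu> u C" if C: "C \<in> loop_through \<alpha> \<mu> ` E" for C
  proof -
    obtain e where e: "e \<in> E" "C = loop_through \<alpha> \<mu> e" using C by auto
    have "(\<Sum>x\<in>orbit (\<alpha>' \<circ> \<mu>') (h e). u' (\<alpha>' x) - u' x) = (\<Sum>x\<in>orbit (\<alpha> \<circ> \<mu>) e. u (\<alpha> x) - u x)"
      unfolding orb[OF e(1)]
      by (subst sum.reindex[OF inj_on_subset[OF inj inE[OF e(1)]]], rule sum.cong)
         (use inE[OF e(1)] \<alpha> u st in \<open>auto simp: strands_def pairing_def subset_iff\<close>)
    then show ?thesis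
      using turning_loop[OF st e(1)] turning_loop[OF st', of "h e"] loop[OF e(1)] e E' by simp
  qed
  show ?thesis
    unfolding loop_product_def loops prod.reindex[OF inj'] by (rule prod.cong) (auto simp: turn)
qed

lemma loop_product_cong:
  assumes "strands E \<alpha> \<mu>"
    and "\<And>e. e \<in> E \<Longrightarrow> \<mu>' e = \<mu> e" "\<And>e. e \<in> E \<Longrightarrow> u' e = u e"
  shows "loop_product f E \<alpha> \<mu>' u' = loop_product f E \<alpha> \<mu> u"
  by (rule loop_product_iso[OF assms(1), of id]) (use assms in auto)

text \<open>
  A summand that is constant across every smoothing telescopes along each closed curve.
\<close>

lemma loop_product_gauge:
  assumes st: "strands E \<alpha> \<mu>" and g: "\<And>e. e \<in> E \<Longrightarrow> g (\<mu> e) = g e"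
  shows "loop_product f E \<alpha> \<mu> (\<lambda>e. u e + g e) = loop_product f E \<alpha> \<mu> u"
proof -
  let ?T = "\<alpha> \<circ> \<mu>"
  have "turning \<alpha> \<mu> (\<lambda>e. u e + g e) C = turning \<alpha> \<mu> u C" if C: "C \<in> loop_through \<alpha> \<mu> ` E" for C
  proof -
    obtain e where e: "e \<in> E" "C = loop_through \<alpha> \<mu> e" using C by auto
    have fin: "finite E" using st by (simp add: strands_def)
    have inE: "orbit ?T e \<subseteq> E" by (rule orbit_subset_bij[OF walk_bij[OF st] e(1)])
    have "(\<Sum>x\<in>orbit ?T e. g (\<alpha> x)) = (\<Sum>x\<in>orbit ?T e. g (\<alpha> (?T x)))"
      by (rule sum_orbit_shift[OF fin walk_bij[OF st] e(1), symmetric])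
    also have "\<dots> = (\<Sum>x\<in>orbit ?T e. g x)"
      using inE st g by (intro sum.cong) (auto simp: strands_def pairing_def subset_iff)
    finally have "(\<Sum>x\<in>orbit ?T e. u (\<alpha> x) + g (\<alpha> x) - (u x + g x)) =
                  (\<Sum>x\<in>orbit ?T e. u (\<alpha> x) - u x)"
      by (simp add: sum.distrib sum_subtractf)
    then show ?thesis using turning_loop[OF st e(1)] e(2) by simp
  qed
  then show ?thesis unfolding loop_product_def by (intro prod.cong) auto
qed

text \<open>
  Only increments along arcs are visible, so besides adding \<open>g\<close> one may alter the
  potential freely at both ends of the arcs in \<open>I\<close>, as long as these arcs stay
  level. This is what compares the potentials of two diagrams that differ by a move:
  \<open>I\<close> consists of the ends of the arcs inside its disc.
\<close>

lemma loop_product_potential: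
  assumes st: "strands E \<alpha> \<mu>" and g: "\<And>e. e \<in> E \<Longrightarrow> g (\<mu> e) = g e"
    and I: "I \<subseteq> E" "\<And>e. e \<in> I \<Longrightarrow> \<alpha> e \<in> I \<and> u' (\<alpha> e) = u' e \<and> u (\<alpha> e) + g (\<alpha> e) = u e + g e"
    and out: "\<And>e. e \<in> E - I \<Longrightarrow> u' e = u e + g e"
  shows "loop_product f E \<alpha> \<mu> u' = loop_product f E \<alpha> \<mu> u"
proof -
  have pair: "pairing E \<alpha>" using st by (simp add: strands_def)
  have *: "u' (\<alpha> e) - u' e = (u (\<alpha> e) + g (\<alpha> e)) - (u e + g e)" if "e \<in> E" for e
  proof (cases "e \<in> I")
    case True then show ?thesis using I(2)[OF True] by simp
  next
    case False
    then have "\<alpha> e \<in> E - I" using pair \<open>e \<in> E\<close> I(2) by (metis Diff_iff pairing_def)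
    then show ?thesis using out[of e] out[of "\<alpha> e"] False \<open>e \<in> E\<close> by simp
  qed
  have "turning \<alpha> \<mu> u' C = turning \<alpha> \<mu> (\<lambda>e. u e + g e) C" if C: "C \<in> loop_through \<alpha> \<mu> ` E" for C
  proof -
    obtain e where e: "e \<in> E" "C = loop_through \<alpha> \<mu> e" using C by auto
    have "(\<Sum>x\<in>orbit (\<alpha> \<circ> \<mu>) e. u' (\<alpha> x) - u' x) =
          (\<Sum>x\<in>orbit (\<alpha> \<circ> \<mu>) e. (u (\<alpha> x) + g (\<alpha> x)) - (u x + g x))"
      using orbit_subset_bij[OF walk_bij[OF st] e(1)] * by (intro sum.cong) auto
    then show ?thesis using turning_loop[OF st e(1)] e(2) by simp
  qed
  then have "loop_product f E \<alpha> \<mu> u' = loop_product f E \<alpha> \<mu> (\<lambda>e. u e + g e)"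
    unfolding loop_product_def by (intro prod.cong) auto
  then show ?thesis using loop_product_gauge[of E \<alpha> \<mu> g f u] st g by simp
qed

text \<open>
  The pairing that remains when the arc with the ends \<open>a\<close> and \<open>b\<close> is
  shrunk to a point: the former partners of \<open>a\<close> and \<open>b\<close> become
  partners of each other.
\<close>

definition bypass :: "'a \<Rightarrow> 'a \<Rightarrow> ('a \<Rightarrow> 'a) \<Rightarrow> 'a \<Rightarrow> 'a" where
  "bypass a b \<mu> e = (if \<mu> e = a then \<mu> b else if \<mu> e = b then \<mu> a else \<mu> e)"

lemma strands_bypass:
  assumes "strands E \<alpha> \<mu>" "a \<in> E" "b = \<alpha> a"
  shows "strands (E - {a, b}) \<alpha> (bypass a b \<mu>)"
proof -
  have fin: "finite E" and \<alpha>: "\<And>e. e \<in> E \<Longrightarrow> \<alpha> e \<in> E \<and> \<alpha> e \<noteq> e \<and> \<alpha> (\<alpha> e) = e"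
    and \<mu>: "\<And>e. e \<in> E \<Longrightarrow> \<mu> e \<in> E \<and> \<mu> e \<noteq> e \<and> \<mu> (\<mu> e) = e"
    using assms by (auto simp: strands_def pairing_def)
  have b: "b \<in> E" "\<alpha> b = a" "a \<noteq> b" using \<alpha>[OF assms(2)] assms(3) by auto
  have "pairing (E - {a, b}) \<alpha>"
    unfolding pairing_def using \<alpha> b assms(3) by (metis DiffD1 DiffD2 DiffI insert_iff singletonD)
  moreover have "pairing (E - {a, b}) (bypass a b \<mu>)"
    unfolding pairing_def
  proof
    fix e assume e: "e \<in> E - {a, b}"
    note m = \<mu>[of e] \<mu>[of a] \<mu>[of b]
    consider "\<mu> e = a" | "\<mu> e = b" | "\<mu> e \<noteq> a" "\<mu> e \<noteq> b" by blast
    then show "bypass a b \<mu> e \<in> E - {a, b} \<and> bypass a b \<mu> e \<noteq> e \<and>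
        bypass a b \<mu> (bypass a b \<mu> e) = e"
    proof cases
      case 1
      then have "\<mu> a = e" using m e by auto
      then have "\<mu> b \<noteq> a" "\<mu> b \<noteq> e" using m e b assms(2) by auto
      then show ?thesis using 1 m e b assms(2) \<open>\<mu> a = e\<close> by (auto simp: bypass_def)
    next
      case 2
      then have "\<mu> b = e" using m e by auto
      then have "\<mu> a \<noteq> b" "\<mu> a \<noteq> e" using m e b assms(2) by auto
      then show ?thesis using 2 m e b assms(2) \<open>\<mu> b = e\<close> by (auto simp: bypass_def)
    next
      case 3
      then show ?thesis using m e b assms(2) by (auto simp: bypass_def)
    qed
  qed
  ultimately show ?thesis using fin by (simp add: strands_def)
qed

text \<open>
  A level arc contributes nothing to the turning, so shrinking it preserves every curve that
  contains a further arc. If \<open>\<mu>\<close> joins its two ends, the arc by itself is a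
  circle of turning zero and disappears with the factor \<open>f 0\<close>.
\<close>

lemma loop_product_bypass:
  assumes st: "strands E \<alpha> \<mu>" and a: "a \<in> E" and b: "b = \<alpha> a" and u: "u a = u b"
  shows "loop_product f E \<alpha> \<mu> u =
    (if \<mu> a = b then f 0 else 1) * loop_product f (E - {a, b}) \<alpha> (bypass a b \<mu>) u"
proof -
  define \<nu> where "\<nu> = bypass a b \<mu>"
  define E' where "E' = E - {a, b}"
  let ?T = "\<alpha> \<circ> \<mu>" and ?T' = "\<alpha> \<circ> \<nu>"
  have st': "strands E' \<alpha> \<nu>" unfolding E'_def \<nu>_def by (rule strands_bypass[OF st a b])
  have fin: "finite E" and \<alpha>: "\<And>e. e \<in> E \<Longrightarrow> \<alpha> e \<in> E \<and> \<alpha> e \<noteq> e \<and> \<alpha> (\<alpha> e) = e"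
    and \<mu>: "\<And>e. e \<in> E \<Longrightarrow> \<mu> e \<in> E \<and> \<mu> e \<noteq> e \<and> \<mu> (\<mu> e) = e"
    using st by (auto simp: strands_def pairing_def)
  have bE: "b \<in> E" "\<alpha> b = a" "a \<noteq> b" using \<alpha>[OF a] b by auto
  have TE: "?T e \<in> E" if "e \<in> E" for e using that \<alpha> \<mu> by simp
  have step_eq: "?T' e = (if ?T e \<in> {a, b} then ?T (?T e) else ?T e)" if "e \<in> E'" for e
  proof -
    have "e \<in> E" using that by (simp add: E'_def)
    then have "\<mu> e \<in> E" using \<mu> by blast
    then have "?T e = a \<longleftrightarrow> \<mu> e = b" "?T e = b \<longleftrightarrow> \<mu> e = a"
      using \<alpha> bE b a by (metis comp_apply)+
    then show ?thesis using bE b by (auto simp: \<nu>_def bypass_def)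
  qed
  have Tab: "?T a \<noteq> b" "?T b \<noteq> a"
    using \<alpha> \<mu> a b bE by (metis comp_apply)+
  (* The shortened walk makes the same visits, jumping over \<open>a\<close> and
     \<open>b\<close>. *)
  have orb: "orbit ?T' e = orbit ?T e - {a, b}" if e: "e \<in> E'" for e
  proof
    show "orbit ?T' e \<subseteq> orbit ?T e - {a, b}"
    proof
      fix y assume y: "y \<in> orbit ?T' e"
      have sub: "orbit ?T' e \<subseteq> E'" by (rule orbit_subset_bij[OF walk_bij[OF st'] e])
      from y have "y \<in> orbit ?T e"
      proof induct
        case base
        show ?case using step_eq[OF e] by (metis (full_types) orbit.simps)
      next
        case (step y)
        then have "y \<in> E'" using sub by auto
        then show ?case using step(2) step_eq by (metis (full_types) orbit.simps)
      qed
      then show "y \<in> orbit ?T e - {a, b}" using sub y by (auto simp: E'_def)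
    qed
    have "(?T ^^ n) e \<notin> {a, b} \<Longrightarrow> n > 0 \<Longrightarrow> (?T ^^ n) e \<in> orbit ?T' e" for n
    proof (induct n rule: less_induct)
      case (less n)
      have inE: "(?T ^^ k) e \<in> E" for k
        using e TE by (induct k) (auto simp: E'_def)
      obtain k where k: "n = Suc k" using less(3) by (cases n) auto
      let ?y = "(?T ^^ k) e"
      have z: "?T ?y = (?T ^^ n) e" by (simp add: k)
      show ?case
      proof (cases "?y \<in> {a, b}")
        case False
        then have "?y \<in> E'" using inE by (simp add: E'_def)
        then have s: "?T' ?y = (?T ^^ n) e" using step_eq[of ?y] less(2) unfolding z by (simp only: if_False)
        show ?thesis
        proof (cases k)
          case 0 then show ?thesis using s by (metis funpow_0 orbit.base)
        next
          case (Suc l)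
          then have "k < n" "0 < k" using k by simp_all
          from less(1)[OF this(1) False this(2)] have "?y \<in> orbit ?T' e" .
          then show ?thesis using s by (metis orbit.step)
        qed
      next
        case True
        then obtain l where l: "k = Suc l" using e by (cases k) (auto simp: E'_def)
        let ?w = "(?T ^^ l) e"
        have w: "?T ?w = ?y" by (simp add: l)
        have "?w \<notin> {a, b}" using True w z Tab less(2) by (metis insert_iff singletonD)
        then have "?w \<in> E'" using inE by (simp add: E'_def)
        then have s: "?T' ?w = (?T ^^ n) e" using step_eq[of ?w] True unfolding w z by (simp only: if_True)
        show ?thesis
        proof (cases l)
          case 0 then show ?thesis using s by (metis funpow_0 orbit.base)
        next
          case (Suc m)
          then have "l < n" "0 < l" using k l by simp_all
          from less(1)[OF this(1) \<open>?w \<notin> {a, b}\<close> this(2)] have "?w \<in> orbit ?T' e" .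
          then show ?thesis using s by (metis orbit.step)
        qed
      qed
    qed
    then show "orbit ?T e - {a, b} \<subseteq> orbit ?T' e" by (auto simp: orbit_altdef)
  qed
  have loop: "loop_through \<alpha> \<nu> e = loop_through \<alpha> \<mu> e - {a, b}" if e: "e \<in> E'" for e
  proof -
    have "orbit ?T e \<subseteq> E" using orbit_subset_bij[OF walk_bij[OF st]] e by (simp add: E'_def)
    then have "\<alpha> ` (orbit ?T e - {a, b}) = \<alpha> ` orbit ?T e - {a, b}"
      using \<alpha> bE b by (auto simp: subset_iff) (metis imageI)+
    then show ?thesis unfolding loop_through_def orb[OF e] by auto
  qed
  have turn: "turning \<alpha> \<nu> u (loop_through \<alpha> \<mu> e - {a, b}) = turning \<alpha> \<mu> u (loop_through \<alpha> \<mu> e)"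
    if e: "e \<in> E'" for e
  proof -
    have eE: "e \<in> E" using e by (simp add: E'_def)
    have "finite (orbit ?T e)"
      using orbit_subset_bij[OF walk_bij[OF st] eE] fin finite_subset by blast
    then have "(\<Sum>x\<in>orbit ?T e - {a, b}. u (\<alpha> x) - u x) = (\<Sum>x\<in>orbit ?T e. u (\<alpha> x) - u x)"
      by (intro sum.mono_neutral_left) (use u b bE in auto)
    then show ?thesis
      using turning_loop[OF st' e] turning_loop[OF st eE] loop[OF e] orb[OF e] by simp
  qed
  let ?L = "loop_through \<alpha> \<mu> ` E'"
  have inj: "inj_on (\<lambda>C. C - {a, b}) ?L"
  proof (rule inj_onI)
    fix C C' assume C: "C \<in> ?L" "C' \<in> ?L" "C - {a, b} = C' - {a, b}"
    then obtain e e' where e: "e \<in> E'" "C = loop_through \<alpha> \<mu> e" "e' \<in> E'" "C' = loop_through \<alpha> \<mu> e'"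
      by auto
    then have "e \<in> C - {a, b}" using mem_loop_through[OF st, of e] by (auto simp: E'_def)
    then have "e \<in> loop_through \<alpha> \<mu> e'" using C(3) e by auto
    then show "C = C'" using loop_through_eq[OF st, of e' e] e by (auto simp: E'_def)
  qed
  have "loop_through \<alpha> \<nu> ` E' = (\<lambda>C. C - {a, b}) ` ?L"
    using loop by (force simp: image_image)
  then have "loop_product f E' \<alpha> \<nu> u = (\<Prod>C\<in>?L. f (turning \<alpha> \<nu> u (C - {a, b})))"
    by (simp add: loop_product_def prod.reindex[OF inj])
  also have "\<dots> = (\<Prod>C\<in>?L. f (turning \<alpha> \<mu> u C))"
    by (intro prod.cong) (auto simp: turn)
  finally have reduced: "loop_product f E' \<alpha> \<nu> u = (\<Prod>C\<in>?L. f (turning \<alpha> \<mu> u C))" .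
  have "b \<in> loop_through \<alpha> \<mu> a"
    using self_in_orbit[OF fin walk_bij[OF st] a] b by (auto simp: loop_through_def)
  then have ab: "loop_through \<alpha> \<mu> b = loop_through \<alpha> \<mu> a" by (rule loop_through_eq[OF st a])
  have "E = insert a (insert b E')" using a bE by (auto simp: E'_def)
  then have all: "loop_through \<alpha> \<mu> ` E = insert (loop_through \<alpha> \<mu> a) ?L" using ab by auto
  show ?thesis
  proof (cases "\<mu> a = b")
    case True
    then have fixed: "?T a = a" using bE by simp
    then have o: "orbit ?T a = {a}" by (simp only: orbit_eq_singleton_iff)
    then have la: "loop_through \<alpha> \<mu> a = {a, b}" using b by (auto simp: loop_through_def)
    moreover have "{a, b} \<notin> ?L" using mem_loop_through[OF st] by (force simp: E'_def)
    moreover have "turning \<alpha> \<mu> u {a, b} = 0"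
      using turning_loop[OF st a, of u] la o u b by simp
    ultimately show ?thesis
      using True reduced all fin unfolding E'_def[symmetric] \<nu>_def[symmetric]
      by (simp add: loop_product_def E'_def)
  next
    case False
    then have "\<mu> a \<in> E'" using \<mu>[OF a] by (auto simp: E'_def)
    have "?T a \<in> orbit ?T a" by (rule orbit.base)
    then have "\<alpha> (?T a) \<in> loop_through \<alpha> \<mu> a" unfolding loop_through_def by blast
    then have "\<mu> a \<in> loop_through \<alpha> \<mu> a" using \<alpha> \<mu>[OF a] by simp
    then have "loop_through \<alpha> \<mu> a \<in> ?L"
      using loop_through_eq[OF st a] \<open>\<mu> a \<in> E'\<close> by (metis imageI)
    then have "loop_through \<alpha> \<mu> ` E = ?L" using all by auto
    then show ?thesis
      using False reduced unfolding E'_def[symmetric] \<nu>_def[symmetric]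
      by (simp add: loop_product_def)
  qed
qed

section \<open>Kauffman's local calculations\<close>

lemma outside_pairing:
  assumes "strands E \<alpha> \<mu>" "\<And>x. x \<in> L \<Longrightarrow> \<mu> x \<in> L" "e \<in> E - L"
  shows "\<mu> e \<notin> L"
  using assms by (force simp: strands_def pairing_def)

lemma loop_product_bypass2:
  assumes st: "strands E \<alpha> \<mu>"
    and "{a1, b1, a2, b2} \<subseteq> E" "distinct [a1, b1, a2, b2]"
    and "b1 = \<alpha> a1" "b2 = \<alpha> a2" and u: "u a1 = u b1" "u a2 = u b2"
    and \<nu>: "\<And>e. e \<in> E - {a1, b1, a2, b2} \<Longrightarrow> bypass a2 b2 (bypass a1 b1 \<mu>) e = \<nu> e"
  shows "loop_product f E \<alpha> \<mu> u =
    (if \<mu> a1 = b1 then f 0 else 1) * ((if bypass a1 b1 \<mu> a2 = b2 then f 0 else 1) *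
      loop_product f (E - {a1, b1, a2, b2}) \<alpha> \<nu> u)"
proof -
  have E: "E - {a1, b1} - {a2, b2} = E - {a1, b1, a2, b2}" by auto
  have a: "a1 \<in> E" "a2 \<in> E - {a1, b1}" using assms by auto
  note s1 = strands_bypass[OF st a(1) \<open>b1 = _\<close>]
  note s2 = strands_bypass[OF s1 a(2) \<open>b2 = _\<close>]
  show ?thesis
    unfolding loop_product_bypass[OF st a(1) \<open>b1 = _\<close> u(1), of f]
      loop_product_bypass[OF s1 a(2) \<open>b2 = _\<close> u(2), of f]
    using loop_product_cong[OF s2, of \<nu> u u f] \<nu> E by simp
qed

lemma loop_product_bypass3:
  assumes st: "strands E \<alpha> \<mu>"
    and "{a1, b1, a2, b2, a3, b3} \<subseteq> E" "distinct [a1, b1, a2, b2, a3, b3]"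
    and "b1 = \<alpha> a1" "b2 = \<alpha> a2" "b3 = \<alpha> a3"
    and u: "u a1 = u b1" "u a2 = u b2" "u a3 = u b3"
    and \<nu>: "\<And>e. e \<in> E - {a1, b1, a2, b2, a3, b3} \<Longrightarrow>
                  bypass a3 b3 (bypass a2 b2 (bypass a1 b1 \<mu>)) e = \<nu> e"
  shows "loop_product f E \<alpha> \<mu> u =
    (if \<mu> a1 = b1 then f 0 else 1) * ((if bypass a1 b1 \<mu> a2 = b2 then f 0 else 1) *
    ((if bypass a2 b2 (bypass a1 b1 \<mu>) a3 = b3 then f 0 else 1) *
      loop_product f (E - {a1, b1, a2, b2, a3, b3}) \<alpha> \<nu> u))"
proof -
  have E: "E - {a1, b1} - {a2, b2} - {a3, b3} = E - {a1, b1, a2, b2, a3, b3}" by auto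
  have a: "a1 \<in> E" "a2 \<in> E - {a1, b1}" "a3 \<in> E - {a1, b1} - {a2, b2}" using assms by auto
  note s1 = strands_bypass[OF st a(1) \<open>b1 = _\<close>]
  note s2 = strands_bypass[OF s1 a(2) \<open>b2 = _\<close>]
  note s3 = strands_bypass[OF s2 a(3) \<open>b3 = _\<close>]
  show ?thesis
    unfolding loop_product_bypass[OF st a(1) \<open>b1 = _\<close> u(1), of f]
      loop_product_bypass[OF s1 a(2) \<open>b2 = _\<close> u(2), of f]
      loop_product_bypass[OF s2 a(3) \<open>b3 = _\<close> u(3), of f]
    using loop_product_cong[OF s3, of \<nu> u u f] \<nu> E by simp
qed

text \<open>
  In this and the following local calculations a crossing of the move has four ends; those whose
  names end in \<open>t\<close> lie on arcs inside the disc of the move, those in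
  \<open>a\<close> on arcs leading out of it. Here the arc from \<open>At\<close> to
  \<open>Bt\<close> is the loop of a kink, \<open>\<mu>\<^sub>1\<close> splits it off as a
  circle, \<open>\<mu>\<^sub>2\<close> does not, and \<open>\<mu>\<^sub>0\<close> is the diagram
  in which the crossing has been removed.
\<close>

lemma kink_local:
  assumes st: "strands E \<alpha> \<mu>\<^sub>1" "strands E \<alpha> \<mu>\<^sub>2" "strands E \<alpha> \<mu>\<^sub>0"
    and dist: "distinct [Aa, At, Ba, Bt]" and sub: "{Aa, At, Ba, Bt} \<subseteq> E"
    and arc: "Bt = \<alpha> At" and u: "u At = u Bt"
    and vals: "\<mu>\<^sub>1 Aa = Ba" "\<mu>\<^sub>1 At = Bt" "\<mu>\<^sub>2 Aa = Bt" "\<mu>\<^sub>2 At = Ba" "\<mu>\<^sub>0 Aa = At" "\<mu>\<^sub>0 Ba = Bt"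
    and off: "\<And>e. e \<in> E - {Aa, At, Ba, Bt} \<Longrightarrow> \<mu>\<^sub>1 e = \<mu>\<^sub>0 e \<and> \<mu>\<^sub>2 e = \<mu>\<^sub>0 e"
  shows "loop_product f E \<alpha> \<mu>\<^sub>1 u = f 0 * loop_product f E \<alpha> \<mu>\<^sub>0 u"
    and "loop_product f E \<alpha> \<mu>\<^sub>2 u = loop_product f E \<alpha> \<mu>\<^sub>0 u"
proof -
  let ?L = "{Aa, At, Ba, Bt}"
  have dist': "distinct [Bt, Ba, At, Aa]"
    using dist distinct_rev[of "[Aa, At, Ba, Bt]"] by (simp only: rev.simps append.simps)
  have inv: "\<mu>\<^sub>1 Ba = Aa" "\<mu>\<^sub>1 Bt = At" "\<mu>\<^sub>2 Bt = Aa" "\<mu>\<^sub>2 Ba = At" "\<mu>\<^sub>0 At = Aa" "\<mu>\<^sub>0 Bt = Ba"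
    using st sub vals unfolding strands_def pairing_def by (metis insert_subset)+
  have closed: "\<mu>\<^sub>0 x \<in> ?L" if "x \<in> ?L" for x using that by (auto simp: vals inv)
  have out: "\<mu>\<^sub>0 e \<noteq> At" "\<mu>\<^sub>0 e \<noteq> Bt" if "e \<in> E - ?L" for e
    using outside_pairing[OF st(3) closed that] by simp_all
  have E: "E - {At, Bt} = {Aa, Ba} \<union> (E - ?L)" using sub dist by auto
  have At: "At \<in> E" using sub by simp
  have eq: "bypass At Bt \<mu>\<^sub>1 e = bypass At Bt \<mu>\<^sub>0 e" "bypass At Bt \<mu>\<^sub>2 e = bypass At Bt \<mu>\<^sub>0 e"
    if "e \<in> E - {At, Bt}" for e
  proof -
    consider "e = Aa" | "e = Ba" | "e \<in> E - ?L" using \<open>e \<in> _\<close> unfolding E by blast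
    then have "bypass At Bt \<mu>\<^sub>1 e = bypass At Bt \<mu>\<^sub>0 e \<and> bypass At Bt \<mu>\<^sub>2 e = bypass At Bt \<mu>\<^sub>0 e"
    proof cases
      case 3
      from off[OF 3] out[OF 3] show ?thesis by (simp add: bypass_def)
    qed (use dist dist' in \<open>simp_all add: bypass_def vals inv\<close>)
    then show "bypass At Bt \<mu>\<^sub>1 e = bypass At Bt \<mu>\<^sub>0 e" "bypass At Bt \<mu>\<^sub>2 e = bypass At Bt \<mu>\<^sub>0 e"
      by simp_all
  qed
  note s0 = strands_bypass[OF st(3) At arc]
  note b = loop_product_bypass[where E = E and \<alpha> = \<alpha> and u = u and f = f, OF _ At arc u]
  show "loop_product f E \<alpha> \<mu>\<^sub>1 u = f 0 * loop_product f E \<alpha> \<mu>\<^sub>0 u"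
    "loop_product f E \<alpha> \<mu>\<^sub>2 u = loop_product f E \<alpha> \<mu>\<^sub>0 u"
    unfolding b[OF st(1)] b[OF st(2)] b[OF st(3)]
    using loop_product_cong[OF s0 eq(1), of u u f] loop_product_cong[OF s0 eq(2), of u u f] dist dist'
    by (simp_all add: vals inv)
qed

text \<open>
  The Boolean \<open>k\<close> (\<open>l\<close>) says that a smoothing joins ends of type
  \<open>t\<close> with ends of type \<open>a\<close>. If both do, the two strands pass each
  other without crossing, as in \<open>\<mu>\<^sub>0\<close>. The other three states yield the
  same pairing of the outer ends, one of them with an additional circle, and cancel because
  \<open>a\<^sup>2 + b\<^sup>2 + f 0 = 0\<close>.
\<close>

lemma bigon_local:
  fixes a b :: "'r::comm_ring_1"
  assumes st: "\<And>k l. strands E \<alpha> (M k l)" "strands E \<alpha> \<mu>\<^sub>0"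
    and dist: "distinct [Pa, Pt, P'a, P't, Qa, Qt, Q'a, Q't]"
    and sub: "{Pa, Pt, P'a, P't, Qa, Qt, Q'a, Q't} \<subseteq> E"
    and arc: "P't = \<alpha> Pt" "Q't = \<alpha> Qt" and u: "u Pt = u P't" "u Qt = u Q't"
    and M: "\<And>k l. M k l Pa = (if k then Qt else Qa)" "\<And>k l. M k l Pt = (if k then Qa else Qt)"
      "\<And>k l. M k l P'a = (if l then Q't else Q'a)" "\<And>k l. M k l P't = (if l then Q'a else Q't)"
    and \<mu>\<^sub>0: "\<mu>\<^sub>0 Pa = Pt" "\<mu>\<^sub>0 P'a = P't" "\<mu>\<^sub>0 Qa = Qt" "\<mu>\<^sub>0 Q'a = Q't"
    and off: "\<And>e k l. e \<in> E - {Pa, Pt, P'a, P't, Qa, Qt, Q'a, Q't} \<Longrightarrow> M k l e = \<mu>\<^sub>0 e"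
    and f: "f 0 = - (a * a) - b * b" and ab: "a * b = 1"
  shows "(\<Sum>k\<in>UNIV. \<Sum>l\<in>UNIV. (if k then a else b) * (if l then b else a) * loop_product f E \<alpha> (M k l) u)
    = loop_product f E \<alpha> \<mu>\<^sub>0 u"
proof -
  let ?L = "{Pa, Pt, P'a, P't, Qa, Qt, Q'a, Q't}"
  have dist': "distinct [Q't, Q'a, Qt, Qa, P't, P'a, Pt, Pa]"
    using dist distinct_rev[of "[Pa, Pt, P'a, P't, Qa, Qt, Q'a, Q't]"] by (simp only: rev.simps append.simps)
  have inv0: "\<mu>\<^sub>0 Pt = Pa" "\<mu>\<^sub>0 P't = P'a" "\<mu>\<^sub>0 Qt = Qa" "\<mu>\<^sub>0 Q't = Q'a"
    using st(2) sub \<mu>\<^sub>0 unfolding strands_def pairing_def by (metis insert_subset)+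
  have invM: "M k l Qa = (if k then Pt else Pa)" "M k l Qt = (if k then Pa else Pt)"
    "M k l Q'a = (if l then P't else P'a)" "M k l Q't = (if l then P'a else P't)" for k l
    using st(1)[of k l] sub M unfolding strands_def pairing_def by (metis insert_subset)+
  note v = M invM \<mu>\<^sub>0 inv0
  have closed: "\<mu>\<^sub>0 x \<in> ?L" if "x \<in> ?L" for x using that by (auto simp: v)
  have out: "\<mu>\<^sub>0 e \<notin> ?L" if "e \<in> E - ?L" for e
    by (rule outside_pairing[OF st(2) closed that])
  have "E - {Pt, P't, Qt, Q't} = {Pa, P'a, Qa, Q'a} \<union> (E - ?L)" using sub dist by auto
  then have E: "e \<in> E - {Pt, P't, Qt, Q't} \<Longrightarrow> e = Pa \<or> e = P'a \<or> e = Qa \<or> e = Q'a \<or> e \<in> E - ?L" for e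
    by blast
  (* The two crossingless ways to join the four outer ends. *)
  define \<nu> where "\<nu> = \<mu>\<^sub>0(Pa := Qa, Qa := Pa, P'a := Q'a, Q'a := P'a)"
  define \<iota> where "\<iota> = \<mu>\<^sub>0(Pa := P'a, P'a := Pa, Qa := Q'a, Q'a := Qa)"
  let ?lp = "\<lambda>\<nu>. loop_product f (E - {Pt, P't, Qt, Q't}) \<alpha> \<nu> u"
  have sub': "{Pt, P't, Qt, Q't} \<subseteq> E" "distinct [Pt, P't, Qt, Q't]" using sub dist by auto
  note contract = loop_product_bypass2[where E = E and \<alpha> = \<alpha> and u = u and f = f, OF _ sub' arc u]
  have "loop_product f E \<alpha> (M k l) u =
      (if k \<and> l then ?lp \<iota> else if k \<or> l then ?lp \<nu> else f 0 * ?lp \<nu>)" for k l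
  proof -
    have "bypass Qt Q't (bypass Pt P't (M k l)) e = (if k \<and> l then \<iota> e else \<nu> e)"
      if "e \<in> E - {Pt, P't, Qt, Q't}" for e
      using E[OF that]
    proof (elim disjE)
      assume "e \<in> E - ?L"
      from off[OF this] out[OF this] this show ?thesis
        by (simp add: bypass_def \<iota>_def \<nu>_def)
    qed (use dist dist' in \<open>simp_all add: bypass_def v \<iota>_def \<nu>_def\<close>)
    from contract[OF st(1)[of k l] this] show ?thesis
      using dist dist' by (simp add: bypass_def v)
  qed
  moreover have "loop_product f E \<alpha> \<mu>\<^sub>0 u = ?lp \<iota>"
  proof -
    have "bypass Qt Q't (bypass Pt P't \<mu>\<^sub>0) e = \<iota> e" if "e \<in> E - {Pt, P't, Qt, Q't}" for e
      using E[OF that]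
    proof (elim disjE)
      assume "e \<in> E - ?L"
      from out[OF this] this show ?thesis by (simp add: bypass_def \<iota>_def)
    qed (use dist dist' in \<open>simp_all add: bypass_def v \<iota>_def\<close>)
    from contract[OF st(2) this] show ?thesis
      using dist dist' by (simp add: bypass_def v)
  qed
  ultimately have lp: "loop_product f E \<alpha> (M k l) u =
      (if k \<and> l then loop_product f E \<alpha> \<mu>\<^sub>0 u else if k \<or> l then ?lp \<nu> else f 0 * ?lp \<nu>)" for k l
    by simp
  have ab': "a * (b * x) = x" for x using ab by (metis mult.assoc mult_1)
  show ?thesis unfolding lp
    by (simp add: UNIV_bool f algebra_simps ab')
qed

text \<open>
  The crossing of two strands slides along both of them past a pair of markers; this is what a
  third move with a strand of virtual crossings amounts to.
\<close>

lemma slide_local: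
  assumes st: "\<And>k. strands E \<alpha> (M k)" "\<And>k. strands E \<alpha> (N k)"
    and dist: "distinct [Y1a, Y1t, Y2a, Y2t, Z1a, Z1t, Z2a, Z2t]"
    and sub: "{Y1a, Y1t, Y2a, Y2t, Z1a, Z1t, Z2a, Z2t} \<subseteq> E"
    and arc: "Y2t = \<alpha> Y1t" "Z2t = \<alpha> Z1t" and u: "u Y1t = u Y2t" "u Z1t = u Z2t"
    and M: "\<And>k. M k Y1a = Y1t" "\<And>k. M k Z1a = Z1t" "\<And>k. M k Y2a = (if k then Z2t else Z2a)"
      "\<And>k. M k Y2t = (if k then Z2a else Z2t)"
    and N: "\<And>k. N k Y2a = Y2t" "\<And>k. N k Z2a = Z2t" "\<And>k. N k Y1a = (if k then Z1t else Z1a)"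
      "\<And>k. N k Y1t = (if k then Z1a else Z1t)"
    and off: "\<And>e k. e \<in> E - {Y1a, Y1t, Y2a, Y2t, Z1a, Z1t, Z2a, Z2t} \<Longrightarrow> M k e = N k e"
  shows "loop_product f E \<alpha> (M k) u = loop_product f E \<alpha> (N k) u"
proof -
  let ?L = "{Y1a, Y1t, Y2a, Y2t, Z1a, Z1t, Z2a, Z2t}"
  have dist': "distinct [Z2t, Z2a, Z1t, Z1a, Y2t, Y2a, Y1t, Y1a]"
    using dist distinct_rev[of "[Y1a, Y1t, Y2a, Y2t, Z1a, Z1t, Z2a, Z2t]"] by (simp only: rev.simps append.simps)
  have inv: "M k Y1t = Y1a" "M k Z1t = Z1a" "M k Z2a = (if k then Y2t else Y2a)"
      "M k Z2t = (if k then Y2a else Y2t)"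
      "N k Y2t = Y2a" "N k Z2t = Z2a" "N k Z1a = (if k then Y1t else Y1a)"
      "N k Z1t = (if k then Y1a else Y1t)" for k
    using st(1)[of k] st(2)[of k] sub M N unfolding strands_def pairing_def by (metis insert_subset)+
  note v = M N inv
  have closed: "N k x \<in> ?L" if "x \<in> ?L" for x k using that by (auto simp: v)
  have out: "N k e \<notin> ?L" if "e \<in> E - ?L" for e k
    by (rule outside_pairing[OF st(2) closed that])
  have "E - {Y1t, Y2t, Z1t, Z2t} = {Y1a, Y2a, Z1a, Z2a} \<union> (E - ?L)" using sub dist by auto
  then have E: "e \<in> E - {Y1t, Y2t, Z1t, Z2t} \<Longrightarrow> e = Y1a \<or> e = Y2a \<or> e = Z1a \<or> e = Z2a \<or> e \<in> E - ?L" for e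
    by blast
  have sub': "{Y1t, Y2t, Z1t, Z2t} \<subseteq> E" "distinct [Y1t, Y2t, Z1t, Z2t]" using sub dist by auto
  note contract = loop_product_bypass2[where E = E and \<alpha> = \<alpha> and u = u and f = f, OF _ sub' arc u]
  have "bypass Z1t Z2t (bypass Y1t Y2t (M k)) e = bypass Z1t Z2t (bypass Y1t Y2t (N k)) e"
    if "e \<in> E - {Y1t, Y2t, Z1t, Z2t}" for e
    using E[OF that]
  proof (elim disjE)
    assume "e \<in> E - ?L"
    from off[OF this, of k] out[OF this, of k] this show ?thesis by (simp add: bypass_def)
  qed (use dist dist' in \<open>simp_all add: bypass_def v\<close>)
  from contract[OF st(1)[of k] this] contract[OF st(2)[of k] refl] show ?thesis
    using dist dist' by (simp add: bypass_def v)
qed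

text \<open>
  Each of the eight states shrinks to one of the five crossingless pairings of the six outer
  ends. Four of them give the same pairing and their coefficients \<open>2a + b f 0 +
  b\<^sup>3\<close>, reduced by \<open>ab = 1\<close>, leave a single \<open>a\<close>. The
  Booleans \<open>k\<close> and \<open>m\<close> say that ends of different types are joined,
  \<open>l\<close> that ends of equal types are; this is how the smoothings with the coefficient
  \<open>a\<close> are distributed when \<open>X\<close> is above \<open>Y\<close> and
  \<open>Y\<close> above \<open>Z\<close>.

  Exchanging the indices \<open>1\<close> and \<open>2\<close> of \<open>X\<close>,
  \<open>Y\<close>, \<open>Z\<close> preserves the pairings in the first summand and the last
  two, exchanges those in the second and the third, and so preserves the right-hand side: this
  symmetry is the third move.
\<close>

lemma triangle_local:
  fixes a b :: "'r::comm_ring_1"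
  assumes st: "\<And>k l m. strands E \<alpha> (M k l m)"
    and dist: "distinct [X1a, X1t, X2a, X2t, Y1a, Y1t, Y2a, Y2t, Z1a, Z1t, Z2a, Z2t]"
    and sub: "{X1a, X1t, X2a, X2t, Y1a, Y1t, Y2a, Y2t, Z1a, Z1t, Z2a, Z2t} \<subseteq> E"
    and arc: "X2t = \<alpha> X1t" "Y2t = \<alpha> Y1t" "Z2t = \<alpha> Z1t"
    and u: "u X1t = u X2t" "u Y1t = u Y2t" "u Z1t = u Z2t"
    and M: "\<And>k l m. M k l m X1a = (if k then Y1t else Y1a)" "\<And>k l m. M k l m X1t = (if k then Y1a else Y1t)"
      "\<And>k l m. M k l m X2a = (if l then Z1a else Z1t)" "\<And>k l m. M k l m X2t = (if l then Z1t else Z1a)"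
      "\<And>k l m. M k l m Y2a = (if m then Z2t else Z2a)" "\<And>k l m. M k l m Y2t = (if m then Z2a else Z2t)"
    and off: "\<And>e k l m. e \<in> E - {X1a, X1t, X2a, X2t, Y1a, Y1t, Y2a, Y2t, Z1a, Z1t, Z2a, Z2t} \<Longrightarrow>
      M k l m e = \<mu>\<^sub>0 e"
    and f: "f 0 = - (a * a) - b * b" and ab: "a * b = 1"
  defines "V \<equiv> \<lambda>p p' q q' r r'.
    loop_product f (E - {X1t, X2t, Y1t, Y2t, Z1t, Z2t}) \<alpha>
      (\<mu>\<^sub>0(p := p', p' := p, q := q', q' := q, r := r', r' := r)) u"
  shows "(\<Sum>k\<in>UNIV. \<Sum>l\<in>UNIV. \<Sum>m\<in>UNIV. (if k then a else b) * (if l then a else b) * (if m then a else b)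
        * loop_product f E \<alpha> (M k l m) u)
    = a * a * a * V X1a Z2a X2a Z1a Y1a Y2a
      + a * V X1a Y1a X2a Z1a Y2a Z2a + a * V X1a Z2a X2a Y2a Y1a Z1a
      + b * V X1a X2a Y1a Z1a Y2a Z2a + b * V X1a Y1a X2a Y2a Z1a Z2a"
proof -
  let ?L = "{X1a, X1t, X2a, X2t, Y1a, Y1t, Y2a, Y2t, Z1a, Z1t, Z2a, Z2t}"
  have dist': "distinct [Z2t, Z2a, Z1t, Z1a, Y2t, Y2a, Y1t, Y1a, X2t, X2a, X1t, X1a]"
    using dist distinct_rev[of "[X1a, X1t, X2a, X2t, Y1a, Y1t, Y2a, Y2t, Z1a, Z1t, Z2a, Z2t]"] by (simp only: rev.simps append.simps)
  let ?I = "{X1t, X2t, Y1t, Y2t, Z1t, Z2t}"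
  have invM: "M k l m Y1a = (if k then X1t else X1a)" "M k l m Y1t = (if k then X1a else X1t)"
      "M k l m Z1a = (if l then X2a else X2t)" "M k l m Z1t = (if l then X2t else X2a)"
      "M k l m Z2a = (if m then Y2t else Y2a)" "M k l m Z2t = (if m then Y2a else Y2t)" for k l m
    using st(1)[of k l m] sub M unfolding strands_def pairing_def by (metis insert_subset)+
  note v = M invM
  have closed: "M True True True x \<in> ?L" if "x \<in> ?L" for x using that by (auto simp: v)
  have out: "\<mu>\<^sub>0 e \<notin> ?L" if "e \<in> E - ?L" for e
    using outside_pairing[OF st closed that] off[OF that] by simp
  have "E - ?I = {X1a, X2a, Y1a, Y2a, Z1a, Z2a} \<union> (E - ?L)" using sub dist by auto
  then have E: "e \<in> E - ?I \<Longrightarrow> e = X1a \<or> e = X2a \<or> e = Y1a \<or> e = Y2a \<or> e = Z1a \<or> e = Z2a \<or> e \<in> E - ?L" for e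
    by blast
  have sub': "?I \<subseteq> E" "distinct [X1t, X2t, Y1t, Y2t, Z1t, Z2t]" using sub dist by auto
  note contract = loop_product_bypass3[where E = E and \<alpha> = \<alpha> and u = u and f = f, OF _ sub' arc u]
  let ?A = "{X1a, X2a, Y1a, Y2a, Z1a, Z2a}"
  let ?\<nu> = "\<lambda>p p' q q' r r'. \<mu>\<^sub>0(p := p', p' := p, q := q', q' := q, r := r', r' := r)"
  have state: "loop_product f E \<alpha> (M k l m) u =
    (if M k l m X1t = X2t then f 0 else 1) * ((if bypass X1t X2t (M k l m) Y1t = Y2t then f 0 else 1) *
    ((if bypass Y1t Y2t (bypass X1t X2t (M k l m)) Z1t = Z2t then f 0 else 1) *
     V p p' q q' r r'))"
    if away: "\<forall>e\<in>?A. bypass Z1t Z2t (bypass Y1t Y2t (bypass X1t X2t (M k l m))) e = ?\<nu> p p' q q' r r' e"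
      and six: "{p, p', q, q', r, r'} \<subseteq> ?A" for k l m p p' q q' r r'
    unfolding V_def
  proof (rule contract[OF st])
    fix e assume "e \<in> E - ?I"
    then have "e \<in> ?A \<or> e \<in> E - ?L" using E by simp
    then show "bypass Z1t Z2t (bypass Y1t Y2t (bypass X1t X2t (M k l m))) e = ?\<nu> p p' q q' r r' e"
    proof
      assume e: "e \<in> E - ?L"
      then have "e \<notin> {p, p', q, q', r, r'}" using six by blast
      then show ?thesis using off[OF e, of k l m] out[OF e] by (simp add: bypass_def)
    qed (use away in blast)
  qed
  have 1: "loop_product f E \<alpha> (M True True True) u = V X1a Z2a X2a Z1a Y1a Y2a"
    by (subst state[of True True True X1a Z2a X2a Z1a Y1a Y2a]; use dist dist' in \<open>simp add: bypass_def v\<close>)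
  have 2: "loop_product f E \<alpha> (M True True False) u = V X1a Y1a X2a Z1a Y2a Z2a"
    by (subst state[of True True False X1a Y1a X2a Z1a Y2a Z2a]; use dist dist' in \<open>simp add: bypass_def v\<close>)
  have 3: "loop_product f E \<alpha> (M True False True) u = V X1a Z2a X2a Y2a Y1a Z1a"
    by (subst state[of True False True X1a Z2a X2a Y2a Y1a Z1a]; use dist dist' in \<open>simp add: bypass_def v\<close>)
  have 4: "loop_product f E \<alpha> (M True False False) u = V X1a X2a Y1a Z1a Y2a Z2a"
    by (subst state[of True False False X1a X2a Y1a Z1a Y2a Z2a]; use dist dist' in \<open>simp add: bypass_def v\<close>)
  have 5: "loop_product f E \<alpha> (M False True True) u = V X1a Y1a X2a Z1a Y2a Z2a"
    by (subst state[of False True True X1a Y1a X2a Z1a Y2a Z2a]; use dist dist' in \<open>simp add: bypass_def v\<close>)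
  have 6: "loop_product f E \<alpha> (M False True False) u = f 0 * V X1a Y1a X2a Z1a Y2a Z2a"
    by (subst state[of False True False X1a Y1a X2a Z1a Y2a Z2a]; use dist dist' in \<open>simp add: bypass_def v\<close>)
  have 7: "loop_product f E \<alpha> (M False False True) u = V X1a Y1a X2a Y2a Z1a Z2a"
    by (subst state[of False False True X1a Y1a X2a Y2a Z1a Z2a]; use dist dist' in \<open>simp add: bypass_def v\<close>)
  have 8: "loop_product f E \<alpha> (M False False False) u = V X1a Y1a X2a Z1a Y2a Z2a"
    by (subst state[of False False False X1a Y1a X2a Z1a Y2a Z2a]; use dist dist' in \<open>simp add: bypass_def v\<close>)
  have ab': "a * (b * x) = x" for x using ab by (metis mult.assoc mult_1)
  show ?thesis
    by (simp add: UNIV_bool 1 2 3 4 5 6 7 8 f algebra_simps ab')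
qed

section \<open>The state sum of a system of crossings\<close>

text \<open>
  An end of an arc is a point with a Boolean: \<open>(q, True)\<close> is the end that comes
  into \<open>q\<close> in the direction of the orientation and \<open>(q, False)\<close> the
  end that goes out of \<open>q\<close>.
\<close>

definition arc_end :: "(nat \<Rightarrow> nat) \<Rightarrow> nat \<times> bool \<Rightarrow> nat \<times> bool" where
  "arc_end n e = (if snd e then (inv n (fst e), False) else (n (fst e), True))"

definition proper_crossings :: "nat set \<Rightarrow> crossing set \<Rightarrow> bool" where
  "proper_crossings P K \<longleftrightarrow> (\<forall>c\<in>K. ends c \<subseteq> P \<and> pt1 c \<noteq> pt2 c) \<and>
     (\<forall>c\<in>K. \<forall>c'\<in>K. c \<noteq> c' \<longrightarrow> ends c \<inter> ends c' = {})"

definition crossing_of :: "crossing set \<Rightarrow> nat \<Rightarrow> crossing" where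
  "crossing_of K q = (THE c. c \<in> K \<and> q \<in> ends c)"

definition smoothing :: "crossing set \<Rightarrow> crossing set \<Rightarrow> nat \<times> bool \<Rightarrow> nat \<times> bool" where
  "smoothing K S e =
     (if \<exists>c\<in>K. fst e \<in> ends c
      then (other (crossing_of K (fst e)) (fst e), snd e \<noteq> (crossing_of K (fst e) \<in> S))
      else (fst e, \<not> snd e))"

text \<open>
  Across an oriented smoothing the potential is constant, since it is \<open>0\<close> on one
  pair of partners and \<open>1\<close> on the other; across a disoriented one it changes by
  \<open>1\<close>. It does not depend on the state, so the states of a diagram differ in their
  pairings only.
\<close>

definition potential :: "crossing set \<Rightarrow> nat \<times> bool \<Rightarrow> int" where
  "potential K e = (if \<exists>c\<in>K. e = (pt1 c, False) \<or> e = (pt2 c, True) then 1 else 0)"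

text \<open>
  The argument is the number of uncancelled cusps of a loop, twice its arrow number. Every loop
  carries a factor \<open>d\<close>, one more altogether than in the arrow polynomial.
\<close>

definition K_weight :: "int \<Rightarrow> arrow_ring" where
  "K_weight w = d_poly * (if w div 2 = 0 then 1 else K_var (nat (w div 2)))"

definition smoothing_exponent :: "crossing \<Rightarrow> bool \<Rightarrow> int" where
  "smoothing_exponent c s = (if s = (ckind c = Positive) then 1 else - 1)"

definition state_weight :: "crossing set \<Rightarrow> crossing set \<Rightarrow> arrow_ring" where
  "state_weight K S = (\<Prod>c\<in>K. A_pow (smoothing_exponent c (c \<in> S)))"

definition state_loops :: "nat set \<Rightarrow> (nat \<Rightarrow> nat) \<Rightarrow> crossing set \<Rightarrow> crossing set \<Rightarrow> arrow_ring" where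
  "state_loops P n K S =
     loop_product K_weight (P \<times> UNIV) (arc_end n) (smoothing K S) (potential K)"

definition bracket :: "nat set \<Rightarrow> (nat \<Rightarrow> nat) \<Rightarrow> crossing set \<Rightarrow> arrow_ring" where
  "bracket P n K = (\<Sum>S\<in>Pow K. state_weight K S * state_loops P n K S)"

lemma K_weight_0: "K_weight 0 = d_poly"
  by (simp add: K_weight_def)

lemma A_pow_add: "A_pow (j + k) = A_pow j * A_pow k"
  by (simp add: A_pow_def mult_single plus_prod_def)

lemma A_pow_0: "A_pow 0 = 1"
  by (simp add: A_pow_def zero_prod_def[symmetric])

lemma d_poly_eq: "d_poly = - (A_pow 1 * A_pow 1) - A_pow (- 1) * A_pow (- 1)"
  by (simp add: d_poly_def A_pow_add[symmetric])

lemma crossing_of_eq: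
  assumes "proper_crossings P K" "c \<in> K" "q \<in> ends c"
  shows "crossing_of K q = c"
  using assms unfolding crossing_of_def proper_crossings_def by (intro the_equality) blast+

lemma smoothing_at:
  assumes "proper_crossings P K" "c \<in> K"
  shows "smoothing K S (pt1 c, f) = (pt2 c, f \<noteq> (c \<in> S))"
    and "smoothing K S (pt2 c, f) = (pt1 c, f \<noteq> (c \<in> S))"
proof -
  have "pt1 c \<noteq> pt2 c" using assms by (auto simp: proper_crossings_def)
  then show "smoothing K S (pt1 c, f) = (pt2 c, f \<noteq> (c \<in> S))"
    "smoothing K S (pt2 c, f) = (pt1 c, f \<noteq> (c \<in> S))"
    using crossing_of_eq[OF assms, of "pt1 c"] crossing_of_eq[OF assms, of "pt2 c"] assms(2)
    by (auto simp: smoothing_def ends_def other_def)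
qed

lemma smoothing_marker:
  "\<forall>c\<in>K. q \<notin> ends c \<Longrightarrow> smoothing K S (q, f) = (q, \<not> f)"
  by (auto simp: smoothing_def)

lemma potential_at:
  assumes "proper_crossings P K" "c \<in> K"
  shows "potential K (pt1 c, f) = (if f then 0 else 1)"
    and "potential K (pt2 c, f) = (if f then 1 else 0)"
proof -
  have neq: "pt1 c \<noteq> pt2 c" using assms by (auto simp: proper_crossings_def)
  have apart: "pt1 c \<noteq> pt2 c'" "pt2 c \<noteq> pt1 c'" if "c' \<in> K" for c'
  proof -
    have "c' = c" if "pt1 c \<in> ends c' \<or> pt2 c \<in> ends c'"
      using that assms \<open>c' \<in> K\<close> unfolding proper_crossings_def ends_def by blast
    then show "pt1 c \<noteq> pt2 c'" "pt2 c \<noteq> pt1 c'" using neq by (auto simp: ends_def)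
  qed
  show "potential K (pt1 c, f) = (if f then 0 else 1)"
    "potential K (pt2 c, f) = (if f then 1 else 0)"
    by (cases f; use apart assms(2) in \<open>auto simp: potential_def\<close>)+
qed

lemma potential_marker:
  "\<forall>c\<in>K. q \<notin> ends c \<Longrightarrow> potential K (q, f) = 0"
  by (auto simp: potential_def ends_def)

lemma smoothing_oriented:
  assumes "proper_crossings P K" "c \<in> K" "c = oriented_crossing s k x y"
  shows "smoothing K S (x, f) = (y, f \<noteq> (c \<in> S))" and "smoothing K S (y, f) = (x, f \<noteq> (c \<in> S))"
  using smoothing_at[OF assms(1,2)] assms(3) by (auto simp: oriented_crossing_def split: if_splits)

lemma potential_oriented:
  assumes "proper_crossings P K" "c \<in> K" "c = oriented_crossing s k x y"
  shows "potential K (x, f) = (if f = s then 0 else 1)"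
    and "potential K (y, f) = (if f = s then 1 else 0)"
  using potential_at[OF assms(1,2)] assms(3) by (auto simp: oriented_crossing_def split: if_splits)

lemma proper_crossings_subset: "proper_crossings P K \<Longrightarrow> K' \<subseteq> K \<Longrightarrow> proper_crossings P K'"
  unfolding proper_crossings_def by blast

lemma ends_unique:
  "proper_crossings P K \<Longrightarrow> c \<in> K \<Longrightarrow> c' \<in> K \<Longrightarrow> q \<in> ends c \<Longrightarrow> q \<in> ends c' \<Longrightarrow> c' = c"
  unfolding proper_crossings_def by blast

lemma finite_crossings:
  assumes "finite P" "proper_crossings P K" shows "finite K"
proof (rule finite_imageD)
  show "finite (pt1 ` K)"
    using assms by (auto intro!: finite_subset[of _ P] simp: proper_crossings_def ends_def)
  show "inj_on pt1 K"
    using assms(2) by (intro inj_onI) (auto simp: proper_crossings_def ends_def)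
qed

lemma strands_diagram:
  assumes "finite P" "n permutes P" "proper_crossings P K"
  shows "strands (P \<times> UNIV) (arc_end n) (smoothing K S)"
proof -
  have n: "inv n p \<in> P" "n p \<in> P" if "p \<in> P" for p
    using permutes_in_image[OF permutes_inv[OF assms(2)]] permutes_in_image[OF assms(2)] that by auto
  have "pairing (P \<times> UNIV) (arc_end n)"
    using n permutes_inverses[OF assms(2)] by (auto simp: pairing_def arc_end_def)
  moreover have "pairing (P \<times> UNIV) (smoothing K S)"
    unfolding pairing_def
  proof (clarify, goal_cases)
    case (1 q f)
    show ?case
    proof (cases "\<exists>c\<in>K. q \<in> ends c")
      case True
      then obtain c where c: "c \<in> K" "q = pt1 c \<or> q = pt2 c" by (auto simp: ends_def)
      then have "pt1 c \<noteq> pt2 c" "ends c \<subseteq> P" using assms(3) by (auto simp: proper_crossings_def)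
      then show ?thesis using smoothing_at[OF assms(3) c(1)] c(2) by (auto simp: ends_def)
    next
      case False
      then show ?thesis using 1 by (auto simp: smoothing_marker)
    qed
  qed
  ultimately show ?thesis using assms(1) by (simp add: strands_def)
qed

lemma smoothing_gauge:
  assumes "proper_crossings P K" "\<And>c. c \<in> K \<Longrightarrow> \<gamma> (pt1 c) = \<gamma> (pt2 c)"
  shows "\<gamma> (fst (smoothing K S e)) = \<gamma> (fst e)"
proof (cases "\<exists>c\<in>K. fst e \<in> ends c")
  case True
  then obtain c where c: "c \<in> K" "fst e = pt1 c \<or> fst e = pt2 c" by (auto simp: ends_def)
  then show ?thesis using smoothing_at[OF assms(1) c(1), of S "snd e"] assms(2)[OF c(1)]
    by (metis fst_conv prod.collapse)
next
  case False then show ?thesis by (simp add: smoothing_def)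
qed

lemma smoothing_elsewhere:
  assumes K: "proper_crossings P K" and K': "proper_crossings P K'"
    and same: "\<And>c. q \<in> ends c \<Longrightarrow> c \<in> K \<longleftrightarrow> c \<in> K'"
    and S: "\<And>c. c \<in> K \<Longrightarrow> q \<in> ends c \<Longrightarrow> c \<in> S \<longleftrightarrow> c \<in> S'"
  shows "smoothing K S (q, f) = smoothing K' S' (q, f)"
proof (cases "\<exists>c\<in>K. q \<in> ends c")
  case True
  then obtain c where c: "c \<in> K" "q \<in> ends c" by auto
  then have "c \<in> K'" using same by blast
  then show ?thesis
    using crossing_of_eq[OF K c] crossing_of_eq[OF K' _ c(2)] c S[OF c] by (auto simp: smoothing_def)
next
  case False
  then have "\<not> (\<exists>c\<in>K'. q \<in> ends c)" using same by blast
  then show ?thesis using False by (simp add: smoothing_def)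
qed

lemma potential_elsewhere:
  assumes "\<And>c. q \<in> ends c \<Longrightarrow> c \<in> K \<longleftrightarrow> c \<in> K'"
  shows "potential K (q, f) = potential K' (q, f)"
  using assms unfolding potential_def ends_def by (metis insertCI prod.inject)

lemma arc_end_follows:
  assumes "n permutes P" "if e then n p = q else n q = p"
  shows "arc_end n (p, \<not> e) = (q, e)"
  using assms permutes_inverses[OF assms(1)] by (auto simp: arc_end_def)

definition choose_smoothing :: "crossing \<Rightarrow> bool \<Rightarrow> crossing set \<Rightarrow> crossing set" where
  "choose_smoothing c s S = (if s then insert c S else S)"

lemma in_choose_smoothing: "c' \<in> choose_smoothing c s S \<longleftrightarrow> c' = c \<and> s \<or> c' \<in> S"
  by (auto simp: choose_smoothing_def)

lemma sum_Pow_insert: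
  assumes "c \<notin> K" "finite K"
  shows "(\<Sum>S\<in>Pow (insert c K). g S) = (\<Sum>S\<in>Pow K. \<Sum>s\<in>UNIV. g (choose_smoothing c s S))"
proof -
  have "inj_on (insert c) (Pow K)" using assms(1) by (auto simp: inj_on_def)
  moreover have "Pow K \<inter> insert c ` Pow K = {}" using assms(1) by auto
  ultimately have "(\<Sum>S\<in>Pow (insert c K). g S) = (\<Sum>S\<in>Pow K. g S) + (\<Sum>S\<in>Pow K. g (insert c S))"
    using assms(2) by (simp add: Pow_insert sum.union_disjoint sum.reindex)
  then show ?thesis by (simp add: UNIV_bool choose_smoothing_def sum.distrib add.commute)
qed

lemma state_weight_choose:
  assumes "finite K" "c \<notin> K" "S \<in> Pow K"
  shows "state_weight (insert c K) (choose_smoothing c s S) =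
         A_pow (smoothing_exponent c s) * state_weight K S"
proof -
  have "x \<in> choose_smoothing c s S \<longleftrightarrow> x \<in> S" if "x \<in> K" for x
    using that assms(2) by (auto simp: in_choose_smoothing)
  then have "state_weight K (choose_smoothing c s S) = state_weight K S"
    unfolding state_weight_def by (intro prod.cong) auto
  moreover have "c \<in> choose_smoothing c s S \<longleftrightarrow> s" using assms by (auto simp: in_choose_smoothing)
  ultimately show ?thesis using assms by (simp add: state_weight_def)
qed

lemma sum_bool_reindex: "(\<Sum>s\<in>UNIV. g s) = (\<Sum>k\<in>UNIV. g (k = b))" for b :: bool
  by (cases b) (simp_all add: UNIV_bool add.commute)

section \<open>Invariance of the state sum under local moves\<close>

text \<open>
  At a positive crossing the oriented smoothing splits off the loop of the kink, with
  coefficient \<open>A\<close>, and \<open>A d + A\<^sup>-\<^sup>1 = - A\<^sup>3\<close>; a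
  negative crossing exchanges \<open>A\<close> and its inverse.
\<close>

lemma bracket_kink:
  assumes P: "finite P" "n permutes P" and K: "proper_crossings P (insert c K)" "c \<notin> K"
    and kink: "n (pt1 c) = pt2 c \<or> n (pt2 c) = pt1 c" and kind: "ckind c \<noteq> Virtual"
  shows "bracket P n (insert c K) =
    - A_pow (if ckind c = Positive then 3 else - 3) * bracket P n K"
proof -
  obtain a b m where ab: "n a = b" "(a = pt1 c \<and> b = pt2 c \<and> m = (0::int)) \<or> (a = pt2 c \<and> b = pt1 c \<and> m = 1)"
    using kink by metis
  let ?K = "insert c K" and ?E = "P \<times> (UNIV :: bool set)"
  have cK: "c \<in> ?K" by simp
  have K0: "proper_crossings P K" by (rule proper_crossings_subset[OF K(1)]) auto
  have fin: "finite K" by (rule finite_crossings[OF P(1) K0])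
  have neq: "a \<noteq> b" and sub: "a \<in> P" "b \<in> P" using K(1) ab(2) by (auto simp: proper_crossings_def ends_def)
  have abc: "a \<in> ends c" "b \<in> ends c" using ab(2) by (auto simp: ends_def)
  have marker: "\<forall>c'\<in>K. a \<notin> ends c'" "\<forall>c'\<in>K. b \<notin> ends c'"
    using ends_unique[OF K(1) cK _ abc(1)] ends_unique[OF K(1) cK _ abc(2)] K(2) by blast+
  have at: "smoothing ?K S (a, f) = (b, f \<noteq> (c \<in> S))" "smoothing ?K S (b, f) = (a, f \<noteq> (c \<in> S))" for S f
    using smoothing_at[OF K(1) cK] ab(2) by auto
  have pot: "potential ?K (a, f) = (if f then m else 1 - m)" "potential ?K (b, f) = (if f then 1 - m else m)" for f
    using potential_at[OF K(1) cK] ab(2) by auto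
  note st = strands_diagram[OF P K(1)] and st0 = strands_diagram[OF P K0]
  have arc: "(b, True) = arc_end n (a, False)" using ab(1) by (simp add: arc_end_def)
  then have arc': "arc_end n (b, True) = (a, False)"
    using permutes_inverses[OF P(2)] by (simp add: arc_end_def ab(1)[symmetric])
  have loops: "state_loops P n ?K (insert c S) = d_poly * state_loops P n K S"
    "state_loops P n ?K S = state_loops P n K S" if S: "S \<subseteq> K" for S
  proof -
    have cS: "c \<notin> S" using S K(2) by auto
    have off: "smoothing ?K (insert c S) e = smoothing K S e \<and> smoothing ?K S e = smoothing K S e"
      if "e \<in> ?E - {(a, True), (a, False), (b, True), (b, False)}" for e
    proof -
      have "fst e \<notin> ends c" using that ab(2) by (cases e; cases "snd e") (auto simp: ends_def)
      then show ?thesis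
        using smoothing_elsewhere[OF K(1) K0, of "fst e" "insert c S" S "snd e"]
          smoothing_elsewhere[OF K(1) K0, of "fst e" S S "snd e"] by auto
    qed
    have vals: "smoothing ?K (insert c S) (a, True) = (b, False)"
      "smoothing ?K (insert c S) (a, False) = (b, True)"
      "smoothing ?K S (a, True) = (b, True)" "smoothing ?K S (a, False) = (b, False)"
      "smoothing K S (a, True) = (a, False)" "smoothing K S (b, False) = (b, True)"
      using cS by (simp_all add: at smoothing_marker[OF marker(1)] smoothing_marker[OF marker(2)])
    have four: "distinct [(a, True), (a, False), (b, False), (b, True)]"
      "{(a, True), (a, False), (b, False), (b, True)} \<subseteq> ?E" using neq sub by auto
    have off': "smoothing ?K (insert c S) e = smoothing K S e \<and> smoothing ?K S e = smoothing K S e"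
      if "e \<in> ?E - {(a, True), (a, False), (b, False), (b, True)}" for e
      using off[of e] that by blast
    have level: "potential ?K (a, False) = potential ?K (b, True)" by (simp add: pot)
    note kink = kink_local[of ?E "arc_end n" "smoothing ?K (insert c S)" "smoothing ?K S" "smoothing K S"
        "(a, True)" "(a, False)" "(b, False)" "(b, True)" "potential ?K" K_weight,
        OF st st st0 four arc level vals off']
    (* The constant by which the potentials with and without the crossing differ at the two
       outer ends. *)
    define \<gamma> where "\<gamma> q = (if q = a \<or> q = b then m else 0)" for q
    have pot0: "loop_product K_weight ?E (arc_end n) (smoothing K S) (potential ?K) = state_loops P n K S"
      unfolding state_loops_def
    proof (rule loop_product_potential[where g = "\<lambda>e. \<gamma> (fst e)" and I = "{(a, False), (b, True)}", OF st0])
      show "\<gamma> (fst (smoothing K S e)) = \<gamma> (fst e)" for e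
        by (rule smoothing_gauge[OF K0]) (use marker in \<open>auto simp: \<gamma>_def ends_def\<close>)
      show "potential ?K e = potential K e + \<gamma> (fst e)" if "e \<in> ?E - {(a, False), (b, True)}" for e
      proof (cases "fst e = a \<or> fst e = b")
        case True
        then have "e = (a, True) \<or> e = (b, False)" using that by (cases e) auto
        then show ?thesis using pot potential_marker[OF marker(1)] potential_marker[OF marker(2)] neq
          by (auto simp: \<gamma>_def)
      next
        case False
        then have "fst e \<notin> ends c" using ab(2) by (auto simp: ends_def)
        then show ?thesis using False potential_elsewhere[of "fst e" ?K K "snd e"] by (auto simp: \<gamma>_def)
      qed
      show "{(a, False), (b, True)} \<subseteq> ?E" using sub by simp
      fix e assume "e \<in> {(a, False), (b, True)}"
      then consider "e = (a, False)" | "e = (b, True)" by blast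
      then show "arc_end n e \<in> {(a, False), (b, True)} \<and>
          potential ?K (arc_end n e) = potential ?K e \<and>
          potential K (arc_end n e) + \<gamma> (fst (arc_end n e)) = potential K e + \<gamma> (fst e)"
        by cases (simp_all add: \<gamma>_def arc[symmetric] arc' pot potential_marker[OF marker(1)]
           potential_marker[OF marker(2)])
    qed
    show "state_loops P n ?K (insert c S) = d_poly * state_loops P n K S"
      "state_loops P n ?K S = state_loops P n K S"
      unfolding pot0[symmetric] K_weight_0[symmetric] unfolding state_loops_def
      using kink by blast+
  qed
  have wt: "A_pow (smoothing_exponent c True) * d_poly + A_pow (smoothing_exponent c False) =
      - A_pow (if ckind c = Positive then 3 else - 3)"
    by (auto simp: smoothing_exponent_def d_poly_def algebra_simps A_pow_add[symmetric])
  have "bracket P n ?K = (\<Sum>S\<in>Pow K. \<Sum>s\<in>UNIV.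
      A_pow (smoothing_exponent c s) * state_weight K S * state_loops P n ?K (choose_smoothing c s S))"
    unfolding bracket_def sum_Pow_insert[OF K(2) fin]
    by (intro sum.cong refl) (simp only: state_weight_choose[OF fin K(2)])
  also have "\<dots> = (\<Sum>S\<in>Pow K. - A_pow (if ckind c = Positive then 3 else - 3) * (state_weight K S * state_loops P n K S))"
    unfolding wt[symmetric]
    by (intro sum.cong) (simp_all add: UNIV_bool choose_smoothing_def loops algebra_simps)
  finally show ?thesis by (simp add: bracket_def sum_distrib_left)
qed

text \<open>
  The signs of the two crossings are opposite, so that smoothings of the same type have inverse
  coefficients. The Boolean \<open>t\<close> in the proof tells whether the strands are
  parallel: it translates oriented and disoriented smoothings into those which join ends of type
  \<open>t\<close> with ends of type \<open>a\<close> and those which do not.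
\<close>

lemma bracket_bigon:
  assumes P: "finite P" "n permutes P"
    and K: "proper_crossings P (insert c (insert c' K))" "c \<notin> K" "c' \<notin> K"
    and c: "c = Crossing k p q" "c' = Crossing k' q' p'" "distinct [p, p', q, q']"
    and kinds: "(k, k') \<in> {(Positive, Negative), (Negative, Positive)}"
    and strands: "n p = p' \<or> n p' = p" "n q = q' \<or> n q' = q"
  shows "bracket P n (insert c (insert c' K)) = bracket P n K"
proof -
  let ?K = "insert c (insert c' K)" and ?E = "P \<times> (UNIV :: bool set)"
  obtain ep where ep: "if ep then n p = p' else n p' = p" using strands(1) by metis
  obtain eq where eq: "if eq then n q = q' else n q' = q" using strands(2) by metis
  define t where "t \<longleftrightarrow> (ep \<longleftrightarrow> eq)"
  have cc: "c \<noteq> c'" using c by auto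
  have cK: "c \<in> ?K" "c' \<in> ?K" by auto
  have K1: "proper_crossings P (insert c' K)" and K0: "proper_crossings P K"
    by (rule proper_crossings_subset[OF K(1)]; auto)+
  have fin: "finite K" by (rule finite_crossings[OF P(1) K0])
  have sub: "p \<in> P" "q \<in> P" "p' \<in> P" "q' \<in> P" using K(1) c by (auto simp: proper_crossings_def ends_def)
  have ends: "p \<in> ends c" "q \<in> ends c" "p' \<in> ends c'" "q' \<in> ends c'" using c by (auto simp: ends_def)
  have marker: "\<forall>c''\<in>K. p \<notin> ends c''" "\<forall>c''\<in>K. q \<notin> ends c''"
      "\<forall>c''\<in>K. p' \<notin> ends c''" "\<forall>c''\<in>K. q' \<notin> ends c''"
    using ends_unique[OF K(1) cK(1) _ ends(1)] ends_unique[OF K(1) cK(1) _ ends(2)]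
      ends_unique[OF K(1) cK(2) _ ends(3)] ends_unique[OF K(1) cK(2) _ ends(4)] K(2,3) by blast+
  note sm = smoothing_marker[OF marker(1)] smoothing_marker[OF marker(2)]
    smoothing_marker[OF marker(3)] smoothing_marker[OF marker(4)]
  note pm = potential_marker[OF marker(1)] potential_marker[OF marker(2)]
    potential_marker[OF marker(3)] potential_marker[OF marker(4)]
  have at: "smoothing ?K S (p, f) = (q, f \<noteq> (c \<in> S))" "smoothing ?K S (q, f) = (p, f \<noteq> (c \<in> S))"
      "smoothing ?K S (p', f) = (q', f \<noteq> (c' \<in> S))" "smoothing ?K S (q', f) = (p', f \<noteq> (c' \<in> S))" for S f
    using smoothing_at[OF K(1) cK(1), of S f] smoothing_at[OF K(1) cK(2), of S f] c by simp_all
  have pot: "potential ?K (p, f) = (if f then 0 else 1)" "potential ?K (q, f) = (if f then 1 else 0)"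
      "potential ?K (q', f) = (if f then 0 else 1)" "potential ?K (p', f) = (if f then 1 else 0)" for f
    using potential_at[OF K(1) cK(1), of f] potential_at[OF K(1) cK(2), of f] c by simp_all
  have dist: "p \<noteq> p'" "p \<noteq> q" "p \<noteq> q'" "p' \<noteq> q" "p' \<noteq> q'" "q \<noteq> q'"
     "p' \<noteq> p" "q \<noteq> p" "q' \<noteq> p" "q \<noteq> p'" "q' \<noteq> p'" "q' \<noteq> q" using c(3) by auto
  note st = strands_diagram[OF P K(1)] and st0 = strands_diagram[OF P K0]
  have arcs: "(p', ep) = arc_end n (p, \<not> ep)" "(q', eq) = arc_end n (q, \<not> eq)"
    using arc_end_follows[OF P(2) ep] arc_end_follows[OF P(2) eq] by simp_all
  have inv: "arc_end n (arc_end n e) = e" if "e \<in> ?E" for e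
    using st0 that by (auto simp: strands_def pairing_def)
  have arcs': "arc_end n (p', ep) = (p, \<not> ep)" "arc_end n (q', eq) = (q, \<not> eq)"
    unfolding arcs using inv sub by auto
  let ?a = "A_pow (smoothing_exponent c t)" and ?b = "A_pow (smoothing_exponent c (\<not> t))"
  let ?L = "{(p, ep), (p, \<not> ep), (p', \<not> ep), (p', ep), (q, eq), (q, \<not> eq), (q', \<not> eq), (q', eq)}"
  have L: "fst e \<notin> {p, p', q, q'}" if "e \<in> ?E - ?L" for e
  proof -
    obtain x f where "e = (x, f)" by (cases e)
    then show ?thesis using that by (cases f; cases ep; cases eq) auto
  qed
  have off: "smoothing ?K S e = smoothing K S' e"
    if "e \<in> ?E - ?L" "S - {c, c'} = S' - {c, c'}" for e S S'
  proof -
    have "fst e \<notin> ends c" "fst e \<notin> ends c'" using L[OF that(1)] c by (auto simp: ends_def)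
    then show ?thesis
      using smoothing_elsewhere[OF K(1) K0, of "fst e" S S' "snd e"] that(2) by auto
  qed
  have wt: "?a * ?b = 1" "K_weight 0 = - (?a * ?a) - ?b * ?b"
    unfolding K_weight_0 d_poly_eq by (auto simp: smoothing_exponent_def A_pow_add[symmetric] A_pow_0)
  have exps: "A_pow (smoothing_exponent c (i = t)) = (if i then ?a else ?b)"
    "A_pow (smoothing_exponent c' (i = t)) = (if i then ?b else ?a)" for i
    using kinds c by (cases i; cases t; auto simp: smoothing_exponent_def)+
  have "state_loops P n K S = (\<Sum>i\<in>UNIV. \<Sum>j\<in>UNIV. (if i then ?a else ?b) * (if j then ?b else ?a) *
      state_loops P n ?K (choose_smoothing c (i = t) (choose_smoothing c' (j = t) S)))"
    if S: "S \<subseteq> K" for S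
  proof -
    define M where "M i j = smoothing ?K (choose_smoothing c (i = t) (choose_smoothing c' (j = t) S))" for i j
    have mem: "c \<in> choose_smoothing c (i = t) (choose_smoothing c' (j = t) S) \<longleftrightarrow> i = t"
      "c' \<in> choose_smoothing c (i = t) (choose_smoothing c' (j = t) S) \<longleftrightarrow> j = t" for i j
      using S K cc by (auto simp: in_choose_smoothing)
    have stM: "strands ?E (arc_end n) (M i j)" for i j unfolding M_def by (rule st)
    have eight: "distinct [(p, ep), (p, \<not> ep), (p', \<not> ep), (p', ep), (q, eq), (q, \<not> eq), (q', \<not> eq), (q', eq)]"
      "?L \<subseteq> ?E" using dist sub by auto
    have level: "potential ?K (p, \<not> ep) = potential ?K (p', ep)" "potential ?K (q, \<not> eq) = potential ?K (q', eq)"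
      by (simp_all add: pot)
    have valsM: "M i j (p, ep) = (if i then (q, \<not> eq) else (q, eq))"
      "M i j (p, \<not> ep) = (if i then (q, eq) else (q, \<not> eq))"
      "M i j (p', \<not> ep) = (if j then (q', eq) else (q', \<not> eq))"
      "M i j (p', ep) = (if j then (q', \<not> eq) else (q', eq))" for i j
      unfolding M_def at mem by (auto simp: t_def)
    have vals0: "smoothing K S (p, ep) = (p, \<not> ep)" "smoothing K S (p', \<not> ep) = (p', ep)"
      "smoothing K S (q, eq) = (q, \<not> eq)" "smoothing K S (q', \<not> eq) = (q', eq)"
      by (simp_all add: sm)
    have offM: "M i j e = smoothing K S e" if "e \<in> ?E - ?L" for e i j
      unfolding M_def by (rule off[OF that]) (auto simp: in_choose_smoothing)
    note sum = bigon_local[of ?E "arc_end n" M "smoothing K S" "(p, ep)" "(p, \<not> ep)" "(p', \<not> ep)" "(p', ep)"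
        "(q, eq)" "(q, \<not> eq)" "(q', \<not> eq)" "(q', eq)" "potential ?K" K_weight ?a ?b,
        OF stM st0 eight arcs level valsM vals0 offM wt(2,1)]
    define \<gamma> where "\<gamma> x = (if x = p \<or> x = p' then if ep then 0 else 1
       else if x = q \<or> x = q' then if eq then 1 else 0 else (0::int))" for x
    let ?I = "{(p, \<not> ep), (p', ep), (q, \<not> eq), (q', eq)}"
    have "loop_product K_weight ?E (arc_end n) (smoothing K S) (potential ?K) = state_loops P n K S"
      unfolding state_loops_def
    proof (rule loop_product_potential[where g = "\<lambda>e. \<gamma> (fst e)" and I = ?I, OF st0])
      show "\<gamma> (fst (smoothing K S e)) = \<gamma> (fst e)" for e
        by (rule smoothing_gauge[OF K0]) (use marker in \<open>auto simp: \<gamma>_def ends_def\<close>)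
      show "?I \<subseteq> ?E" using sub by simp
      show "arc_end n e \<in> ?I \<and> potential ?K (arc_end n e) = potential ?K e \<and>
          potential K (arc_end n e) + \<gamma> (fst (arc_end n e)) = potential K e + \<gamma> (fst e)" if "e \<in> ?I" for e
      proof -
        consider "e = (p, \<not> ep)" | "e = (p', ep)" | "e = (q, \<not> eq)" | "e = (q', eq)" using \<open>e \<in> ?I\<close> by blast
        then show ?thesis
          by cases (simp_all add: \<gamma>_def arcs[symmetric] arcs' pot pm dist)
      qed
      show "potential ?K e = potential K e + \<gamma> (fst e)" if e: "e \<in> ?E - ?I" for e
      proof (cases "e \<in> ?L")
        case True
        then consider "e = (p, ep)" | "e = (p', \<not> ep)" | "e = (q, eq)" | "e = (q', \<not> eq)" using e by blast
        then show ?thesis by cases (simp_all add: \<gamma>_def pot pm dist)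
      next
        case False
        with e have "e \<in> ?E - ?L" by blast
        then have F: "fst e \<notin> {p, p', q, q'}" by (rule L)
        then have "fst e \<notin> ends c" "fst e \<notin> ends c'" using c by (auto simp: ends_def)
        then show ?thesis using F potential_elsewhere[of "fst e" ?K K "snd e"] by (auto simp: \<gamma>_def)
      qed
    qed
    with sum show ?thesis unfolding state_loops_def M_def by simp
  qed
  note step = this
  have "bracket P n ?K = (\<Sum>S\<in>Pow K. \<Sum>s'\<in>UNIV. \<Sum>s\<in>UNIV.
      A_pow (smoothing_exponent c s) * (A_pow (smoothing_exponent c' s') * state_weight K S) *
      state_loops P n ?K (choose_smoothing c s (choose_smoothing c' s' S)))"
  proof -
    have K': "c \<notin> insert c' K" "finite (insert c' K)" using K(2) cc fin by auto
    have "choose_smoothing c' s' S \<in> Pow (insert c' K)" if "S \<in> Pow K" for S s'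
      using that by (auto simp: choose_smoothing_def)
    then show ?thesis
      unfolding bracket_def sum_Pow_insert[OF K'] sum_Pow_insert[OF K(3) fin]
      by (intro sum.cong refl) (simp only: state_weight_choose[OF K'(2,1)] state_weight_choose[OF fin K(3)])
  qed
  also have "\<dots> = (\<Sum>S\<in>Pow K. \<Sum>j\<in>UNIV. \<Sum>i\<in>UNIV.
      A_pow (smoothing_exponent c (i = t)) * (A_pow (smoothing_exponent c' (j = t)) * state_weight K S) *
      state_loops P n ?K (choose_smoothing c (i = t) (choose_smoothing c' (j = t) S)))"
    by (subst (1 2) sum_bool_reindex[where b = t]) (rule refl)
  also have "\<dots> = bracket P n K"
    unfolding bracket_def exps
    by (intro sum.cong refl) (simp add: step UNIV_bool algebra_simps)
  finally show ?thesis .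
qed

lemma ends_oriented [simp]: "ends (oriented_crossing s k x y) = {x, y}"
  by (auto simp: ends_def oriented_crossing_def)

lemma ckind_oriented [simp]: "ckind (oriented_crossing s k x y) = k"
  by (simp add: oriented_crossing_def)

text \<open>
  The sign of the crossing and the directions of the strands are unchanged, hence each smoothing
  of \<open>c\<close> has a counterpart at \<open>c'\<close> of the same type and coefficient.
\<close>

lemma bracket_slide:
  assumes P: "finite P" "n permutes P"
    and c: "c = oriented_crossing s k y2 z2" and c': "c' = oriented_crossing s k y1 z1"
    and K: "proper_crossings P (insert c K)" "c \<notin> K"
    and K': "proper_crossings P (insert c' K)" "c' \<notin> K"
    and dist: "distinct [y1, y2, z1, z2]"
    and ey: "if ey then n y1 = y2 else n y2 = y1" and ez: "if ez then n z1 = z2 else n z2 = z1"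
  shows "bracket P n (insert c K) = bracket P n (insert c' K)"
proof -
  let ?K = "insert c K" and ?K' = "insert c' K" and ?E = "P \<times> (UNIV :: bool set)"
  have cK: "c \<in> ?K" "c' \<in> ?K'" by auto
  have K0: "proper_crossings P K" by (rule proper_crossings_subset[OF K(1)]; auto)
  have fin: "finite K" by (rule finite_crossings[OF P(1) K0])
  have ends: "y2 \<in> ends c" "z2 \<in> ends c" "y1 \<in> ends c'" "z1 \<in> ends c'" by (auto simp: c c')
  have sub: "y1 \<in> P" "y2 \<in> P" "z1 \<in> P" "z2 \<in> P"
    using K(1) K'(1) by (auto simp: proper_crossings_def c c')
  have neq: "y1 \<noteq> y2" "y1 \<noteq> z1" "y1 \<noteq> z2" "y2 \<noteq> z1" "y2 \<noteq> z2" "z1 \<noteq> z2"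
     "y2 \<noteq> y1" "z1 \<noteq> y1" "z2 \<noteq> y1" "z1 \<noteq> y2" "z2 \<noteq> y2" "z2 \<noteq> z1" using dist by auto
  have marker: "\<forall>d\<in>K. y2 \<notin> ends d" "\<forall>d\<in>K. z2 \<notin> ends d" "\<forall>d\<in>K. y1 \<notin> ends d" "\<forall>d\<in>K. z1 \<notin> ends d"
    using ends_unique[OF K(1) cK(1) _ ends(1)] ends_unique[OF K(1) cK(1) _ ends(2)]
      ends_unique[OF K'(1) cK(2) _ ends(3)] ends_unique[OF K'(1) cK(2) _ ends(4)] K(2) K'(2) by blast+
  have markerK: "\<forall>d\<in>?K. y1 \<notin> ends d" "\<forall>d\<in>?K. z1 \<notin> ends d"
    "\<forall>d\<in>?K'. y2 \<notin> ends d" "\<forall>d\<in>?K'. z2 \<notin> ends d" using marker neq by (auto simp: c c')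
  note sm = smoothing_marker[OF markerK(1)] smoothing_marker[OF markerK(2)]
    smoothing_marker[OF markerK(3)] smoothing_marker[OF markerK(4)]
  note pm = potential_marker[OF markerK(1)] potential_marker[OF markerK(2)]
    potential_marker[OF markerK(3)] potential_marker[OF markerK(4)]
  note at = smoothing_oriented[OF K(1) cK(1) c]
    smoothing_oriented[OF K'(1) cK(2) c']
  note pot = potential_oriented[OF K(1) cK(1) c]
    potential_oriented[OF K'(1) cK(2) c']
  note st = strands_diagram[OF P K(1)] and st' = strands_diagram[OF P K'(1)]
  have arcs: "(y2, ey) = arc_end n (y1, \<not> ey)" "(z2, ez) = arc_end n (z1, \<not> ez)"
    using arc_end_follows[OF P(2) ey] arc_end_follows[OF P(2) ez] by simp_all
  have inv: "arc_end n (arc_end n e) = e" if "e \<in> ?E" for e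
    using st that by (auto simp: strands_def pairing_def)
  have arcs': "arc_end n (y2, ey) = (y1, \<not> ey)" "arc_end n (z2, ez) = (z1, \<not> ez)"
    unfolding arcs using inv sub by auto
  let ?L = "{(y1, ey), (y1, \<not> ey), (y2, \<not> ey), (y2, ey), (z1, ez), (z1, \<not> ez), (z2, \<not> ez), (z2, ez)}"
  let ?I = "{(y1, \<not> ey), (y2, ey), (z1, \<not> ez), (z2, ez)}"
  have L: "fst e \<notin> {y1, y2, z1, z2}" if "e \<in> ?E - ?L" for e
  proof -
    obtain x f where "e = (x, f)" by (cases e)
    then show ?thesis using that by (cases f; cases ey; cases ez) auto
  qed
  have off: "smoothing ?K S e = smoothing ?K' S' e"
    if "e \<in> ?E - ?L" "S - {c, c'} = S' - {c, c'}" for e S S'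
  proof -
    have "fst e \<notin> ends c" "fst e \<notin> ends c'" using L[OF that(1)] by (auto simp: c c')
    then show ?thesis
      using smoothing_elsewhere[OF K(1) K'(1), of "fst e" S S' "snd e"] that(2) by auto
  qed
  (* The first function makes the potential level along both inner arcs, and the second one
     carries the potential of the crossing in its new position over to the result. *)
  define \<gamma> where "\<gamma> x = (if x = y1 then if ey = s then 0 else 1
     else if x = z1 then if ez = s then 1 else 0 else (0::int))" for x
  define \<gamma>' where "\<gamma>' x = (if x = y2 then if ey = s then 1 else 0
     else if x = z2 then if ez = s then 0 else 1 else (0::int))" for x
  define u where "u e = potential ?K e + \<gamma> (fst e)" for e
  have u: "loop_product K_weight ?E (arc_end n) (smoothing ?K S) u = state_loops P n ?K S" for S
    unfolding u_def state_loops_def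
  proof (rule loop_product_gauge[OF st])
    show "\<gamma> (fst (smoothing ?K S e)) = \<gamma> (fst e)" for e
      by (rule smoothing_gauge[OF K(1)]) (use markerK in \<open>auto simp: \<gamma>_def ends_def\<close>)
  qed
  have u': "loop_product K_weight ?E (arc_end n) (smoothing ?K' S) u = state_loops P n ?K' S" for S
    unfolding state_loops_def
  proof (rule loop_product_potential[where g = "\<lambda>e. \<gamma>' (fst e)" and I = ?I, OF st'])
    show "\<gamma>' (fst (smoothing ?K' S e)) = \<gamma>' (fst e)" for e
      by (rule smoothing_gauge[OF K'(1)]) (use markerK in \<open>auto simp: \<gamma>'_def ends_def\<close>)
    show "?I \<subseteq> ?E" using sub by simp
    show "arc_end n e \<in> ?I \<and> u (arc_end n e) = u e \<and>
        potential ?K' (arc_end n e) + \<gamma>' (fst (arc_end n e)) = potential ?K' e + \<gamma>' (fst e)" if "e \<in> ?I" for e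
    proof -
      consider "e = (y1, \<not> ey)" | "e = (y2, ey)" | "e = (z1, \<not> ez)" | "e = (z2, ez)" using \<open>e \<in> ?I\<close> by blast
      then show ?thesis
        by cases (simp_all add: u_def \<gamma>_def \<gamma>'_def arcs[symmetric] arcs' pot pm neq)
    qed
    show "u e = potential ?K' e + \<gamma>' (fst e)" if e: "e \<in> ?E - ?I" for e
    proof (cases "e \<in> ?L")
      case True
      then consider "e = (y1, ey)" | "e = (y2, \<not> ey)" | "e = (z1, ez)" | "e = (z2, \<not> ez)" using e by blast
      then show ?thesis by cases (simp_all add: u_def \<gamma>_def \<gamma>'_def pot pm neq)
    next
      case False
      with e have "e \<in> ?E - ?L" by blast
      then have F: "fst e \<notin> {y1, y2, z1, z2}" by (rule L)
      then have "fst e \<notin> ends c" "fst e \<notin> ends c'" by (auto simp: c c')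
      then show ?thesis using F potential_elsewhere[of "fst e" ?K ?K' "snd e"]
        by (auto simp: u_def \<gamma>_def \<gamma>'_def)
    qed
  qed
  have step: "state_loops P n ?K (choose_smoothing c b S) = state_loops P n ?K' (choose_smoothing c' b S)"
    if S: "S \<subseteq> K" for S b
  proof -
    define t where "t \<longleftrightarrow> (ey \<longleftrightarrow> ez)"
    define M where "M i = smoothing ?K (choose_smoothing c (i = t) S)" for i
    define N where "N i = smoothing ?K' (choose_smoothing c' (i = t) S)" for i
    have mem: "c \<in> choose_smoothing c x S \<longleftrightarrow> x" "c' \<in> choose_smoothing c' x S \<longleftrightarrow> x" for x
      using S K(2) K'(2) by (auto simp: in_choose_smoothing)
    have stM: "strands ?E (arc_end n) (M i)" "strands ?E (arc_end n) (N i)" for i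
      unfolding M_def N_def by (rule st st')+
    have eight: "distinct [(y1, ey), (y1, \<not> ey), (y2, \<not> ey), (y2, ey), (z1, ez), (z1, \<not> ez), (z2, \<not> ez), (z2, ez)]"
      "?L \<subseteq> ?E" using neq sub by auto
    have level: "u (y1, \<not> ey) = u (y2, ey)" "u (z1, \<not> ez) = u (z2, ez)"
      by (simp_all add: u_def \<gamma>_def pot pm neq)
    have vals: "M i (y1, ey) = (y1, \<not> ey)" "M i (z1, ez) = (z1, \<not> ez)"
      "M i (y2, \<not> ey) = (if i then (z2, ez) else (z2, \<not> ez))"
      "M i (y2, ey) = (if i then (z2, \<not> ez) else (z2, ez))"
      "N i (y2, \<not> ey) = (y2, ey)" "N i (z2, \<not> ez) = (z2, ez)"
      "N i (y1, ey) = (if i then (z1, \<not> ez) else (z1, ez))"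
      "N i (y1, \<not> ey) = (if i then (z1, ez) else (z1, \<not> ez))" for i
      unfolding M_def N_def at sm mem by (auto simp: t_def)
    have offM: "M i e = N i e" if "e \<in> ?E - ?L" for e i
      unfolding M_def N_def by (rule off[OF that]) (auto simp: in_choose_smoothing)
    have "loop_product K_weight ?E (arc_end n) (M i) u = loop_product K_weight ?E (arc_end n) (N i) u" for i
      by (rule slide_local[of ?E "arc_end n" M N "(y1, ey)" "(y1, \<not> ey)" "(y2, \<not> ey)" "(y2, ey)"
        "(z1, ez)" "(z1, \<not> ez)" "(z2, \<not> ez)" "(z2, ez)", OF stM eight arcs level vals offM])
    then have *: "state_loops P n ?K (choose_smoothing c (i = t) S) =
        state_loops P n ?K' (choose_smoothing c' (i = t) S)" for i
      unfolding M_def N_def u u' .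
    have "b = ((b = t) = t)" by auto
    then obtain i where "b = (i = t)" by blast
    then show ?thesis using * by simp
  qed
  have "smoothing_exponent c b = smoothing_exponent c' b" for b by (simp add: smoothing_exponent_def c c')
  then show ?thesis
    unfolding bracket_def sum_Pow_insert[OF K(2) fin] sum_Pow_insert[OF K'(2) fin]
    by (intro sum.cong refl) (simp add: state_weight_choose[OF fin K(2)] state_weight_choose[OF fin K'(2)] step)
qed

lemma bracket_insert3:
  fixes t1 t2 t3 :: bool
  assumes fin: "finite K" and c: "c1 \<notin> K" "c2 \<notin> K" "c3 \<notin> K" "distinct [c1, c2, c3]"
  shows "bracket P n (insert c1 (insert c2 (insert c3 K))) = (\<Sum>S\<in>Pow K. state_weight K S *
    (\<Sum>i\<in>UNIV. \<Sum>j\<in>UNIV. \<Sum>m\<in>UNIV. A_pow (smoothing_exponent c1 (i = t1)) *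
       A_pow (smoothing_exponent c2 (j = t2)) * A_pow (smoothing_exponent c3 (m = t3)) *
       state_loops P n (insert c1 (insert c2 (insert c3 K)))
         (choose_smoothing c1 (i = t1) (choose_smoothing c2 (j = t2) (choose_smoothing c3 (m = t3) S)))))"
proof -
  let ?K = "insert c1 (insert c2 (insert c3 K))"
  have K3: "c2 \<notin> insert c3 K" "finite (insert c3 K)" "c1 \<notin> insert c2 (insert c3 K)"
    "finite (insert c2 (insert c3 K))" using assms by auto
  have m: "choose_smoothing c3 s S \<in> Pow (insert c3 K)" if "S \<in> Pow K" for S s
    using that by (auto simp: choose_smoothing_def)
  have m': "choose_smoothing c2 s S \<in> Pow (insert c2 (insert c3 K))" if "S \<in> Pow (insert c3 K)" for S s
    using that by (auto simp: choose_smoothing_def)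
  have "bracket P n ?K = (\<Sum>S\<in>Pow K. \<Sum>s3\<in>UNIV. \<Sum>s2\<in>UNIV. \<Sum>s1\<in>UNIV.
      A_pow (smoothing_exponent c1 s1) * (A_pow (smoothing_exponent c2 s2) *
       (A_pow (smoothing_exponent c3 s3) * state_weight K S)) *
       state_loops P n ?K (choose_smoothing c1 s1 (choose_smoothing c2 s2 (choose_smoothing c3 s3 S))))"
    unfolding bracket_def sum_Pow_insert[OF K3(3,4)] sum_Pow_insert[OF K3(1,2)] sum_Pow_insert[OF c(3) fin]
    by (intro sum.cong refl) (simp only: state_weight_choose[OF K3(4,3) m'[OF m]]
        state_weight_choose[OF K3(2,1) m] state_weight_choose[OF fin c(3)])
  also have "\<dots> = (\<Sum>S\<in>Pow K. \<Sum>m\<in>UNIV. \<Sum>j\<in>UNIV. \<Sum>i\<in>UNIV.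
      A_pow (smoothing_exponent c1 (i = t1)) * (A_pow (smoothing_exponent c2 (j = t2)) *
       (A_pow (smoothing_exponent c3 (m = t3)) * state_weight K S)) *
       state_loops P n ?K (choose_smoothing c1 (i = t1) (choose_smoothing c2 (j = t2) (choose_smoothing c3 (m = t3) S))))"
    by (subst (1) sum_bool_reindex[where b = t1], subst (2) sum_bool_reindex[where b = t2],
        subst (3) sum_bool_reindex[where b = t3]) (rule refl)
  finally show ?thesis
    by (simp add: UNIV_bool algebra_simps)
qed

lemma ends_avoid:
  assumes "proper_crossings P L" "c \<in> L" "q \<in> ends c" "K \<subseteq> L" "c \<notin> K"
  shows "\<forall>d\<in>K. q \<notin> ends d"
  using assms ends_unique[OF assms(1,2) _ assms(3)] by blast

text \<open>
  The hypothesis on \<open>s1\<close>, \<open>s2\<close>, \<open>s3\<close> says that the three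
  crossings bound a triangle, and \<open>over_kind\<close> that \<open>x\<close> lies above
  \<open>y\<close> and \<open>y\<close> above \<open>z\<close>. As a consequence the coefficient
  \<open>?a\<close> belongs to the smoothings that join inner with outer ends where
  \<open>y\<close> meets \<open>x\<close> or \<open>z\<close>, and to the one that joins inner
  with inner ends where \<open>x\<close> meets \<open>z\<close>.
\<close>

lemma bracket_triangle:
  assumes P: "finite P" "n permutes P"
    and c: "c1 = oriented_crossing s1 (over_kind s1) x1 y1" "c2 = oriented_crossing s2 (over_kind s2) x2 z1"
      "c3 = oriented_crossing s3 (over_kind s3) y2 z2"
    and d: "d1 = oriented_crossing s1 (over_kind s1) x2 y2" "d2 = oriented_crossing s2 (over_kind s2) x1 z2"
      "d3 = oriented_crossing s3 (over_kind s3) y1 z1"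
    and s: "s1 \<longleftrightarrow> (t \<longleftrightarrow> (ex \<longleftrightarrow> ey))" "s2 \<longleftrightarrow> (t \<longleftrightarrow> (ex \<longleftrightarrow> ez))" "s3 \<longleftrightarrow> (t \<longleftrightarrow> (ey \<longleftrightarrow> ez))"
    and K: "proper_crossings P (insert c1 (insert c2 (insert c3 K)))" "c1 \<notin> K" "c2 \<notin> K" "c3 \<notin> K"
    and K': "proper_crossings P (insert d1 (insert d2 (insert d3 K)))"
    and dist: "distinct [x1, x2, y1, y2, z1, z2]"
    and ex: "if ex then n x1 = x2 else n x2 = x1" and ey: "if ey then n y1 = y2 else n y2 = y1"
    and ez: "if ez then n z1 = z2 else n z2 = z1"
  shows "bracket P n (insert c1 (insert c2 (insert c3 K))) = bracket P n (insert d1 (insert d2 (insert d3 K)))"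
proof -
  let ?K = "insert c1 (insert c2 (insert c3 K))" and ?K' = "insert d1 (insert d2 (insert d3 K))"
  let ?E = "P \<times> (UNIV :: bool set)"
  have cK: "c1 \<in> ?K" "c2 \<in> ?K" "c3 \<in> ?K" and dK: "d1 \<in> ?K'" "d2 \<in> ?K'" "d3 \<in> ?K'" by auto
  have K0: "proper_crossings P K" by (rule proper_crossings_subset[OF K(1)]; auto)
  have fin: "finite K" by (rule finite_crossings[OF P(1) K0])
  have sub: "x1 \<in> P" "x2 \<in> P" "y1 \<in> P" "y2 \<in> P" "z1 \<in> P" "z2 \<in> P"
    using K(1) by (auto simp: proper_crossings_def c)
  have neq: "x1 \<noteq> x2" "x1 \<noteq> y1" "x1 \<noteq> y2" "x1 \<noteq> z1" "x1 \<noteq> z2" "x2 \<noteq> y1" "x2 \<noteq> y2" "x2 \<noteq> z1" "x2 \<noteq> z2"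
     "y1 \<noteq> y2" "y1 \<noteq> z1" "y1 \<noteq> z2" "y2 \<noteq> z1" "y2 \<noteq> z2" "z1 \<noteq> z2"
     "x2 \<noteq> x1" "y1 \<noteq> x1" "y2 \<noteq> x1" "z1 \<noteq> x1" "z2 \<noteq> x1" "y1 \<noteq> x2" "y2 \<noteq> x2" "z1 \<noteq> x2" "z2 \<noteq> x2"
     "y2 \<noteq> y1" "z1 \<noteq> y1" "z2 \<noteq> y1" "z1 \<noteq> y2" "z2 \<noteq> y2" "z2 \<noteq> z1" using dist by auto
  have marker: "\<forall>d\<in>K. x1 \<notin> ends d" "\<forall>d\<in>K. y1 \<notin> ends d" "\<forall>d\<in>K. x2 \<notin> ends d"
      "\<forall>d\<in>K. z1 \<notin> ends d" "\<forall>d\<in>K. y2 \<notin> ends d" "\<forall>d\<in>K. z2 \<notin> ends d"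
    using ends_avoid[OF K(1) cK(1) _ _ K(2)] ends_avoid[OF K(1) cK(2) _ _ K(3)]
      ends_avoid[OF K(1) cK(3) _ _ K(4)] by (simp_all add: c subset_insertI2)
  have ends_d: "x2 \<in> ends d1" "x1 \<in> ends d2" "y1 \<in> ends d3" by (simp_all add: d)
  have dnK: "d1 \<notin> K" "d2 \<notin> K" "d3 \<notin> K" using marker ends_d by blast+
  have cd: "distinct [c1, c2, c3]"
  proof -
    have "ends c1 \<noteq> ends c2" "ends c1 \<noteq> ends c3" "ends c2 \<noteq> ends c3"
      using neq by (auto simp: c doubleton_eq_iff)
    then show ?thesis by auto
  qed
  have dd: "distinct [d1, d2, d3]"
  proof -
    have "ends d1 \<noteq> ends d2" "ends d1 \<noteq> ends d3" "ends d2 \<noteq> ends d3"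
      using neq by (auto simp: d doubleton_eq_iff)
    then show ?thesis by auto
  qed
  note at = smoothing_oriented[OF K(1) cK(1) c(1)] smoothing_oriented[OF K(1) cK(2) c(2)]
    smoothing_oriented[OF K(1) cK(3) c(3)]
  note at' = smoothing_oriented[OF K' dK(1) d(1)] smoothing_oriented[OF K' dK(2) d(2)]
    smoothing_oriented[OF K' dK(3) d(3)]
  note pot = potential_oriented[OF K(1) cK(1) c(1)] potential_oriented[OF K(1) cK(2) c(2)]
    potential_oriented[OF K(1) cK(3) c(3)]
  note pot' = potential_oriented[OF K' dK(1) d(1)] potential_oriented[OF K' dK(2) d(2)]
    potential_oriented[OF K' dK(3) d(3)]
  note st = strands_diagram[OF P K(1)] and st' = strands_diagram[OF P K']
  have arcs: "(x2, ex) = arc_end n (x1, \<not> ex)" "(y2, ey) = arc_end n (y1, \<not> ey)" "(z2, ez) = arc_end n (z1, \<not> ez)"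
    using arc_end_follows[OF P(2) ex] arc_end_follows[OF P(2) ey] arc_end_follows[OF P(2) ez] by simp_all
  have inv: "arc_end n (arc_end n e) = e" if "e \<in> ?E" for e
    using st that by (auto simp: strands_def pairing_def)
  have arcs': "(x1, \<not> ex) = arc_end n (x2, ex)" "(y1, \<not> ey) = arc_end n (y2, ey)" "(z1, \<not> ez) = arc_end n (z2, ez)"
    unfolding arcs using inv sub by auto
  let ?L = "{(x1, ex), (x1, \<not> ex), (x2, \<not> ex), (x2, ex), (y1, ey), (y1, \<not> ey), (y2, \<not> ey), (y2, ey),
      (z1, ez), (z1, \<not> ez), (z2, \<not> ez), (z2, ez)}"
  let ?I = "{(x1, \<not> ex), (x2, ex), (y1, \<not> ey), (y2, ey), (z1, \<not> ez), (z2, ez)}"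
  have L: "fst e \<notin> {x1, x2, y1, y2, z1, z2}" if "e \<in> ?E - ?L" for e
  proof -
    obtain x f where "e = (x, f)" by (cases e)
    then show ?thesis using that by (cases f; cases ex; cases ey; cases ez) auto
  qed
  have off: "smoothing ?K S e = smoothing ?K' S' e"
    if "e \<in> ?E - ?L" "S - {c1, c2, c3, d1, d2, d3} = S' - {c1, c2, c3, d1, d2, d3}" for e S S'
  proof -
    have nd: "x \<notin> {c1, c2, c3, d1, d2, d3}" if "fst e \<in> ends x" for x
      using L[OF \<open>e \<in> _\<close>] that by (auto simp: c d)
    have "smoothing ?K S (fst e, snd e) = smoothing ?K' S' (fst e, snd e)"
    proof (rule smoothing_elsewhere[OF K(1) K'])
      fix x assume "fst e \<in> ends x"
      from nd[OF this] show "x \<in> ?K \<longleftrightarrow> x \<in> ?K'" "x \<in> S \<longleftrightarrow> x \<in> S'"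
        using that(2) by (simp, metis DiffD1 DiffI)
    qed
    then show ?thesis by simp
  qed
  define \<beta> where "\<beta> b = (if b then 1 else 0 :: int)" for b
  have \<beta>: "(if b then 1 else 0) = \<beta> b" "(if b then 0 else 1) = \<beta> (\<not> b)" for b by (simp_all add: \<beta>_def)
  (* Constants added at the crossings, which no loop can notice: \<open>g2\<close> and
     \<open>g3\<close> make the old potential level along the three inner arcs, and
     \<open>h1\<close>, \<open>h2\<close>, \<open>h3\<close> adjust the new one to it at the
     six outer ends. *)
  define g2 where "g2 = \<beta> ((\<not> ex) \<noteq> s1) - \<beta> (ex \<noteq> s2)"
  define g3 where "g3 = \<beta> ((\<not> ey) = s1) - \<beta> (ey \<noteq> s3)"
  define h1 where "h1 = \<beta> ((\<not> ex) \<noteq> s2) + g2 - \<beta> ((\<not> ex) \<noteq> s1)"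
  define h2 where "h2 = \<beta> (ex \<noteq> s1) - \<beta> (ex \<noteq> s2)"
  define h3 where "h3 = \<beta> (ey = s1) - \<beta> (ey \<noteq> s3)"
  define \<gamma> where "\<gamma> x = (if x = x2 \<or> x = z1 then g2 else if x = y2 \<or> x = z2 then g3 else 0)" for x
  define \<gamma>' where "\<gamma>' x = (if x = x2 \<or> x = y2 then h1 else if x = x1 \<or> x = z2 then h2
     else if x = y1 \<or> x = z1 then h3 else 0)" for x
  define u where "u e = potential ?K e + \<gamma> (fst e)" for e
  define u' where "u' e = potential ?K' e + \<gamma>' (fst e)" for e
  have \<gamma>s: "\<gamma> x1 = 0" "\<gamma> y1 = 0" "\<gamma> x2 = g2" "\<gamma> z1 = g2" "\<gamma> y2 = g3" "\<gamma> z2 = g3"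
    "\<gamma>' x2 = h1" "\<gamma>' y2 = h1" "\<gamma>' x1 = h2" "\<gamma>' z2 = h2" "\<gamma>' y1 = h3" "\<gamma>' z1 = h3"
    by (simp_all add: \<gamma>_def \<gamma>'_def neq)
  note us = u_def u'_def \<gamma>s pot pot' fst_conv
  have level: "u (x1, \<not> ex) = u (x2, ex)" "u (y1, \<not> ey) = u (y2, ey)" "u (z1, \<not> ez) = u (z2, ez)"
    unfolding us g2_def g3_def \<beta>_def s by (cases ex; cases ey; cases ez; cases t; simp)+
  have level': "u' (x1, \<not> ex) = u' (x2, ex)" "u' (y1, \<not> ey) = u' (y2, ey)" "u' (z1, \<not> ez) = u' (z2, ez)"
    unfolding us h1_def h2_def h3_def g2_def \<beta>_def s by (cases ex; cases ey; cases ez; cases t; simp)+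
  have away: "u (x1, ex) = u' (x1, ex)" "u (x2, \<not> ex) = u' (x2, \<not> ex)"
     "u (y1, ey) = u' (y1, ey)" "u (y2, \<not> ey) = u' (y2, \<not> ey)"
     "u (z1, ez) = u' (z1, ez)" "u (z2, \<not> ez) = u' (z2, \<not> ez)"
    unfolding us h1_def h2_def h3_def g2_def g3_def \<beta>_def s by (cases ex; cases ey; cases ez; cases t; simp)+
  have u: "loop_product K_weight ?E (arc_end n) (smoothing ?K S) u = state_loops P n ?K S" for S
    unfolding u_def state_loops_def
  proof (rule loop_product_gauge[OF st])
    show "\<gamma> (fst (smoothing ?K S e)) = \<gamma> (fst e)" for e
    proof (rule smoothing_gauge[OF K(1)])
      fix c assume "c \<in> ?K"
      then consider "c = c1" | "c = c2" | "c = c3" | "c \<in> K" by blast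
      then show "\<gamma> (pt1 c) = \<gamma> (pt2 c)"
      proof cases
        case 4 then show ?thesis using marker by (auto simp: \<gamma>_def ends_def)
      qed (simp_all add: c oriented_crossing_def \<gamma>s)
    qed
  qed
  have u': "loop_product K_weight ?E (arc_end n) (smoothing ?K' S) u = state_loops P n ?K' S" for S
    unfolding state_loops_def
  proof (rule loop_product_potential[where g = "\<lambda>e. \<gamma>' (fst e)" and I = ?I, OF st'])
    show "\<gamma>' (fst (smoothing ?K' S e)) = \<gamma>' (fst e)" for e
    proof (rule smoothing_gauge[OF K'])
      fix c assume "c \<in> ?K'"
      then consider "c = d1" | "c = d2" | "c = d3" | "c \<in> K" by blast
      then show "\<gamma>' (pt1 c) = \<gamma>' (pt2 c)"
      proof cases
        case 4 then show ?thesis using marker by (auto simp: \<gamma>'_def ends_def)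
      qed (simp_all add: d oriented_crossing_def \<gamma>s)
    qed
    show "?I \<subseteq> ?E" using sub by simp
    show "arc_end n e \<in> ?I \<and> u (arc_end n e) = u e \<and>
        potential ?K' (arc_end n e) + \<gamma>' (fst (arc_end n e)) = potential ?K' e + \<gamma>' (fst e)" if "e \<in> ?I" for e
    proof -
      have "arc_end n e \<in> ?I \<and> u (arc_end n e) = u e \<and> u' (arc_end n e) = u' e"
        using \<open>e \<in> ?I\<close> level level' by (elim insertE emptyE) (simp_all add: arcs[symmetric] arcs'[symmetric])
      then show ?thesis unfolding u'_def .
    qed
    show "u e = potential ?K' e + \<gamma>' (fst e)" if e: "e \<in> ?E - ?I" for e
    proof (cases "e \<in> ?L")
      case True
      then consider "e = (x1, ex)" | "e = (x2, \<not> ex)" | "e = (y1, ey)" | "e = (y2, \<not> ey)"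
        | "e = (z1, ez)" | "e = (z2, \<not> ez)" using e by blast
      then have "u e = u' e" by cases (simp_all only: away)
      then show ?thesis unfolding u'_def .
    next
      case False
      with e have "e \<in> ?E - ?L" by blast
      then have F: "fst e \<notin> {x1, x2, y1, y2, z1, z2}" by (rule L)
      then have "fst e \<notin> ends c1" "fst e \<notin> ends c2" "fst e \<notin> ends c3"
        "fst e \<notin> ends d1" "fst e \<notin> ends d2" "fst e \<notin> ends d3" by (auto simp: c d)
      then have "potential ?K (fst e, snd e) = potential ?K' (fst e, snd e)"
        by (intro potential_elsewhere) auto
      then show ?thesis using F by (auto simp: u_def \<gamma>_def \<gamma>'_def)
    qed
  qed
  let ?a = "A_pow (if t then 1 else - 1)" and ?b = "A_pow (if t then - 1 else 1)"
  have wt: "K_weight 0 = - (?a * ?a) - ?b * ?b" "?a * ?b = 1"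
    unfolding K_weight_0 d_poly_eq by (auto simp: A_pow_add[symmetric] A_pow_0)
  let ?c = "\<lambda>i. if i then ?a else ?b"
  define t1 where "t1 \<longleftrightarrow> (ex \<longleftrightarrow> ey)"
  define t2 where "t2 \<longleftrightarrow> (ex \<longleftrightarrow> ez)"
  define t3 where "t3 \<longleftrightarrow> (ey \<longleftrightarrow> ez)"
  have exps: "A_pow (smoothing_exponent c1 (i = t1)) = ?c i"
    "A_pow (smoothing_exponent c2 (i = t2)) = ?c i"
    "A_pow (smoothing_exponent c3 (i = t3)) = ?c i"
    "A_pow (smoothing_exponent d1 (i = t1)) = ?c i"
    "A_pow (smoothing_exponent d2 (i = t2)) = ?c i"
    "A_pow (smoothing_exponent d3 (i = t3)) = ?c i" for i
    unfolding c d smoothing_exponent_def ckind_oriented over_kind_def s t1_def t2_def t3_def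
    by (cases i; cases ex; cases ey; cases ez; cases t; simp)+
  have step: "(\<Sum>i\<in>UNIV. \<Sum>j\<in>UNIV. \<Sum>m\<in>UNIV. ?c i * ?c j * ?c m *
       state_loops P n ?K
         (choose_smoothing c1 (i = t1) (choose_smoothing c2 (j = t2) (choose_smoothing c3 (m = t3) S)))) =
     (\<Sum>i\<in>UNIV. \<Sum>j\<in>UNIV. \<Sum>m\<in>UNIV. ?c i * ?c j * ?c m *
       state_loops P n ?K'
         (choose_smoothing d1 (i = t1) (choose_smoothing d2 (j = t2) (choose_smoothing d3 (m = t3) S))))"
    if S: "S \<subseteq> K" for S
  proof -
    define M where "M i j m = smoothing ?K
         (choose_smoothing c1 (i = t1) (choose_smoothing c2 (j = t2) (choose_smoothing c3 (m = t3) S)))" for i j m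
    define N where "N i j m = smoothing ?K'
         (choose_smoothing d1 (i = t1) (choose_smoothing d2 (j = t2) (choose_smoothing d3 (m = t3) S)))" for i j m
    have mem: "c1 \<in> choose_smoothing c1 i (choose_smoothing c2 j (choose_smoothing c3 m S)) \<longleftrightarrow> i"
        "c2 \<in> choose_smoothing c1 i (choose_smoothing c2 j (choose_smoothing c3 m S)) \<longleftrightarrow> j"
        "c3 \<in> choose_smoothing c1 i (choose_smoothing c2 j (choose_smoothing c3 m S)) \<longleftrightarrow> m" for i j m
      using S K(2-4) cd by (auto simp: in_choose_smoothing)
    have mem': "d1 \<in> choose_smoothing d1 i (choose_smoothing d2 j (choose_smoothing d3 m S)) \<longleftrightarrow> i"
        "d2 \<in> choose_smoothing d1 i (choose_smoothing d2 j (choose_smoothing d3 m S)) \<longleftrightarrow> j"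
        "d3 \<in> choose_smoothing d1 i (choose_smoothing d2 j (choose_smoothing d3 m S)) \<longleftrightarrow> m" for i j m
      using S dnK dd by (auto simp: in_choose_smoothing)
    have stM: "strands ?E (arc_end n) (M i j m)" and stN: "strands ?E (arc_end n) (N i j m)" for i j m
      unfolding M_def N_def by (rule st st')+
    have twelve: "distinct [(x1, ex), (x1, \<not> ex), (x2, \<not> ex), (x2, ex), (y1, ey), (y1, \<not> ey), (y2, \<not> ey), (y2, ey),
      (z1, ez), (z1, \<not> ez), (z2, \<not> ez), (z2, ez)]" "?L \<subseteq> ?E" using neq sub by auto
    have twelve': "distinct [(x2, \<not> ex), (x2, ex), (x1, ex), (x1, \<not> ex), (y2, \<not> ey), (y2, ey), (y1, ey), (y1, \<not> ey),
      (z2, \<not> ez), (z2, ez), (z1, ez), (z1, \<not> ez)]"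
      "{(x2, \<not> ex), (x2, ex), (x1, ex), (x1, \<not> ex), (y2, \<not> ey), (y2, ey), (y1, ey), (y1, \<not> ey),
      (z2, \<not> ez), (z2, ez), (z1, ez), (z1, \<not> ez)} \<subseteq> ?E" using neq sub by auto
    have vals: "M i j m (x1, ex) = (if i then (y1, \<not> ey) else (y1, ey))"
      "M i j m (x1, \<not> ex) = (if i then (y1, ey) else (y1, \<not> ey))"
      "M i j m (x2, \<not> ex) = (if j then (z1, ez) else (z1, \<not> ez))"
      "M i j m (x2, ex) = (if j then (z1, \<not> ez) else (z1, ez))"
      "M i j m (y2, \<not> ey) = (if m then (z2, ez) else (z2, \<not> ez))"
      "M i j m (y2, ey) = (if m then (z2, \<not> ez) else (z2, ez))" for i j m
      unfolding M_def at mem t1_def t2_def t3_def by auto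
    have vals': "N i j m (x2, \<not> ex) = (if i then (y2, ey) else (y2, \<not> ey))"
      "N i j m (x2, ex) = (if i then (y2, \<not> ey) else (y2, ey))"
      "N i j m (x1, ex) = (if j then (z2, \<not> ez) else (z2, ez))"
      "N i j m (x1, \<not> ex) = (if j then (z2, ez) else (z2, \<not> ez))"
      "N i j m (y1, ey) = (if m then (z1, \<not> ez) else (z1, ez))"
      "N i j m (y1, \<not> ey) = (if m then (z1, ez) else (z1, \<not> ez))" for i j m
      unfolding N_def at' mem' t1_def t2_def t3_def by auto
    have offM: "M i j m e = M True True True e" if "e \<in> ?E - ?L" for e i j m
    proof -
      have "M i' j' m' e = N True True True e" for i' j' m'
        unfolding M_def N_def by (rule off[OF that]) (auto simp: in_choose_smoothing)
      then show ?thesis by simp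
    qed
    have offN: "N i j m e = M True True True e"
      if e: "e \<in> ?E - {(x2, \<not> ex), (x2, ex), (x1, ex), (x1, \<not> ex), (y2, \<not> ey), (y2, ey), (y1, ey), (y1, \<not> ey),
      (z2, \<not> ez), (z2, ez), (z1, ez), (z1, \<not> ez)}" for e i j m
    proof -
      have "e \<in> ?E - ?L" using e by blast
      then show ?thesis
        unfolding M_def N_def by (rule off[symmetric]) (auto simp: in_choose_smoothing)
    qed
    (* The contribution of the pairing of the outer ends by three given pairs; both sides of
       the move are expressed by it. *)
    define W where "W p p' q q' r r' = loop_product K_weight
        (?E - {(x1, \<not> ex), (x2, ex), (y1, \<not> ey), (y2, ey), (z1, \<not> ez), (z2, ez)}) (arc_end n)
        ((M True True True)(p := p', p' := p, q := q', q' := q, r := r', r' := r)) u" for p p' q q' r r'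
    have I: "?E - {(x1, \<not> ex), (x2, ex), (y1, \<not> ey), (y2, ey), (z1, \<not> ez), (z2, ez)} =
      ?E - {(x2, ex), (x1, \<not> ex), (y2, ey), (y1, \<not> ey), (z2, ez), (z1, \<not> ez)}" by auto
    have "(\<Sum>i\<in>UNIV. \<Sum>j\<in>UNIV. \<Sum>m\<in>UNIV. ?c i * ?c j * ?c m *
        loop_product K_weight ?E (arc_end n) (M i j m) u) =
      ?a * ?a * ?a * W (x1, ex) (z2, \<not> ez) (x2, \<not> ex) (z1, ez) (y1, ey) (y2, \<not> ey)
      + ?a * W (x1, ex) (y1, ey) (x2, \<not> ex) (z1, ez) (y2, \<not> ey) (z2, \<not> ez)
      + ?a * W (x1, ex) (z2, \<not> ez) (x2, \<not> ex) (y2, \<not> ey) (y1, ey) (z1, ez)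
      + ?b * W (x1, ex) (x2, \<not> ex) (y1, ey) (z1, ez) (y2, \<not> ey) (z2, \<not> ez)
      + ?b * W (x1, ex) (y1, ey) (x2, \<not> ex) (y2, \<not> ey) (z1, ez) (z2, \<not> ez)"
      unfolding W_def
      by (rule triangle_local[where E = ?E and \<alpha> = "arc_end n" and M = M and u = u and f = K_weight
          and \<mu>\<^sub>0 = "M True True True" and a = ?a and b = ?b, OF stM twelve arcs level vals _ wt]) (rule offM)
    also have "\<dots> =
      ?a * ?a * ?a * W (x2, \<not> ex) (z1, ez) (x1, ex) (z2, \<not> ez) (y2, \<not> ey) (y1, ey)
      + ?a * W (x2, \<not> ex) (y2, \<not> ey) (x1, ex) (z2, \<not> ez) (y1, ey) (z1, ez)
      + ?a * W (x2, \<not> ex) (z1, ez) (x1, ex) (y1, ey) (y2, \<not> ey) (z2, \<not> ez)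
      + ?b * W (x2, \<not> ex) (x1, ex) (y2, \<not> ey) (z2, \<not> ez) (y1, ey) (z1, ez)
      + ?b * W (x2, \<not> ex) (y2, \<not> ey) (x1, ex) (y1, ey) (z2, \<not> ez) (z1, ez)"
      unfolding W_def by (simp add: fun_upd_twist neq)
    also have "\<dots> = (\<Sum>i\<in>UNIV. \<Sum>j\<in>UNIV. \<Sum>m\<in>UNIV. ?c i * ?c j * ?c m *
        loop_product K_weight ?E (arc_end n) (N i j m) u)"
      unfolding W_def I
      by (rule triangle_local[where E = ?E and \<alpha> = "arc_end n" and M = N and u = u and f = K_weight
          and \<mu>\<^sub>0 = "M True True True" and a = ?a and b = ?b, OF stN twelve' arcs' level[symmetric] vals' _ wt, symmetric]) (rule offN)
    finally have "(\<Sum>i\<in>UNIV. \<Sum>j\<in>UNIV. \<Sum>m\<in>UNIV. ?c i * ?c j * ?c m *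
        loop_product K_weight ?E (arc_end n) (M i j m) u) =
      (\<Sum>i\<in>UNIV. \<Sum>j\<in>UNIV. \<Sum>m\<in>UNIV. ?c i * ?c j * ?c m *
        loop_product K_weight ?E (arc_end n) (N i j m) u)" .
    then show ?thesis unfolding M_def N_def u u' .
  qed
  show ?thesis
    unfolding bracket_insert3[OF fin K(2-4) cd, where ?t1.0 = t1 and ?t2.0 = t2 and ?t3.0 = t3]
      bracket_insert3[OF fin dnK dd, where ?t1.0 = t1 and ?t2.0 = t2 and ?t3.0 = t3] exps
    by (intro sum.cong refl arg_cong2[where f = "(*)"] step) auto
qed

lemma bracket_relabel:
  assumes P: "finite P" "n permutes P" "n' permutes P'"
    and K: "proper_crossings P K" "proper_crossings P' K'"
    and f: "bij_betw f P P'" and n': "\<And>p. p \<in> P \<Longrightarrow> n' (f p) = f (n p)"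
    and K': "K' = (\<lambda>c. Crossing (ckind c) (f (pt1 c)) (f (pt2 c))) ` K"
  shows "bracket P' n' K' = bracket P n K"
proof -
  let ?r = "\<lambda>c. Crossing (ckind c) (f (pt1 c)) (f (pt2 c))"
  have inj: "inj_on f P" using f by (simp add: bij_betw_def)
  have ends: "pt1 c \<in> P" "pt2 c \<in> P" if "c \<in> K" for c
    using K(1) that by (auto simp: proper_crossings_def ends_def)
  have inj_r: "inj_on ?r K"
    using inj ends by (intro inj_onI) (auto simp: inj_on_eq_iff intro: crossing.expand)
  have r: "?r c \<in> K'" if "c \<in> K" for c using that K' by auto
  let ?h = "\<lambda>e :: nat \<times> bool. (f (fst e), snd e)"
  have h: "bij_betw ?h (P \<times> UNIV) (P' \<times> UNIV)"
    using bij_betw_map_prod[OF f bij_betw_id[of "UNIV :: bool set"]]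
    by (rule bij_betw_cong[THEN iffD1, rotated]) (auto simp: map_prod_def)
  have inv: "inv n' (f p) = f (inv n p)" if "p \<in> P" for p
  proof -
    have "inv n p \<in> P" using permutes_in_image[OF permutes_inv[OF P(2)]] that by simp
    then have "n' (f (inv n p)) = f p" using n' permutes_inverses(1)[OF P(2)] by simp
    then show ?thesis using permutes_inverses(2)[OF P(3)] by metis
  qed
  have marker: "\<forall>c'\<in>K'. f q \<notin> ends c'" if "q \<in> P" "\<forall>c\<in>K. q \<notin> ends c" for q
    using that inj ends unfolding K' by (auto simp: ends_def inj_on_eq_iff)
  have loops: "state_loops P' n' K' (?r ` S) = state_loops P n K S" if S: "S \<subseteq> K" for S
    unfolding state_loops_def
  proof (rule loop_product_iso[OF strands_diagram[OF P(1,2) K(1)] h])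
    fix e :: "nat \<times> bool" assume e: "e \<in> P \<times> UNIV"
    obtain q b where qb: "e = (q, b)" "q \<in> P" using e by auto
    show "arc_end n' (?h e) = ?h (arc_end n e)"
      using qb inv n' by (auto simp: arc_end_def)
    show "smoothing K' (?r ` S) (?h e) = ?h (smoothing K S e)"
    proof (cases "\<exists>c\<in>K. q \<in> ends c")
      case True
      then obtain c where c: "c \<in> K" "q = pt1 c \<or> q = pt2 c" by (auto simp: ends_def)
      have "?r c \<in> ?r ` S \<longleftrightarrow> c \<in> S" using inj_on_image_mem_iff[OF inj_r c(1) S] .
      then show ?thesis
        using smoothing_at[OF K(1) c(1), of S b] smoothing_at[OF K(2) r[OF c(1)], of "?r ` S" b] c(2) qb(1)
        by auto
    next
      case False
      then show ?thesis
        using smoothing_marker[of K q S b] smoothing_marker[OF marker[OF qb(2)]] qb by auto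
    qed
    show "potential K' (?h e) = potential K e"
    proof (cases "\<exists>c\<in>K. q \<in> ends c")
      case True
      then obtain c where c: "c \<in> K" "q = pt1 c \<or> q = pt2 c" by (auto simp: ends_def)
      then show ?thesis
        using potential_at[OF K(1) c(1), of b] potential_at[OF K(2) r[OF c(1)], of b] c(2) qb(1)
        by auto
    next
      case False
      then show ?thesis
        using potential_marker[of K q b] potential_marker[OF marker[OF qb(2)]] qb by auto
    qed
  qed
  have weight: "state_weight K' (?r ` S) = state_weight K S" if S: "S \<subseteq> K" for S
  proof -
    have "?r c \<in> ?r ` S \<longleftrightarrow> c \<in> S" if "c \<in> K" for c using inj_on_image_mem_iff[OF inj_r that S] .
    then show ?thesis
      unfolding state_weight_def K' prod.reindex[OF inj_r]
      by (intro prod.cong) (simp_all add: smoothing_exponent_def)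
  qed
  have "Pow K' = (`) ?r ` Pow K" unfolding K' by (simp add: image_Pow_surj)
  then have "bracket P' n' K' = (\<Sum>S\<in>Pow K. state_weight K' (?r ` S) * state_loops P' n' K' (?r ` S))"
    by (simp add: bracket_def sum.reindex[OF inj_on_image_Pow[OF inj_r]])
  also have "\<dots> = bracket P n K"
    unfolding bracket_def by (intro sum.cong refl) (simp add: loops weight)
  finally show ?thesis .
qed

text \<open>
  The new point subdivides an arc. Shrinking the piece from \<open>p\<close> to \<open>m\<close>
  restores the former pairing, with \<open>(m, False)\<close> in the place of \<open>(p,
  False)\<close>.
\<close>

lemma bracket_add_marker:
  assumes P: "finite P" "n permutes P" and K: "proper_crossings P K"
    and p: "p \<in> P" and m: "m \<notin> P"
    and n': "n(m := n p, p := m) permutes insert m P"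
  shows "bracket (insert m P) (n(m := n p, p := m)) K = bracket P n K"
proof -
  let ?n = "n(m := n p, p := m)" and ?E = "P \<times> (UNIV :: bool set)"
  let ?E' = "insert m P \<times> (UNIV :: bool set)"
  have pm: "p \<noteq> m" "m \<noteq> p" using p m by auto
  have K': "proper_crossings (insert m P) K" using K unfolding proper_crossings_def by blast
  have marker: "\<forall>c\<in>K. m \<notin> ends c" using K m by (auto simp: proper_crossings_def)
  note sm = smoothing_marker[OF marker] and pot_m = potential_marker[OF marker]
  have np: "n p \<in> P" "n q \<in> P \<longleftrightarrow> q \<in> P" for q using permutes_in_image[OF P(2)] p by auto
  have i1: "inv ?n m = p" using permutes_inverses(2)[OF n', of p] by simp
  have i2: "inv ?n (n p) = m" using permutes_inverses(2)[OF n', of m] pm by simp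
  have i3: "inv ?n q = inv n q" if "q \<in> P" "q \<noteq> n p" for q
  proof -
    have "inv n q \<in> P" using permutes_in_image[OF permutes_inv[OF P(2)]] that by simp
    moreover have "inv n q \<noteq> p" using that permutes_inverses(1)[OF P(2)] by metis
    ultimately have "?n (inv n q) = q" using permutes_inverses(1)[OF P(2)] m by auto
    then show ?thesis using permutes_inverses(2)[OF n'] by metis
  qed
  have "state_loops (insert m P) ?n K S = state_loops P n K S" for S
  proof -
    note st = strands_diagram[OF P K, of S]
    have st': "strands ?E' (arc_end ?n) (smoothing K S)"
      by (rule strands_diagram[OF _ n' K']) (use P in simp)
    let ?a = "(p, False)" and ?b = "(m, True)"
    (* The potential becomes level along the arc from p to m and passes the value at its
       beginning on to the outgoing end at m. *)
    define \<gamma> where "\<gamma> x = (if x = m then potential K ?a else 0)" for x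
    define u where "u e = potential K e + \<gamma> (fst e)" for e
    have "state_loops (insert m P) ?n K S = loop_product K_weight ?E' (arc_end ?n) (smoothing K S) u"
      unfolding u_def state_loops_def
    proof (rule loop_product_gauge[OF st', symmetric])
      show "\<gamma> (fst (smoothing K S e)) = \<gamma> (fst e)" for e
        by (rule smoothing_gauge[OF K]) (use marker in \<open>auto simp: \<gamma>_def ends_def\<close>)
    qed
    also have "\<dots> = loop_product K_weight (?E' - {?a, ?b}) (arc_end ?n) (bypass ?a ?b (smoothing K S)) u"
    proof -
      have "smoothing K S ?a \<in> ?E" using st p unfolding strands_def pairing_def by blast
      then have "smoothing K S ?a \<noteq> ?b" using m by auto
      moreover have "?b = arc_end ?n ?a" by (simp add: arc_end_def)
      moreover have "u ?a = u ?b" using pm by (simp add: u_def \<gamma>_def pot_m)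
      ultimately show ?thesis using loop_product_bypass[OF st', of ?a ?b u K_weight] p by simp
    qed
    also have "\<dots> = loop_product K_weight ?E (arc_end n) (smoothing K S) (potential K)"
    proof (rule loop_product_iso[OF st])
      let ?h = "\<lambda>e. if e = ?a then (m, False) else e"
      show "bij_betw ?h ?E (?E' - {?a, ?b})"
        by (rule bij_betwI[of _ _ _ "\<lambda>e. if e = (m, False) then ?a else e"])
           (use p m in \<open>auto split: if_splits\<close>)
      fix e :: "nat \<times> bool" assume e: "e \<in> ?E"
      obtain q f where qf: "e = (q, f)" "q \<in> P" using e by auto
      have qm: "q \<noteq> m" using qf m by auto
      have sE: "smoothing K S e \<in> ?E" "smoothing K S (smoothing K S e) = e" "smoothing K S e \<noteq> e"
        using st e by (auto simp: strands_def pairing_def)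
      have aE: "?a \<in> ?E" using p by simp
      have sa: "smoothing K S ?a \<in> ?E" "smoothing K S (smoothing K S ?a) = ?a" "smoothing K S ?a \<noteq> ?a"
        using st aE by (auto simp: strands_def pairing_def)
      show "u (?h e) = potential K e"
        using qf qm pm by (auto simp: u_def \<gamma>_def pot_m)
      show "arc_end ?n (?h e) = ?h (arc_end n e)"
      proof (cases f)
        case True
        show ?thesis
        proof (cases "q = n p")
          case True
          then show ?thesis using \<open>f\<close> qf i2 permutes_inverses(2)[OF P(2)] by (simp add: arc_end_def)
        next
          case False
          moreover have "inv n q \<noteq> p" using False permutes_inverses(1)[OF P(2)] by metis
          ultimately show ?thesis using \<open>f\<close> qf i3 by (simp add: arc_end_def)
        qed
      next
        case False
        then show ?thesis using qf pm qm by (simp add: arc_end_def)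
      qed
      show "bypass ?a ?b (smoothing K S) (?h e) = ?h (smoothing K S e)"
      proof (cases "e = ?a")
        case True
        have "smoothing K S ?a \<noteq> (m, False)" using sa(1) m by auto
        then show ?thesis using True sa pm by (simp add: bypass_def sm)
      next
        case False
        have "smoothing K S e \<noteq> ?b" using sE(1) m by auto
        then show ?thesis using False by (simp add: bypass_def sm)
      qed
    qed
    finally show ?thesis by (simp add: state_loops_def)
  qed
  then show ?thesis by (simp add: bracket_def)
qed

section \<open>Reduction of cusps\<close>

text \<open>
  Neighbouring equal letters have opposite signs in the alternating sum, which makes its
  absolute value an invariant of the reduction of words of even length.
\<close>

fun alternating_sum :: "bool list \<Rightarrow> int" where
  "alternating_sum [] = 0"
| "alternating_sum (s # w) = (if s then 1 else - 1) - alternating_sum w"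

lemma alternating_sum_append:
  "alternating_sum (v @ w) = alternating_sum v + (- 1) ^ length v * alternating_sum w"
  by (induct v) auto

lemma cancel_length: "cancel w w' \<Longrightarrow> length w = length w' + 2"
  by (induct rule: cancel.induct) auto

lemma cancel_alternating_sum:
  "cancel w w' \<Longrightarrow> even (length w) \<Longrightarrow> \<bar>alternating_sum w'\<bar> = \<bar>alternating_sum w\<bar>"
proof (induct rule: cancel.induct)
  case (inner u s v)
  then show ?case by (simp add: alternating_sum_append)
next
  case (cyclic s v)
  then show ?case by (simp add: alternating_sum_append)
qed

lemma cancels_alternating_sum:
  assumes "cancel\<^sup>*\<^sup>* w w'" "even (length w)"
  shows "even (length w') \<and> \<bar>alternating_sum w'\<bar> = \<bar>alternating_sum w\<bar>"
  using assms(1)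
proof (induct rule: rtranclp_induct)
  case base then show ?case using assms(2) by simp
next
  case (step v v')
  then show ?case using cancel_alternating_sum[of v v'] cancel_length[of v v'] by auto
qed

text \<open>In a reduced word the letters alternate, so all its terms have the same sign.\<close>

lemma alternating_sum_reduced:
  "(\<And>u s v. w \<noteq> u @ [s, s] @ v) \<Longrightarrow>
     alternating_sum w = (if w = [] then 0 else (if hd w then 1 else - 1) * int (length w))"
proof (induct w)
  case (Cons s w)
  have "w \<noteq> u @ [s', s'] @ v" for u s' v using Cons(2)[of "s # u" s' v] by auto
  note IH = Cons(1)[OF this]
  show ?case
  proof (cases w)
    case (Cons s' v)
    then have "s' \<noteq> s" using \<open>\<And>u sa v. s # w \<noteq> u @ [sa, sa] @ v\<close>[of "[]" s v] by auto
    then show ?thesis using IH Cons by auto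
  qed simp
qed simp

lemma reduced_exists: "\<exists>w'. cancel\<^sup>*\<^sup>* w w' \<and> (\<nexists>w''. cancel w' w'')"
proof (induct "length w" arbitrary: w rule: less_induct)
  case less
  show ?case
  proof (cases "\<exists>v. cancel w v")
    case True
    then obtain v where v: "cancel w v" by auto
    then have "length v < length w" using cancel_length by fastforce
    from less[OF this] v show ?thesis by (meson converse_rtranclp_into_rtranclp)
  next
    case False then show ?thesis by blast
  qed
qed

lemma cusps_left_eq:
  assumes "even (length w)"
  shows "int (cusps_left w) = \<bar>alternating_sum w\<bar>"
proof -
  have len: "int (length w') = \<bar>alternating_sum w\<bar>" if "cancel\<^sup>*\<^sup>* w w'" "\<nexists>w''. cancel w' w''" for w'
  proof -
    have "w' \<noteq> u @ [s, s] @ v" for u s v using that(2) cancel.inner by metis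
    from alternating_sum_reduced[OF this] have "\<bar>alternating_sum w'\<bar> = int (length w')" by auto
    then show ?thesis using cancels_alternating_sum[OF that(1) assms] by simp
  qed
  obtain w0 where w0: "cancel\<^sup>*\<^sup>* w w0" "\<nexists>w''. cancel w0 w''" using reduced_exists by blast
  have "cusps_left w = length w0"
    unfolding cusps_left_def
  proof (rule the_equality)
    show "\<exists>w'. cancel\<^sup>*\<^sup>* w w' \<and> (\<nexists>w''. cancel w' w'') \<and> length w0 = length w'" using w0 by blast
    show "m = length w0" if "\<exists>w'. cancel\<^sup>*\<^sup>* w w' \<and> (\<nexists>w''. cancel w' w'') \<and> m = length w'" for m
      using that len len[OF w0] by (metis of_nat_eq_iff)
  qed
  then show ?thesis using len[OF w0] by simp
qed

section \<open>The arrow polynomial as a state sum of pairings\<close>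

lemma diagram_facts:
  assumes "is_diagram D"
  shows "finite (points D)" "nxt D permutes points D" "points D \<noteq> {}"
    "proper_crossings (points D) (crossings D)" "proper_crossings (points D) (classical_crossings D)"
  using assms proper_crossings_subset[of "points D" "crossings D" "classical_crossings D"]
  by (auto simp: is_diagram_def proper_crossings_def classical_crossings_def)

lemma crossing_at_Some:
  assumes "is_diagram D" "c \<in> crossings D" "q \<in> ends c"
  shows "crossing_at D q = Some c"
proof -
  have "(THE c. c \<in> crossings D \<and> q \<in> ends c) = c"
  proof (rule the_equality)
    show "c' = c" if "c' \<in> crossings D \<and> q \<in> ends c'" for c'
      using ends_unique[OF diagram_facts(4)[OF assms(1)] assms(2) _ assms(3)] that by simp
  qed (use assms in simp)
  then show ?thesis using assms(2,3) by (auto simp: crossing_at_def)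
qed

lemma crossing_at_SomeD:
  assumes "is_diagram D" "crossing_at D q = Some c"
  shows "c \<in> crossings D \<and> q \<in> ends c"
proof -
  obtain c' where c': "c' \<in> crossings D" "q \<in> ends c'"
    using assms(2) by (auto simp: crossing_at_def split: if_splits)
  then show ?thesis using crossing_at_Some[OF assms(1) c'] assms(2) by simp
qed

text \<open>
  Carries the directed arcs, on which the traversals of a diagram are defined, to the ends of
  arcs.
\<close>

definition arrival :: "diagram \<Rightarrow> nat \<times> bool \<Rightarrow> nat \<times> bool" where
  "arrival D x = (head D x, snd x)"

lemma arrival_leave: "arrival D (leave D q f) = arc_end (nxt D) (q, \<not> f)"
  by (simp add: arrival_def leave_def head_def arc_end_def)

lemma snd_leave [simp]: "snd (leave D q f) = f"
  by (simp add: leave_def)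

lemma arrival_bij:
  assumes "is_diagram D"
  shows "bij_betw (arrival D) (points D \<times> UNIV) (points D \<times> UNIV)"
proof -
  note n = diagram_facts(2)[OF assms]
  show ?thesis
    by (rule bij_betwI[of _ _ _ "\<lambda>e. (if snd e then inv (nxt D) (fst e) else fst e, snd e)"])
       (auto simp: arrival_def head_def permutes_inverses[OF n] permutes_in_image[OF n]
          permutes_in_image[OF permutes_inv[OF n]])
qed

lemma state_step_cases:
  assumes D: "is_diagram D" and c: "c \<in> classical_crossings D" "head D x \<in> ends c"
  shows "state_step D S x = leave D (other c (head D x)) (snd x \<longleftrightarrow> c \<in> S)"
    and "cusps D S x = (if c \<in> S then [] else [head D x = pt1 c])"
  using c crossing_at_Some[OF D, of c "head D x"]
  by (auto simp: state_step_def cusps_def classical_crossings_def)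

lemma state_step_marker:
  assumes D: "is_diagram D" and c: "\<not> (\<exists>c\<in>classical_crossings D. head D x \<in> ends c)"
  shows "state_step D S x = leave D (head D x) (snd x)" and "cusps D S x = []"
  using c crossing_at_SomeD[OF D, of "head D x"]
  by (auto simp: state_step_def cusps_def classical_crossings_def split: option.split)

lemma arrival_state_step:
  assumes D: "is_diagram D"
  shows "arrival D (state_step D S x) =
    (arc_end (nxt D) \<circ> smoothing (classical_crossings D) S) (arrival D x)"
proof (cases "\<exists>c\<in>classical_crossings D. head D x \<in> ends c")
  case True
  then obtain c where c: "c \<in> classical_crossings D" "head D x \<in> ends c" by auto
  have "smoothing (classical_crossings D) S (arrival D x) = (other c (head D x), snd x \<noteq> (c \<in> S))"
    using crossing_of_eq[OF diagram_facts(5)[OF D] c] c by (auto simp: smoothing_def arrival_def)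
  then show ?thesis unfolding state_step_cases(1)[OF D c] arrival_leave by simp
next
  case False
  then show ?thesis unfolding state_step_marker(1)[OF D False] arrival_leave
    by (simp add: smoothing_def arrival_def)
qed

lemma strands_of_diagram:
  assumes D: "is_diagram D"
  shows "strands (points D \<times> UNIV) (arc_end (nxt D)) (smoothing (classical_crossings D) S)"
  by (rule strands_diagram) (use diagram_facts[OF D] in auto)

lemma permutes_dartI:
  assumes D: "is_diagram D" and inj: "inj_on T (points D \<times> UNIV)"
    and T: "\<And>x. x \<in> points D \<times> UNIV \<Longrightarrow> arrival D (T x) \<in> points D \<times> UNIV"
    and out: "\<And>x. fst x \<notin> points D \<Longrightarrow> T x = x"
  shows "T permutes (points D \<times> UNIV)"
proof -
  note n = diagram_facts(2)[OF D]
  have "x \<in> points D \<times> UNIV" if "arrival D x \<in> points D \<times> UNIV" for x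
    using that permutes_in_image[OF n] by (cases x) (auto simp: arrival_def head_def split: if_splits)
  then have "T ` (points D \<times> UNIV) \<subseteq> points D \<times> UNIV" using T by blast
  then have "bij_betw T (points D \<times> UNIV) (points D \<times> UNIV)"
    using inj endo_inj_surj[of "points D \<times> UNIV" T] diagram_facts(1)[OF D] by (simp add: bij_betw_def)
  then show ?thesis by (rule bij_imp_permutes) (simp add: out mem_Times_iff)
qed

lemma crossing_at_outside:
  assumes D: "is_diagram D" and x: "fst x \<notin> points D"
  shows "crossing_at D (head D x) = None" "leave D (head D x) (snd x) = x"
proof -
  have n: "nxt D (fst x) = fst x" using permutes_not_in[OF diagram_facts(2)[OF D] x] .
  then have h: "head D x = fst x" by (simp add: head_def)
  show "crossing_at D (head D x) = None"
    using crossing_at_SomeD[OF D, of "fst x"] diagram_facts(4)[OF D] x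
    by (cases "crossing_at D (fst x)") (auto simp: h proper_crossings_def)
  have "inv (nxt D) (fst x) = fst x"
    using permutes_not_in[OF permutes_inv[OF diagram_facts(2)[OF D]] x] .
  then show "leave D (head D x) (snd x) = x" by (cases "snd x") (simp_all add: h leave_def prod_eq_iff)
qed

lemma state_step_permutes:
  assumes D: "is_diagram D"
  shows "state_step D S permutes (points D \<times> UNIV)"
proof (rule permutes_dartI[OF D])
  let ?X = "points D \<times> (UNIV :: bool set)"
  let ?A = "arc_end (nxt D) \<circ> smoothing (classical_crossings D) S"
  note w = walk_bij[OF strands_of_diagram[OF D, of S]]
  have a: "arrival D x \<in> ?X" if "x \<in> ?X" for x using arrival_bij[OF D] that by (auto simp: bij_betw_def)
  show "arrival D (state_step D S x) \<in> ?X" if "x \<in> ?X" for x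
    unfolding arrival_state_step[OF D] by (rule bspec[OF bij_betwE[OF w] a[OF that]])
  show "inj_on (state_step D S) ?X"
  proof (rule inj_onI)
    fix x y assume xy: "x \<in> ?X" "y \<in> ?X" "state_step D S x = state_step D S y"
    then have "?A (arrival D x) = ?A (arrival D y)" using arrival_state_step[OF D] by metis
    then have "arrival D x = arrival D y"
      using w a[OF xy(1)] a[OF xy(2)] by (meson bij_betw_def inj_onD)
    then show "x = y" using arrival_bij[OF D] xy by (meson bij_betw_def inj_onD)
  qed
  show "state_step D S x = x" if "fst x \<notin> points D" for x
    using crossing_at_outside[OF D that] by (simp add: state_step_def)
qed

lemma state_step_permutation: "is_diagram D \<Longrightarrow> permutation (state_step D S)"
  unfolding permutation_permutes
  by (intro exI[of _ "points D \<times> UNIV"] conjI state_step_permutes) (simp_all add: diagram_facts(1))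

lemma state_step_orbit:
  assumes D: "is_diagram D"
  shows "arrival D ` orbit (state_step D S) x =
    orbit (arc_end (nxt D) \<circ> smoothing (classical_crossings D) S) (arrival D x)"
proof (rule orbit_inverse)
  show "x \<in> orbit (state_step D S) x"
    by (rule permutation_self_in_orbit[OF state_step_permutation[OF D]])
qed (simp only: arrival_state_step[OF D])

lemma arc_end_arrival:
  assumes "is_diagram D"
  shows "arc_end (nxt D) (arrival D x) = arrival D (fst x, \<not> snd x)"
  using permutes_inverses[OF diagram_facts(2)[OF assms]]
  by (auto simp: arc_end_def arrival_def head_def)

definition loop_ends :: "diagram \<Rightarrow> nat set \<Rightarrow> (nat \<times> bool) set" where
  "loop_ends D C = arrival D ` (C \<times> UNIV)"

lemma loop_through_arrival:
  assumes D: "is_diagram D"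
  shows "loop_through (arc_end (nxt D)) (smoothing (classical_crossings D) S) (arrival D x) =
    loop_ends D (fst ` orbit (state_step D S) x)"
proof -
  have "fst ` O' \<times> UNIV = O' \<union> (\<lambda>x. (fst x, \<not> snd x)) ` O'" for O' :: "(nat \<times> bool) set"
  proof (rule set_eqI)
    fix y :: "nat \<times> bool"
    have "y \<in> fst ` O' \<times> UNIV \<longleftrightarrow> (fst y, snd y) \<in> O' \<or> (fst y, \<not> snd y) \<in> O'"
      by (cases y; cases "snd y") (auto simp: image_iff, (metis (full_types) fst_conv prod.collapse)+)
    also have "(fst y, \<not> snd y) \<in> O' \<longleftrightarrow> y \<in> (\<lambda>x. (fst x, \<not> snd x)) ` O'"
      by (cases y) (force simp: image_iff)
    finally show "y \<in> fst ` O' \<times> UNIV \<longleftrightarrow> y \<in> O' \<union> (\<lambda>x. (fst x, \<not> snd x)) ` O'" by simp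
  qed
  then show ?thesis
    unfolding loop_through_def loop_ends_def state_step_orbit[OF D, symmetric]
    by (simp add: image_Un image_image arc_end_arrival[OF D])
qed

lemma image_Times_UNIV:
  assumes "\<And>p b. p \<in> P \<Longrightarrow> g (p, b) = g (p, c)"
  shows "g ` (P \<times> UNIV) = (\<lambda>p. g (p, c)) ` P"
proof (intro equalityI subsetI)
  fix y assume "y \<in> g ` (P \<times> UNIV)"
  then obtain p b where p: "p \<in> P" "y = g (p, b)" by auto
  have "y = g (p, c)" by (rule trans[OF p(2) assms[OF p(1)]])
  then show "y \<in> (\<lambda>p. g (p, c)) ` P" using p(1) by (rule image_eqI)
qed auto

lemma loops_are_loop_ends:
  assumes D: "is_diagram D"
  shows "loop_through (arc_end (nxt D)) (smoothing (classical_crossings D) S) ` (points D \<times> UNIV) =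
    loop_ends D ` loops D S"
proof -
  let ?lt = "loop_through (arc_end (nxt D)) (smoothing (classical_crossings D) S)"
  let ?X = "points D \<times> (UNIV :: bool set)"
  have "?lt ` ?X = ?lt ` arrival D ` ?X" using arrival_bij[OF D] by (simp add: bij_betw_def)
  also have "\<dots> = (\<lambda>x. ?lt (arrival D x)) ` ?X" by (simp only: image_image)
  also have "\<dots> = (\<lambda>p. ?lt (arrival D (p, True))) ` points D"
  proof (rule image_Times_UNIV)
    fix p b assume p: "p \<in> points D"
    have e: "arrival D (p, True) \<in> ?X" using arrival_bij[OF D] p by (auto simp: bij_betw_def)
    have "arrival D (p, False) = arc_end (nxt D) (arrival D (p, True))"
      by (simp add: arc_end_arrival[OF D])
    also have "\<dots> \<in> ?lt (arrival D (p, True))"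
      using self_in_orbit[OF _ walk_bij[OF strands_of_diagram[OF D]] e] diagram_facts(1)[OF D]
      by (auto simp: loop_through_def)
    finally have "?lt (arrival D (p, False)) = ?lt (arrival D (p, True))"
      by (rule loop_through_eq[OF strands_of_diagram[OF D] e])
    then show "?lt (arrival D (p, b)) = ?lt (arrival D (p, True))" by (cases b) simp_all
  qed
  also have "\<dots> = loop_ends D ` loops D S"
    by (simp only: loops_def image_image loop_through_arrival[OF D])
  finally show ?thesis .
qed

lemma loops_subset:
  assumes D: "is_diagram D" and C: "C \<in> loops D S"
  shows "C \<subseteq> points D" "C \<noteq> {}"
proof -
  obtain p where p: "p \<in> points D" "C = fst ` orbit (state_step D S) (p, True)"
    using C by (auto simp: loops_def)
  then show "C \<subseteq> points D"
    using permutes_orbit_subset[OF state_step_permutes[OF D], of "(p, True)" S] by auto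
  show "C \<noteq> {}" unfolding p(2) by (simp add: orbit_nonempty)
qed

lemma inj_on_loop_ends:
  assumes D: "is_diagram D"
  shows "inj_on (loop_ends D) (loops D S)"
proof (rule inj_onI)
  fix C C' assume C: "C \<in> loops D S" "C' \<in> loops D S" "loop_ends D C = loop_ends D C'"
  have "C \<times> (UNIV :: bool set) = C' \<times> UNIV"
  proof (rule inj_on_image_eq_iff[THEN iffD1])
    show "inj_on (arrival D) (points D \<times> UNIV)" using arrival_bij[OF D] by (simp add: bij_betw_def)
    show "arrival D ` (C \<times> UNIV) = arrival D ` (C' \<times> UNIV)" using C(3) by (simp add: loop_ends_def)
  qed (use loops_subset(1)[OF D C(1)] loops_subset(1)[OF D C(2)] in auto)
  then show "C = C'" by (auto simp: times_eq_iff)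
qed

text \<open>
  The cusps met at the end of a directed arc, counted with the signs of the alternating sum. The
  direction of travel relative to the orientation flips exactly at the cusps, so it provides
  those signs locally.
\<close>

definition cusp_sum :: "diagram \<Rightarrow> crossing set \<Rightarrow> nat \<times> bool \<Rightarrow> int" where
  "cusp_sum D S x = (if snd x then 1 else - 1) * alternating_sum (cusps D S x)"

text \<open>
  This moves the cusps from the smoothings into a potential that does not depend on the state.
\<close>

lemma potential_smoothing:
  assumes D: "is_diagram D"
  shows "potential (classical_crossings D) (smoothing (classical_crossings D) S (arrival D x))
    - potential (classical_crossings D) (arrival D x) = cusp_sum D S x"
proof (cases "\<exists>c\<in>classical_crossings D. head D x \<in> ends c")
  case True
  then obtain c where c: "c \<in> classical_crossings D" "head D x \<in> ends c" by auto
  note P = diagram_facts(5)[OF D]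
  have neq: "pt1 c \<noteq> pt2 c" "pt2 c \<noteq> pt1 c" using P c(1) by (auto simp: proper_crossings_def)
  consider "head D x = pt1 c" | "head D x = pt2 c" using c(2) by (auto simp: ends_def)
  then show ?thesis
    by cases (simp_all add: neq arrival_def smoothing_at[OF P c(1)] potential_at[OF P c(1)]
        cusp_sum_def state_step_cases(2)[OF D c])
next
  case False
  then show ?thesis
    using potential_marker[of "classical_crossings D" "head D x"] state_step_marker(2)[OF D False]
    by (simp add: smoothing_def arrival_def cusp_sum_def)
qed

text \<open>
  Only disoriented smoothings, which carry one cusp each, turn a traveller against the
  orientation.
\<close>

lemma snd_state_step:
  assumes D: "is_diagram D"
  shows "(if snd (state_step D S x) then 1 else - 1 :: int) =
    (if snd x then 1 else - 1) * (- 1) ^ length (cusps D S x)"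
proof (cases "\<exists>c\<in>classical_crossings D. head D x \<in> ends c")
  case True
  then obtain c where c: "c \<in> classical_crossings D" "head D x \<in> ends c" by auto
  then show ?thesis by (simp add: state_step_cases[OF D c])
next
  case False
  then show ?thesis by (simp add: state_step_marker[OF D False])
qed

lemma cusp_sum_path:
  fixes D S x
  assumes D: "is_diagram D"
  defines "w k \<equiv> concat (map (cusps D S) (map (\<lambda>i. (state_step D S ^^ i) x) [0..<k]))"
  shows "(\<Sum>i<k. cusp_sum D S ((state_step D S ^^ i) x)) = (if snd x then 1 else - 1) * alternating_sum (w k)
    \<and> (if snd ((state_step D S ^^ k) x) then 1 else - 1 :: int) = (if snd x then 1 else - 1) * (- 1) ^ length (w k)"
proof (induct k)
  case 0 then show ?case by (simp add: w_def)
next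
  case (Suc k)
  let ?y = "(state_step D S ^^ k) x"
  have w: "w (Suc k) = w k @ cusps D S ?y" by (simp add: w_def)
  have y: "cusp_sum D S ?y = (if snd x then 1 else - 1) * (- 1) ^ length (w k) * alternating_sum (cusps D S ?y)"
    unfolding cusp_sum_def using Suc by simp
  show ?case
    using Suc snd_state_step[OF D, of S ?y]
    by (simp add: w alternating_sum_append y power_add algebra_simps)
qed

lemma cusp_sum_loop:
  fixes S :: "crossing set"
  assumes D: "is_diagram D"
  defines "w x \<equiv> concat (map (cusps D S) (support (state_step D S) x))"
  shows "\<bar>\<Sum>y\<in>orbit (state_step D S) x. cusp_sum D S y\<bar> = int (cusps_left (w x))"
    and "even (length (w x))"
proof -
  let ?T = "state_step D S"
  have perm: "permutation ?T" by (rule state_step_permutation[OF D])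
  let ?k = "least_power ?T x"
  have "(?T ^^ ?k) x = x" by (rule least_power_of_permutation(1)[OF perm])
  then show ev: "even (length (w x))"
    using cusp_sum_path[OF D, of S x ?k] unfolding w_def
    by (cases "even (length (w x))") (auto simp: w_def split: if_splits)
  have "distinct (support ?T x)" using cycle_of_permutation[OF perm] by simp
  then have "(\<Sum>y\<in>set (support ?T x). cusp_sum D S y) = sum_list (map (cusp_sum D S) (support ?T x))"
    by (simp only: sum_list_distinct_conv_sum_set)
  also have "\<dots> = (\<Sum>i<?k. cusp_sum D S ((?T ^^ i) x))"
    by (simp add: interv_sum_list_conv_sum_set_nat comp_def lessThan_atLeast0)
  finally have "(\<Sum>y\<in>orbit ?T x. cusp_sum D S y) = (if snd x then 1 else - 1) * alternating_sum (w x)"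
    using cusp_sum_path[OF D, of S x ?k] support_set[OF perm, of x] orbit_altdef_permutation[OF perm, of x]
    unfolding w_def by (simp add: full_SetCompr_eq)
  then show "\<bar>\<Sum>y\<in>orbit ?T x. cusp_sum D S y\<bar> = int (cusps_left (w x))"
    using cusps_left_eq[OF ev] by (simp add: abs_mult)
qed

text \<open>
  Around a closed curve the increments along the arcs and across the smoothings cancel, which
  turns the sum over arcs into the sum over cusps, up to sign.
\<close>

lemma turning_loop_ends:
  assumes D: "is_diagram D" and C: "C \<in> loops D S" and x: "fst x \<in> C"
  shows "turning (arc_end (nxt D)) (smoothing (classical_crossings D) S) (potential (classical_crossings D))
      (loop_ends D C) = \<bar>\<Sum>y\<in>orbit (state_step D S) x. cusp_sum D S y\<bar>"
proof -
  let ?\<alpha> = "arc_end (nxt D)" and ?\<mu> = "smoothing (classical_crossings D) S"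
  let ?u = "potential (classical_crossings D)" and ?X = "points D \<times> (UNIV :: bool set)"
  note st = strands_of_diagram[OF D, of S]
  have xX: "x \<in> ?X" using x loops_subset(1)[OF D C] by (cases x) auto
  have aX: "arrival D x \<in> ?X" using arrival_bij[OF D] xX by (auto simp: bij_betw_def)
  have "arrival D x \<in> loop_ends D C" unfolding loop_ends_def using x by (cases x) auto
  moreover have "loop_ends D C \<in> loop_through ?\<alpha> ?\<mu> ` ?X" unfolding loops_are_loop_ends[OF D] using C by blast
  ultimately have "turning ?\<alpha> ?\<mu> ?u (loop_ends D C) = \<bar>\<Sum>e\<in>orbit (?\<alpha> \<circ> ?\<mu>) (arrival D x). ?u (?\<alpha> e) - ?u e\<bar>"
    using turning_of_member[OF st] by blast
  also have "(\<Sum>e\<in>orbit (?\<alpha> \<circ> ?\<mu>) (arrival D x). ?u (?\<alpha> e) - ?u e) =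
      (\<Sum>e\<in>orbit (?\<alpha> \<circ> ?\<mu>) (arrival D x). ?u (?\<mu> e) - ?u e)"
  proof -
    have sub: "orbit (?\<alpha> \<circ> ?\<mu>) (arrival D x) \<subseteq> ?X" by (rule orbit_subset_bij[OF walk_bij[OF st] aX])
    have "(\<Sum>e\<in>orbit (?\<alpha> \<circ> ?\<mu>) (arrival D x). ?u (?\<alpha> e)) = (\<Sum>e\<in>orbit (?\<alpha> \<circ> ?\<mu>) (arrival D x). ?u (?\<alpha> ((?\<alpha> \<circ> ?\<mu>) e)))"
      by (rule sum_orbit_shift[OF _ walk_bij[OF st] aX, symmetric]) (use diagram_facts(1)[OF D] in simp)
    also have "\<dots> = (\<Sum>e\<in>orbit (?\<alpha> \<circ> ?\<mu>) (arrival D x). ?u (?\<mu> e))"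
    proof (intro sum.cong refl)
      fix e assume "e \<in> orbit (?\<alpha> \<circ> ?\<mu>) (arrival D x)"
      then have \<mu>e: "?\<mu> e \<in> ?X" using sub st unfolding strands_def pairing_def by blast
      have "\<forall>e\<in>?X. ?\<alpha> (?\<alpha> e) = e" using st unfolding strands_def pairing_def by blast
      then have "?\<alpha> (?\<alpha> (?\<mu> e)) = ?\<mu> e" using \<mu>e by (rule bspec)
      then show "?u (?\<alpha> ((?\<alpha> \<circ> ?\<mu>) e)) = ?u (?\<mu> e)" by simp
    qed
    finally show ?thesis by (simp add: sum_subtractf)
  qed
  also have "\<dots> = (\<Sum>y\<in>orbit (state_step D S) x. cusp_sum D S y)"
  proof -
    have "inj_on (arrival D) (orbit (state_step D S) x)"
      using arrival_bij[OF D] permutes_orbit_subset[OF state_step_permutes[OF D] xX, of S]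
      by (auto simp: bij_betw_def intro: inj_on_subset)
    then show ?thesis
      unfolding state_step_orbit[OF D, symmetric]
      by (simp add: sum.reindex potential_smoothing[OF D])
  qed
  finally show ?thesis .
qed

lemma arrow_number_loop:
  assumes D: "is_diagram D" and C: "C \<in> loops D S" and x: "fst x \<in> C"
  shows "\<bar>\<Sum>y\<in>orbit (state_step D S) x. cusp_sum D S y\<bar> = 2 * int (arrow_number D S C)"
proof -
  have "finite C" using loops_subset(1)[OF D C] diagram_facts(1)[OF D] finite_subset by blast
  then have m: "Min C \<in> C" using loops_subset(2)[OF D C] by simp
  have "\<bar>\<Sum>y\<in>orbit (state_step D S) x. cusp_sum D S y\<bar> = int (cusps_left (cusp_word D S C))"
    using turning_loop_ends[OF D C x] turning_loop_ends[OF D C, of "(Min C, True)"] m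
      cusp_sum_loop(1)[OF D, of S "(Min C, True)"] by (simp add: cusp_word_def)
  moreover have "even (cusps_left (cusp_word D S C))"
  proof -
    have "even (alternating_sum w) \<longleftrightarrow> even (length w)" for w by (induct w) auto
    then have "even (alternating_sum (cusp_word D S C))"
      using cusp_sum_loop(2)[OF D, of S "(Min C, True)"] by (simp add: cusp_word_def)
    then have "even (int (cusps_left (cusp_word D S C)))"
      using cusps_left_eq[of "cusp_word D S C"] cusp_sum_loop(2)[OF D, of S "(Min C, True)"]
      by (simp add: cusp_word_def)
    then show ?thesis by simp
  qed
  ultimately show ?thesis by (auto simp: arrow_number_def elim: evenE)
qed

text \<open>
  The additional factor \<open>d\<close> removes the exponent \<open>|S| - 1\<close> and leaves
  a product over the loops.
\<close>

theorem arrow_polynomial_bracket: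
  assumes D: "is_diagram D"
  shows "d_poly * arrow_polynomial D = bracket (points D) (nxt D) (classical_crossings D)"
proof -
  let ?K = "classical_crossings D"
  have fin: "finite (points D)" "points D \<noteq> {}" using diagram_facts[OF D] by auto
  have "d_poly * (A_pow (coeff_exponent D S) * d_poly ^ (card (loops D S) - 1) * state_value D S) =
      state_weight ?K S * state_loops (points D) (nxt D) ?K S" for S
  proof -
    have "A_pow (coeff_exponent D S) = state_weight ?K S"
    proof -
      have "A_pow (\<Sum>c\<in>B. g c) = (\<Prod>c\<in>B. A_pow (g c))" for B and g :: "crossing \<Rightarrow> int"
        by (induct B rule: infinite_finite_induct) (auto simp: A_pow_0 A_pow_add)
      then show ?thesis
        by (simp add: state_weight_def coeff_exponent_def smoothing_exponent_def)
    qed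
    moreover have "d_poly * d_poly ^ (card (loops D S) - 1) = d_poly ^ card (loops D S)"
    proof -
      have "loops D S \<noteq> {}" "finite (loops D S)" using fin by (auto simp: loops_def)
      then show ?thesis by (metis card_gt_0_iff power_eq_if less_numeral_extra(3))
    qed
    moreover have "state_loops (points D) (nxt D) ?K S = d_poly ^ card (loops D S) * state_value D S"
    proof -
      have per_loop: "K_weight (turning (arc_end (nxt D)) (smoothing ?K S) (potential ?K) (loop_ends D C)) =
          d_poly * loop_value D S C" if C: "C \<in> loops D S" for C
      proof -
        obtain p where p: "p \<in> C" using loops_subset(2)[OF D C] by auto
        show ?thesis
          using turning_loop_ends[OF D C, of "(p, True)"] arrow_number_loop[OF D C, of "(p, True)"] p
          by (simp add: K_weight_def loop_value_def)
      qed
      show ?thesis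
        unfolding state_loops_def loop_product_def loops_are_loop_ends[OF D]
          prod.reindex[OF inj_on_loop_ends[OF D]]
        by (simp add: per_loop prod.distrib state_value_def)
    qed
    ultimately show ?thesis by (metis (no_types, lifting) mult.assoc mult.left_commute)
  qed
  then show ?thesis by (simp add: arrow_polynomial_def bracket_def states_def sum_distrib_left)
qed

section \<open>Invariance of the occurring monomials\<close>

text \<open>
  The monomial of the \<open>K\<^sub>i\<close> with exponents \<open>\<mu>\<close> occurs with
  some power of \<open>A\<close>; this is insensitive to units.
\<close>

definition K_occurs :: "arrow_ring \<Rightarrow> (nat \<Rightarrow>\<^sub>0 nat) \<Rightarrow> bool" where
  "K_occurs f \<mu> \<longleftrightarrow> (\<exists>m. Poly_Mapping.lookup f (m, \<mu>) \<noteq> 0)"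

lemma lookup_A_pow_times:
  "Poly_Mapping.lookup (A_pow k * f) (m, \<mu>) = Poly_Mapping.lookup f (m - k, \<mu>)"
proof (induct f rule: update_induct)
  case const
  then show ?case by simp
next
  case (update f e v)
  have "Poly_Mapping.update e v f = f + Poly_Mapping.single e v"
    using update(1) by (intro poly_mapping_eqI) (auto simp: lookup_update lookup_add lookup_single when_def in_keys_iff)
  moreover have "Poly_Mapping.lookup (A_pow k * Poly_Mapping.single e v) (m, \<mu>) =
      Poly_Mapping.lookup (Poly_Mapping.single e v) (m - k, \<mu>)"
    by (cases e) (auto simp: A_pow_def mult_single lookup_single when_def)
  ultimately show ?case using update(3) by (simp add: distrib_left lookup_add)
qed

lemma K_occurs_A_pow: "K_occurs (A_pow k * f) \<mu> \<longleftrightarrow> K_occurs f \<mu>"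
  unfolding K_occurs_def lookup_A_pow_times by (metis add_diff_cancel_right')

lemma K_occurs_uminus: "K_occurs (- f) \<mu> \<longleftrightarrow> K_occurs f \<mu>"
  by (simp add: K_occurs_def)

text \<open>
  The highest power of \<open>A\<close> next to the given monomial cannot cancel in the product.
\<close>

lemma K_occurs_d_poly: "K_occurs (d_poly * f) \<mu> \<longleftrightarrow> K_occurs f \<mu>"
proof -
  have l: "Poly_Mapping.lookup (d_poly * f) (m, \<mu>) =
      - Poly_Mapping.lookup f (m - 2, \<mu>) - Poly_Mapping.lookup f (m + 2, \<mu>)" for m
    by (simp add: d_poly_def left_diff_distrib lookup_A_pow_times lookup_minus)
  show ?thesis
  proof
    assume "K_occurs (d_poly * f) \<mu>"
    then show "K_occurs f \<mu>" unfolding K_occurs_def l by (metis diff_0_right neg_0_equal_iff_equal)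
  next
    assume f: "K_occurs f \<mu>"
    define M where "M = {m. Poly_Mapping.lookup f (m, \<mu>) \<noteq> 0}"
    have "M \<subseteq> fst ` Poly_Mapping.keys f" unfolding M_def by (force simp: in_keys_iff)
    then have "finite M" by (rule finite_subset) simp
    moreover have "M \<noteq> {}" using f by (auto simp: K_occurs_def M_def)
    ultimately have "Max M \<in> M" by (rule Max_in)
    moreover have "Max M + 4 \<notin> M" using Max_ge[OF \<open>finite M\<close>, of "Max M + 4"] by auto
    ultimately have "Poly_Mapping.lookup (d_poly * f) (Max M + 2, \<mu>) \<noteq> 0"
      unfolding l M_def by (simp add: add.assoc)
    then show "K_occurs (d_poly * f) \<mu>" unfolding K_occurs_def by blast
  qed
qed

definition diagram_bracket :: "diagram \<Rightarrow> arrow_ring" where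
  "diagram_bracket D = bracket (points D) (nxt D) (classical_crossings D)"

lemma K_occurs_arrow_polynomial:
  assumes "is_diagram D"
  shows "K_occurs (arrow_polynomial D) \<mu> \<longleftrightarrow> K_occurs (diagram_bracket D) \<mu>"
  using arrow_polynomial_bracket[OF assms] K_occurs_d_poly by (metis diagram_bracket_def)

lemma diagram_bracket_relabelling:
  assumes "is_diagram D" "is_diagram D'" "relabelling D D'"
  shows "diagram_bracket D' = diagram_bracket D"
proof -
  obtain f where f: "bij_betw f (points D) (points D')" "\<forall>p\<in>points D. nxt D' (f p) = f (nxt D p)"
    and c: "crossings D' = (\<lambda>c. Crossing (ckind c) (f (pt1 c)) (f (pt2 c))) ` crossings D"
    using assms(3) by (auto simp: relabelling_def)
  show ?thesis
    unfolding diagram_bracket_def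
  proof (rule bracket_relabel[OF _ _ _ _ _ f(1)])
    show "classical_crossings D' =
        (\<lambda>c. Crossing (ckind c) (f (pt1 c)) (f (pt2 c))) ` classical_crossings D"
      unfolding classical_crossings_def c by force
  qed (use diagram_facts[OF assms(1)] diagram_facts[OF assms(2)] f(2) in auto)
qed

lemma diagram_bracket_add_marker:
  assumes "is_diagram D" "is_diagram D'" "add_marker D D'"
  shows "diagram_bracket D' = diagram_bracket D"
proof -
  obtain p m where p: "p \<in> points D" "m \<notin> points D"
    and D': "D' = \<lparr>points = insert m (points D), nxt = (nxt D)(m := nxt D p, p := m), crossings = crossings D\<rparr>"
    using assms(3) by (auto simp: add_marker_def)
  have "(nxt D)(m := nxt D p, p := m) permutes insert m (points D)"
    using diagram_facts(2)[OF assms(2)] by (simp add: D')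
  from bracket_add_marker[OF diagram_facts(1,2,5)[OF assms(1)] p this]
  show ?thesis by (simp add: diagram_bracket_def D' classical_crossings_def)
qed

lemma K_occurs_reidemeister1:
  assumes D: "is_diagram D" and R: "reidemeister1 D D'"
  shows "K_occurs (diagram_bracket D') \<mu> \<longleftrightarrow> K_occurs (diagram_bracket D) \<mu>"
proof -
  obtain c where c: "c \<in> crossings D" "nxt D (pt1 c) = pt2 c \<or> nxt D (pt2 c) = pt1 c"
    and D': "D' = D\<lparr>crossings := crossings D - {c}\<rparr>" using R by (auto simp: reidemeister1_def)
  show ?thesis
  proof (cases "ckind c = Virtual")
    case True
    then have "classical_crossings D' = classical_crossings D" by (auto simp: classical_crossings_def D')
    then show ?thesis by (simp add: diagram_bracket_def D')
  next
    case False
    then have K: "classical_crossings D = insert c (classical_crossings D')" "c \<notin> classical_crossings D'"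
      using c(1) by (auto simp: classical_crossings_def D')
    have "diagram_bracket D = - A_pow (if ckind c = Positive then 3 else - 3) * diagram_bracket D'"
      unfolding diagram_bracket_def K(1)
      using bracket_kink[OF diagram_facts(1,2)[OF D] diagram_facts(5)[OF D, unfolded K(1)] K(2) c(2) False]
      by (simp add: D')
    then have "diagram_bracket D = - (A_pow (if ckind c = Positive then 3 else - 3) * diagram_bracket D')"
      by simp
    then show ?thesis by (simp only: K_occurs_uminus K_occurs_A_pow)
  qed
qed

lemma diagram_bracket_reidemeister2:
  assumes D: "is_diagram D" and R: "reidemeister2 D D'"
  shows "diagram_bracket D' = diagram_bracket D"
proof -
  obtain k k' p p' q q' where k: "(k, k') \<in> {(Positive, Negative), (Negative, Positive), (Virtual, Virtual)}"
    and dist: "distinct [p, p', q, q']"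
    and c: "Crossing k p q \<in> crossings D" "Crossing k' q' p' \<in> crossings D"
    and n: "nxt D p = p' \<or> nxt D p' = p" "nxt D q = q' \<or> nxt D q' = q"
    and D': "D' = D\<lparr>crossings := crossings D - {Crossing k p q, Crossing k' q' p'}\<rparr>"
    using R unfolding reidemeister2_def by blast
  show ?thesis
  proof (cases "k = Virtual")
    case True
    then have "k' = Virtual" using k by auto
    then have "classical_crossings D' = classical_crossings D"
      using True by (auto simp: classical_crossings_def D')
    then show ?thesis by (simp add: diagram_bracket_def D')
  next
    case False
    then have kk: "(k, k') \<in> {(Positive, Negative), (Negative, Positive)}" and "k' \<noteq> Virtual" using k by auto
    then have K: "classical_crossings D = insert (Crossing k p q) (insert (Crossing k' q' p') (classical_crossings D'))"
      "Crossing k p q \<notin> classical_crossings D'" "Crossing k' q' p' \<notin> classical_crossings D'"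
      using c False by (auto simp: classical_crossings_def D')
    show ?thesis
      unfolding diagram_bracket_def K(1)
      using bracket_bigon[OF diagram_facts(1,2)[OF D] diagram_facts(5)[OF D, unfolded K(1)] K(2,3) refl refl dist kk n]
      by (simp add: D')
  qed
qed

lemma diagram_bracket_reidemeister3:
  assumes D: "is_diagram D" and D': "is_diagram D'" and R: "reidemeister3 D D'"
  shows "diagram_bracket D' = diagram_bracket D"
proof -
  obtain x1 x2 y1 y2 z1 z2 ex ey ez t s1 s2 s3 k1 k2 k3 where
    dist: "distinct [x1, x2, y1, y2, z1, z2]"
    and f: "follows D ex x1 x2" "follows D ey y1 y2" "follows D ez z1 z2"
    and s: "s1 \<longleftrightarrow> (t \<longleftrightarrow> (ex \<longleftrightarrow> ey))" "s2 \<longleftrightarrow> (t \<longleftrightarrow> (ex \<longleftrightarrow> ez))" "s3 \<longleftrightarrow> (t \<longleftrightarrow> (ey \<longleftrightarrow> ez))"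
    and k: "k1 = over_kind s1 \<and> k2 = over_kind s2 \<and> k3 = over_kind s3 \<or> k1 = Virtual \<and> k2 = Virtual"
    and old: "{oriented_crossing s1 k1 x1 y1, oriented_crossing s2 k2 x2 z1,
                    oriented_crossing s3 k3 y2 z2} \<subseteq> crossings D"
    and D'eq: "D' = D\<lparr>crossings := crossings D - {oriented_crossing s1 k1 x1 y1, oriented_crossing s2 k2 x2 z1,
                    oriented_crossing s3 k3 y2 z2} \<union> {oriented_crossing s1 k1 x2 y2, oriented_crossing s2 k2 x1 z2,
                    oriented_crossing s3 k3 y1 z1}\<rparr>"
    using R unfolding reidemeister3_def Let_def by (elim exE conjE) (rule that; assumption)
  define c1 c2 c3 where c: "c1 = oriented_crossing s1 k1 x1 y1" "c2 = oriented_crossing s2 k2 x2 z1"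
    "c3 = oriented_crossing s3 k3 y2 z2"
  define d1 d2 d3 where d: "d1 = oriented_crossing s1 k1 x2 y2" "d2 = oriented_crossing s2 k2 x1 z2"
    "d3 = oriented_crossing s3 k3 y1 z1"
  note P = diagram_facts(1,2)[OF D]
  have same: "points D' = points D" "nxt D' = nxt D" by (simp_all add: D'eq)
  have cD: "c1 \<in> crossings D" "c2 \<in> crossings D" "c3 \<in> crossings D" using old by (auto simp: c)
  have X': "crossings D' = crossings D - {c1, c2, c3} \<union> {d1, d2, d3}" by (simp add: D'eq c d)
  define K where "K = classical_crossings D - {c1, c2, c3}"
  have dK: "d1 \<notin> crossings D - {c1, c2, c3}" "d2 \<notin> crossings D - {c1, c2, c3}" "d3 \<notin> crossings D - {c1, c2, c3}"
  proof -
    have e: "x2 \<in> ends d1" "x1 \<in> ends d2" "y1 \<in> ends d3" "x1 \<in> ends c1" "y1 \<in> ends c1" "x2 \<in> ends c2"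
      by (simp_all add: c d)
    show "d1 \<notin> crossings D - {c1, c2, c3}" "d2 \<notin> crossings D - {c1, c2, c3}" "d3 \<notin> crossings D - {c1, c2, c3}"
      using ends_unique[OF diagram_facts(4)[OF D] cD(2) _ e(6), of d1] e(1)
        ends_unique[OF diagram_facts(4)[OF D] cD(1) _ e(4), of d2] e(2)
        ends_unique[OF diagram_facts(4)[OF D] cD(1) _ e(5), of d3] e(3) by auto
  qed
  have f': "if ex then nxt D x1 = x2 else nxt D x2 = x1" "if ey then nxt D y1 = y2 else nxt D y2 = y1"
    "if ez then nxt D z1 = z2 else nxt D z2 = z1" using f by (simp_all add: follows_def)
  have kinds: "ckind c1 = k1" "ckind c2 = k2" "ckind c3 = k3" "ckind d1 = k1" "ckind d2 = k2" "ckind d3 = k3"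
    by (simp_all add: c d)
  from k show ?thesis
  proof
    assume k: "k1 = over_kind s1 \<and> k2 = over_kind s2 \<and> k3 = over_kind s3"
    have nv: "ckind c1 \<noteq> Virtual" "ckind c2 \<noteq> Virtual" "ckind c3 \<noteq> Virtual"
      "ckind d1 \<noteq> Virtual" "ckind d2 \<noteq> Virtual" "ckind d3 \<noteq> Virtual"
      by (simp_all add: kinds k over_kind_def)
    have K: "classical_crossings D = insert c1 (insert c2 (insert c3 K))"
      "classical_crossings D' = insert d1 (insert d2 (insert d3 K))"
      using cD nv unfolding K_def classical_crossings_def X' by auto
    have n: "c1 \<notin> K" "c2 \<notin> K" "c3 \<notin> K" by (simp_all add: K_def)
    have "bracket (points D) (nxt D) (insert c1 (insert c2 (insert c3 K))) =
      bracket (points D) (nxt D) (insert d1 (insert d2 (insert d3 K)))"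
      by (rule bracket_triangle[OF P _ _ _ _ _ _ s diagram_facts(5)[OF D, unfolded K(1)] n
            diagram_facts(5)[OF D', unfolded K(2) same] dist f'])
         (simp_all add: c d k)
    then show ?thesis by (simp add: diagram_bracket_def K same)
  next
    assume k: "k1 = Virtual \<and> k2 = Virtual"
    show ?thesis
    proof (cases "k3 = Virtual")
      case True
      then have "classical_crossings D' = classical_crossings D"
        using kinds k unfolding classical_crossings_def X' by auto
      then show ?thesis by (simp add: diagram_bracket_def same)
    next
      case False
      then have K: "classical_crossings D = insert c3 K" "classical_crossings D' = insert d3 K"
        using cD kinds k unfolding K_def classical_crossings_def X' by auto
      have n: "c3 \<notin> K" "d3 \<notin> K" using dK(3) by (auto simp: K_def classical_crossings_def)
      have dist': "distinct [y1, y2, z1, z2]" using dist by simp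
      have "bracket (points D) (nxt D) (insert c3 K) = bracket (points D) (nxt D) (insert d3 K)"
        by (rule bracket_slide[OF P c(3) d(3) _ n(1) _ n(2) dist' f'(2,3)])
           (use diagram_facts(5)[OF D] diagram_facts(5)[OF D'] in \<open>simp_all add: K same\<close>)
      then show ?thesis by (simp add: diagram_bracket_def K same)
    qed
  qed
qed

lemma virtual_link_diagram_is_diagram: "virtual_link_diagram D \<Longrightarrow> is_diagram D"
  by (auto simp: virtual_link_diagram_def is_surface_diagram_def)

lemma K_occurs_same_diagram:
  assumes "same_diagram D D'"
  shows "K_occurs (diagram_bracket D') \<mu> \<longleftrightarrow> K_occurs (diagram_bracket D) \<mu>"
  using assms unfolding same_diagram_def
  by (induct rule: equivclp_induct) (metis diagram_bracket_relabelling diagram_bracket_add_marker)+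

lemma K_occurs_virtual_equivalent:
  assumes "virtual_equivalent D D'"
  shows "K_occurs (diagram_bracket D') \<mu> \<longleftrightarrow> K_occurs (diagram_bracket D) \<mu>"
  using assms unfolding virtual_equivalent_def
  by (induct rule: equivclp_induct)
     (metis diagram_bracket_relabelling diagram_bracket_add_marker K_occurs_reidemeister1
       diagram_bracket_reidemeister2 diagram_bracket_reidemeister3 virtual_link_diagram_is_diagram)+

lemma diagram_bracket_forget_virtual: "diagram_bracket (forget_virtual D) = diagram_bracket D"
  by (simp add: diagram_bracket_def forget_virtual_def classical_crossings_def)

text \<open>
  Virtual crossings never entered the state sum, so forgetting them changes nothing.
\<close>

lemma K_occurs_representation:
  assumes L: "is_diagram L" and F: "represents F L"
  shows "K_occurs (arrow_polynomial (pattern F)) \<mu> \<longleftrightarrow> K_occurs (arrow_polynomial L) \<mu>"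
proof -
  obtain P where P: "virtual_equivalent P L" "same_diagram (forget_virtual P) (pattern F)"
    and "is_diagram (pattern F)"
    using F by (auto simp: represents_def is_surface_diagram_def)
  then show ?thesis
    using K_occurs_virtual_equivalent[OF P(1)] K_occurs_same_diagram[OF P(2)]
    by (simp add: K_occurs_arrow_polynomial L diagram_bracket_forget_virtual)
qed

section \<open>Euler characteristic under cutting and joining\<close>

text \<open>
  Two maps that agree outside \<open>A\<close> agree along a walk until \<open>A\<close> is
  reached for the first time.
\<close>

lemma first_hit:
  assumes "\<And>y. y \<notin> A \<Longrightarrow> f' y = f y" "(f ^^ n) x \<in> A"
  shows "\<exists>m. (f' ^^ m) x \<in> A \<and> (f' ^^ m) x = (f ^^ m) x"
proof -
  define m where "m = (LEAST m. (f ^^ m) x \<in> A)"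
  have m: "(f ^^ m) x \<in> A" unfolding m_def by (rule LeastI[of _ n]) (rule assms(2))
  have least: "(f ^^ k) x \<notin> A" if "k < m" for k using that not_less_Least unfolding m_def by blast
  have "(f' ^^ k) x = (f ^^ k) x" if "k \<le> m" for k
    using that by (induct k) (use least assms(1) in \<open>auto simp: Suc_le_eq\<close>)
  from this[OF order_refl] show ?thesis using m by (intro exI[of _ m]) simp
qed

lemma orbit_same:
  assumes "permutation f" "y \<in> orbit f x"
  shows "orbit f y = orbit f x"
  using orbit_cyclic_eq3[OF cyclic_on_orbit'[OF assms(1)] assms(2)] .

lemma label_orbit:
  assumes "f permutes X" "\<And>x. x \<in> X \<Longrightarrow> \<kappa> (f x) = \<kappa> x" "x \<in> X" "y \<in> orbit f x"
  shows "\<kappa> y = \<kappa> x"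
proof -
  have sub: "orbit f x \<subseteq> X" by (rule permutes_orbit_subset[OF assms(1,3)])
  from assms(4) show ?thesis
    by induct (use assms(2,3) sub in auto)
qed

text \<open>
  Composition with a transposition splits the cycle through \<open>a\<close> and
  \<open>b\<close> or merges their two cycles.
\<close>

lemma card_orbits_transpose:
  assumes X: "finite X" and f: "f permutes X" and ab: "a \<in> X" "b \<in> X"
  defines "f' \<equiv> f \<circ> transpose a b"
  shows "card (orbit f' ` X) \<le> card (orbit f ` X) + 1"
    and "b \<notin> orbit f a \<Longrightarrow> card (orbit f' ` X) + 1 \<le> card (orbit f ` X)"
proof -
  have f': "f' permutes X" unfolding f'_def
    by (rule permutes_compose[OF permutes_swap_id[OF ab] f])
  have p: "permutation f" "permutation f'" using f f' X by (auto simp: permutation_permutes)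
  have agree: "f' y = f y" if "y \<notin> {a, b}" for y using that by (simp add: f'_def transpose_def)
  have hit: "orbit f' x = orbit f' a \<or> orbit f' x = orbit f' b" if meets: "a \<in> orbit f x \<or> b \<in> orbit f x" for x
  proof -
    obtain n where "(f ^^ n) x \<in> {a, b}" using meets by (auto simp: orbit_altdef)
    from first_hit[OF agree this] obtain m where "(f' ^^ m) x \<in> {a, b}" by auto
    moreover have "(f' ^^ m) x \<in> orbit f' x" by (rule funpow_in_orbit[OF permutation_self_in_orbit[OF p(2)]])
    ultimately have "a \<in> orbit f' x \<or> b \<in> orbit f' x" by auto
    then show ?thesis using orbit_same[OF p(2)] by metis
  qed
  have miss: "orbit f' x = orbit f x" if "a \<notin> orbit f x" "b \<notin> orbit f x" for x
  proof (rule orbit_cong[OF permutation_self_in_orbit[OF p(1)]])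
    fix s assume "s \<in> orbit f x"
    then have "s \<notin> {a, b}" using that by auto
    then show "f' s = f s" by (rule agree)
  qed
  have sub: "orbit f' ` X \<subseteq> (orbit f ` X - {orbit f a, orbit f b}) \<union> {orbit f' a, orbit f' b}"
  proof
    fix C assume "C \<in> orbit f' ` X"
    then obtain x where x: "x \<in> X" "C = orbit f' x" by auto
    show "C \<in> (orbit f ` X - {orbit f a, orbit f b}) \<union> {orbit f' a, orbit f' b}"
    proof (cases "a \<in> orbit f x \<or> b \<in> orbit f x")
      case True then show ?thesis using hit x(2) by auto
    next
      case False
      moreover have "x \<in> orbit f x" "a \<in> orbit f a" "b \<in> orbit f b"
        using permutation_self_in_orbit[OF p(1)] by auto
      ultimately have "orbit f x \<noteq> orbit f a" "orbit f x \<noteq> orbit f b" by auto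
      then show ?thesis using miss False x by auto
    qed
  qed
  have fin: "finite (orbit f ` X)" using X by simp
  have mem: "orbit f a \<in> orbit f ` X" "orbit f b \<in> orbit f ` X" using ab by auto
  have "card (orbit f' ` X) \<le> card (orbit f ` X - {orbit f a, orbit f b}) + card {orbit f' a, orbit f' b}"
    using card_mono[OF _ sub] fin card_Un_le[of "orbit f ` X - {orbit f a, orbit f b}" "{orbit f' a, orbit f' b}"]
    by fastforce
  note bound = this
  have one: "card (orbit f ` X - {orbit f a, orbit f b}) + 1 \<le> card (orbit f ` X)"
  proof -
    have "orbit f ` X - {orbit f a, orbit f b} \<subset> orbit f ` X" using mem(1) by blast
    from psubset_card_mono[OF fin this] show ?thesis by simp
  qed
  have two: "card {orbit f' a, orbit f' b} \<le> 2" by (simp add: card_insert_if)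
  show "card (orbit f' ` X) \<le> card (orbit f ` X) + 1"
    using bound one two by simp
  assume b: "b \<notin> orbit f a"
  then have ne: "orbit f a \<noteq> orbit f b" using permutation_self_in_orbit[OF p(1), of b] by metis
  have "orbit f' a = orbit f' b"
  proof -
    have fa: "f' a = f b" by (simp add: f'_def)
    have a: "a \<notin> orbit f b" using b orbit_same[OF p(1), of a b] permutation_self_in_orbit[OF p(1)] by metis
    have "b \<in> orbit f (f b)" using self_in_orbit_step[OF permutation_self_in_orbit[OF p(1)], of b]
      permutation_self_in_orbit[OF p(1), of b] by simp
    then obtain n where "b = (f ^^ n) (f b)" unfolding orbit_altdef by blast
    then have "(f ^^ n) (f b) \<in> {a, b}" by simp
    from first_hit[OF agree this] obtain m where m: "(f' ^^ m) (f b) \<in> {a, b}" "(f' ^^ m) (f b) = (f ^^ m) (f b)"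
      by blast
    have "(f ^^ m) (f b) \<in> orbit f b" by (rule funpow_in_orbit[OF orbit.base])
    then have "(f' ^^ m) (f b) = b" using m a by auto
    moreover have "(f' ^^ m) (f' a) \<in> orbit f' a" by (rule funpow_in_orbit[OF orbit.base])
    ultimately have "b \<in> orbit f' a" using fa by simp
    then show ?thesis using orbit_same[OF p(2)] by metis
  qed
  moreover have "card (orbit f ` X - {orbit f a, orbit f b}) + 2 = card (orbit f ` X)"
  proof -
    have "card {orbit f a, orbit f b} = 2" using ne by simp
    moreover have "card {orbit f a, orbit f b} \<le> card (orbit f ` X)" by (rule card_mono[OF fin]) (use mem in auto)
    moreover have "card (orbit f ` X - {orbit f a, orbit f b}) = card (orbit f ` X) - card {orbit f a, orbit f b}"
      by (rule card_Diff_subset) (use mem in auto)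
    ultimately show ?thesis by linarith
  qed
  ultimately show "card (orbit f' ` X) + 1 \<le> card (orbit f ` X)" using bound by simp
qed

text \<open>
  Components are encoded as labels of points on their boundary circles. Attaching a band at
  \<open>a\<close> and \<open>b\<close> identifies two labels.
\<close>

definition join_labels :: "('a \<Rightarrow> 'l) \<Rightarrow> 'a \<Rightarrow> 'a \<Rightarrow> 'a \<Rightarrow> 'l" where
  "join_labels \<kappa> a b x = (if \<kappa> x = \<kappa> b then \<kappa> a else \<kappa> x)"

lemma join_labels_coarser: "\<kappa> x = \<kappa> y \<Longrightarrow> join_labels \<kappa> a b x = join_labels \<kappa> a b y"
  by (simp add: join_labels_def)

lemma join_labels_joined: "join_labels \<kappa> a b a = join_labels \<kappa> a b b"
  by (simp add: join_labels_def)

lemma card_join_labels: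
  assumes "finite X" "a \<in> X" "b \<in> X"
  shows "card (join_labels \<kappa> a b ` X) + (if \<kappa> a = \<kappa> b then 0 else 1) = card (\<kappa> ` X)"
proof (cases "\<kappa> a = \<kappa> b")
  case True
  then have "join_labels \<kappa> a b = \<kappa>" by (auto simp: join_labels_def)
  then show ?thesis using True by simp
next
  case False
  then have "join_labels \<kappa> a b ` X = \<kappa> ` X - {\<kappa> b}" using assms(2) by (force simp: join_labels_def)
  then show ?thesis using False assms card_Suc_Diff1[of "\<kappa> ` X" "\<kappa> b"] by simp
qed

text \<open>
  A band that connects two components loses one of them but also merges their boundary circles;
  a band within a component can at most split one circle into two.
\<close>

lemma band_euler:
  assumes X: "finite X" and f: "f permutes X" and ab: "a \<in> X" "b \<in> X"
    and \<kappa>: "\<And>x. x \<in> X \<Longrightarrow> \<kappa> (f x) = \<kappa> x"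
  shows "2 * int (card (join_labels \<kappa> a b ` X)) - int (card (orbit (f \<circ> transpose a b) ` X)) \<ge>
         2 * int (card (\<kappa> ` X)) - int (card (orbit f ` X)) - 1"
proof (cases "\<kappa> a = \<kappa> b")
  case True
  then show ?thesis using card_join_labels[OF X ab, of \<kappa>] card_orbits_transpose(1)[OF X f ab] by simp
next
  case False
  then have "b \<notin> orbit f a" using label_orbit[where \<kappa> = \<kappa>, OF f \<kappa> ab(1)] by metis
  from card_orbits_transpose(2)[OF X f ab this] show ?thesis
    using card_join_labels[OF X ab, of \<kappa>] False by simp
qed

lemma band_labels:
  assumes ab: "a \<in> X" "b \<in> X" and \<kappa>: "\<And>x. x \<in> X \<Longrightarrow> \<kappa> (f x) = \<kappa> x" and x: "x \<in> X"
  shows "join_labels \<kappa> a b ((f \<circ> transpose a b) x) = join_labels \<kappa> a b x"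
proof -
  have "transpose a b x \<in> X" using ab x by (simp add: transpose_def)
  then have "join_labels \<kappa> a b (f (transpose a b x)) = join_labels \<kappa> a b (transpose a b x)"
    by (intro join_labels_coarser \<kappa>)
  also have "\<dots> = join_labels \<kappa> a b x" using join_labels_joined[of \<kappa> a b] by (simp add: transpose_def)
  finally show ?thesis by simp
qed

text \<open>
  If a walk met its own reversal, the meeting point would be an end paired with itself.
\<close>

lemma loop_not_reversed:
  assumes st: "strands E \<alpha> \<mu>" and e: "e \<in> E"
  shows "\<alpha> e \<notin> orbit (\<alpha> \<circ> \<mu>) e"
proof -
  define T where "T = \<alpha> \<circ> \<mu>"
  have \<alpha>: "\<alpha> e \<in> E" "\<alpha> e \<noteq> e" "\<alpha> (\<alpha> e) = e" if "e \<in> E" for e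
    using st that by (auto simp: strands_def pairing_def)
  have \<mu>: "\<mu> e \<in> E" "\<mu> e \<noteq> e" "\<mu> (\<mu> e) = e" if "e \<in> E" for e
    using st that by (auto simp: strands_def pairing_def)
  have TE: "T e \<in> E" if "e \<in> E" for e using \<alpha> \<mu> that by (simp add: T_def)
  have powE: "(T ^^ k) e \<in> E" if "e \<in> E" for k e using that TE by (induct k) auto
  have inj: "x = y" if "T x = T y" "x \<in> E" "y \<in> E" for x y
    using walk_bij[OF st] that unfolding T_def by (meson bij_betw_def inj_onD)
  have swap: "T (\<alpha> (T e)) = \<alpha> e" if "e \<in> E" for e using \<alpha> \<mu> that by (simp add: T_def)
  have "e \<in> E \<Longrightarrow> (T ^^ k) e = \<alpha> e \<Longrightarrow> False" for k e
  proof (induct k arbitrary: e rule: less_induct)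
    case (less k)
    have s: "(T ^^ j) e = \<alpha> (T e)" if "k = Suc j" for j
    proof (rule inj)
      show "T ((T ^^ j) e) = T (\<alpha> (T e))" using less(3) swap[OF less(2)] that by simp
    qed (use powE[OF less(2)] \<alpha> TE[OF less(2)] in auto)
    consider "k = 0" | "k = 1" | j where "k = Suc (Suc j)"
      by (metis One_nat_def not0_implies_Suc)
    then show False
    proof cases
      case 1 then show False using less \<alpha>(2) by (metis funpow_0)
    next
      case 2
      then have "e = \<alpha> (T e)" using s[of 0] by simp
      then show False using \<alpha>(3)[OF \<mu>(1)[OF less(2)]] \<mu>(2)[OF less(2)] by (simp add: T_def)
    next
      case 3
      then have "(T ^^ j) (T e) = \<alpha> (T e)" using s[of "Suc j"] by (simp add: funpow_swap1)
      then show False using less(1)[of j "T e"] 3 TE[OF less(2)] by simp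
    qed
  qed
  then have never: "\<alpha> e \<noteq> (T ^^ n) e" for n using e by metis
  show ?thesis unfolding T_def[symmetric] orbit_altdef using never by blast
qed

section \<open>The pieces of a surface cut along the loops of a state\<close>

definition reverse_dart :: "nat \<times> bool \<Rightarrow> nat \<times> bool" where
  "reverse_dart x = (fst x, \<not> snd x)"

definition arriving_dart :: "diagram \<Rightarrow> nat \<Rightarrow> bool \<Rightarrow> nat \<times> bool" where
  "arriving_dart D q f = (if f then (inv (nxt D) q, True) else (q, False))"

text \<open>
  A smoothing opens a channel between two opposite corners of the crossing. Travellers arriving
  at one of its two points turn left, as along the boundary of a region; those who arrive at the
  other one, the point chosen here, turn right and have one of the two opened corners on their
  left. The two directions of arrival account for the two corners.
\<close>

definition split_point :: "crossing set \<Rightarrow> crossing \<Rightarrow> nat" where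
  "split_point S c = (if c \<in> S then pt2 c else pt1 c)"

text \<open>
  Passes through the channels of the crossings in \<open>B\<close>: turning right means to turn
  left as if arriving at the same point from the opposite direction.
\<close>

definition cross_over :: "diagram \<Rightarrow> crossing set \<Rightarrow> crossing set \<Rightarrow> nat \<times> bool \<Rightarrow> nat \<times> bool" where
  "cross_over D S B x =
     (if head D x \<in> split_point S ` B then arriving_dart D (head D x) (\<not> snd x) else x)"

lemma strandsD:
  assumes "strands E \<alpha> \<mu>" "e \<in> E"
  shows "\<alpha> e \<in> E" "\<alpha> e \<noteq> e" "\<alpha> (\<alpha> e) = e" "\<mu> e \<in> E" "\<mu> e \<noteq> e" "\<mu> (\<mu> e) = e"
  using assms by (simp_all add: strands_def pairing_def)

lemma reverse_dart_simps [simp]: "fst (reverse_dart x) = fst x" "snd (reverse_dart x) = (\<not> snd x)"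
    "reverse_dart (reverse_dart x) = x"
  by (simp_all add: reverse_dart_def)

lemma arriving_dart_simps [simp]:
  assumes "is_diagram D"
  shows "head D (arriving_dart D q f) = q" "snd (arriving_dart D q f) = f"
    "arriving_dart D (head D x) (snd x) = x"
  using permutes_inverses[OF diagram_facts(2)[OF assms]]
  by (auto simp: arriving_dart_def head_def prod_eq_iff)

lemma arriving_dart_mem:
  assumes "is_diagram D"
  shows "arriving_dart D q f \<in> points D \<times> UNIV \<longleftrightarrow> q \<in> points D"
  using permutes_in_image[OF permutes_inv[OF diagram_facts(2)[OF assms]]]
  by (auto simp: arriving_dart_def)

lemma head_mem:
  assumes "is_diagram D"
  shows "head D x \<in> points D \<longleftrightarrow> x \<in> points D \<times> UNIV"
  using permutes_in_image[OF diagram_facts(2)[OF assms]] by (cases x) (auto simp: head_def)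

lemma split_point_ends: "split_point S c \<in> ends c"
  by (simp add: split_point_def ends_def)

lemma split_point_mem:
  assumes "is_diagram D" "c \<in> crossings D"
  shows "split_point S c \<in> points D"
  using diagram_facts(4)[OF assms(1)] assms(2) split_point_ends[of S c]
  by (auto simp: proper_crossings_def)

lemma split_point_iff:
  assumes "is_diagram D" "c \<in> crossings D" "q \<in> ends c" "B \<subseteq> crossings D" "c \<in> B"
  shows "q \<in> split_point S ` B \<longleftrightarrow> q = split_point S c"
proof
  assume "q \<in> split_point S ` B"
  then obtain c' where "c' \<in> B" "q = split_point S c'" by auto
  moreover from this have "c' = c"
    using ends_unique[OF diagram_facts(4)[OF assms(1)] assms(2) _ assms(3), of c'] assms(4)
      split_point_ends[of S c'] by auto
  ultimately show "q = split_point S c" by simp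
qed (use assms(5) in simp)

lemma cross_over_cross_over:
  assumes "is_diagram D"
  shows "cross_over D S B (cross_over D S B x) = x"
  by (simp add: cross_over_def assms)

lemma cross_over_permutes:
  assumes D: "is_diagram D" and B: "B \<subseteq> crossings D"
  shows "cross_over D S B permutes (points D \<times> UNIV)"
proof (rule bij_imp_permutes)
  have mem: "cross_over D S B x \<in> points D \<times> UNIV" if "x \<in> points D \<times> UNIV" for x
    using that head_mem[OF D, of x] arriving_dart_mem[OF D] by (simp add: cross_over_def)
  then show "bij_betw (cross_over D S B) (points D \<times> UNIV) (points D \<times> UNIV)"
    by (intro bij_betwI[of _ _ _ "cross_over D S B"]) (simp_all add: cross_over_cross_over[OF D])
  show "cross_over D S B x = x" if "x \<notin> points D \<times> UNIV" for x
    using that head_mem[OF D, of x] split_point_mem[OF D, of _ S] B by (auto simp: cross_over_def)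
qed

lemma cross_over_insert:
  assumes D: "is_diagram D" and c: "insert c B \<subseteq> crossings D" "c \<notin> B"
  shows "cross_over D S (insert c B) = cross_over D S B \<circ>
    transpose (arriving_dart D (split_point S c) True) (arriving_dart D (split_point S c) False)"
proof
  fix x
  let ?q = "split_point S c"
  have q: "?q \<notin> split_point S ` B"
  proof
    assume "?q \<in> split_point S ` B"
    then obtain c' where c': "c' \<in> B" "?q = split_point S c'" by auto
    have "c' = c" using ends_unique[OF diagram_facts(4)[OF D], of c c' ?q] c c'
      split_point_ends[of S c] split_point_ends[of S c'] by auto
    then show False using c' c(2) by simp
  qed
  show "cross_over D S (insert c B) x = (cross_over D S B \<circ>
    transpose (arriving_dart D ?q True) (arriving_dart D ?q False)) x"
  proof (cases "head D x = ?q")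
    case True
    then have "x = arriving_dart D ?q (snd x)" using arriving_dart_simps(3)[OF D, of x] by simp
    then have "transpose (arriving_dart D ?q True) (arriving_dart D ?q False) x = arriving_dart D ?q (\<not> snd x)"
      by (cases "snd x") simp_all
    then show ?thesis using True q by (simp add: cross_over_def D)
  next
    case False
    then have "x \<noteq> arriving_dart D ?q True" "x \<noteq> arriving_dart D ?q False"
      using arriving_dart_simps(1)[OF D] by metis+
    then show ?thesis using False by (simp add: cross_over_def transpose_def)
  qed
qed

text \<open>
  Walking along the left side of a loop is walking along the boundary of a region, except that
  one passes through the channel wherever the loop turns right.
\<close>

lemma state_step_cross_over:
  assumes D: "is_diagram D" and cl: "\<forall>c\<in>crossings D. ckind c \<noteq> Virtual"
  shows "state_step D S x = face_step D (cross_over D S (crossings D) x)"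
proof (cases "\<exists>c\<in>crossings D. head D x \<in> ends c")
  case True
  then obtain c where c: "c \<in> crossings D" "head D x \<in> ends c" by auto
  note at = crossing_at_Some[OF D c]
  note sp = split_point_iff[OF D c order_refl c(1), of S]
  have neq: "pt1 c \<noteq> pt2 c" using diagram_facts(4)[OF D] c(1) by (auto simp: proper_crossings_def)
  have h: "head D x = pt1 c \<or> head D x = pt2 c" using c(2) by (auto simp: ends_def)
  have v: "ckind c \<noteq> Virtual" using cl c(1) by simp
  show ?thesis
  proof (cases "head D x = split_point S c")
    case True
    then have "cross_over D S (crossings D) x = arriving_dart D (head D x) (\<not> snd x)"
      using sp by (simp add: cross_over_def)
    moreover have "(\<not> snd x \<longleftrightarrow> head D x = pt1 c) = (snd x \<longleftrightarrow> c \<in> S)"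
      using True neq by (auto simp: split_point_def)
    ultimately show ?thesis by (simp add: state_step_def face_step_def D at v)
  next
    case False
    then have "cross_over D S (crossings D) x = x"
      using sp by (simp add: cross_over_def)
    moreover have "(snd x \<longleftrightarrow> head D x = pt1 c) = (snd x \<longleftrightarrow> c \<in> S)"
      using False neq h by (auto simp: split_point_def split: if_splits)
    ultimately show ?thesis by (simp add: state_step_def face_step_def at v)
  qed
next
  case False
  then have "crossing_at D (head D x) = None" by (simp add: crossing_at_def)
  moreover have "head D x \<notin> split_point S ` crossings D" using False split_point_ends[of S] by (auto simp: image_iff)
  ultimately show ?thesis by (simp add: state_step_def face_step_def cross_over_def)
qed

lemma face_step_permutes:
  assumes D: "is_diagram D" and cl: "\<forall>c\<in>crossings D. ckind c \<noteq> Virtual"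
  shows "face_step D permutes (points D \<times> UNIV)"
proof -
  have "face_step D = state_step D {} \<circ> cross_over D {} (crossings D)"
    by (simp add: fun_eq_iff state_step_cross_over[OF D cl] cross_over_cross_over[OF D])
  then show ?thesis
    using permutes_compose[OF cross_over_permutes[OF D order_refl] state_step_permutes[OF D]] by simp
qed

text \<open>
  The complement of the loops arises from the regions by attaching a band along the channel of
  each crossing. For \<open>B = {}\<close> the circles are those of the regions and for all
  crossings they are the sides of the loops; the inequality bounds the Euler characteristic on
  the way.
\<close>

lemma cut_labels:
  fixes S :: "crossing set" and \<kappa>\<^sub>0 :: "nat \<times> bool \<Rightarrow> 'l"
  assumes D: "is_diagram D" and cl: "\<forall>c\<in>crossings D. ckind c \<noteq> Virtual"
    and \<kappa>\<^sub>0: "\<And>x. x \<in> points D \<times> UNIV \<Longrightarrow> \<kappa>\<^sub>0 (face_step D x) = \<kappa>\<^sub>0 x"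
    and B: "finite B" "B \<subseteq> crossings D"
  defines "f \<equiv> \<lambda>B. face_step D \<circ> cross_over D S B"
  shows "\<exists>\<kappa> :: nat \<times> bool \<Rightarrow> 'l. (\<forall>x\<in>points D \<times> UNIV. \<kappa> (f B x) = \<kappa> x) \<and>
    (\<forall>c\<in>B. \<kappa> (arriving_dart D (split_point S c) True) = \<kappa> (arriving_dart D (split_point S c) False)) \<and>
    (\<forall>x y. \<kappa>\<^sub>0 x = \<kappa>\<^sub>0 y \<longrightarrow> \<kappa> x = \<kappa> y) \<and>
    2 * int (card (\<kappa>\<^sub>0 ` (points D \<times> UNIV))) - int (card (orbit (face_step D) ` (points D \<times> UNIV))) - int (card B)
      \<le> 2 * int (card (\<kappa> ` (points D \<times> UNIV))) - int (card (orbit (f B) ` (points D \<times> UNIV)))"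
  using B
proof (induct B)
  case empty
  have "f {} = face_step D" by (simp add: f_def fun_eq_iff cross_over_def)
  then show ?case using \<kappa>\<^sub>0 by (intro exI[of _ \<kappa>\<^sub>0]) simp
next
  case (insert c B)
  let ?X = "points D \<times> (UNIV :: bool set)"
  let ?a = "arriving_dart D (split_point S c) True" and ?b = "arriving_dart D (split_point S c) False"
  have sub: "B \<subseteq> crossings D" using insert(4) by simp
  from insert(3)[OF this] obtain \<kappa> :: "nat \<times> bool \<Rightarrow> 'l" where \<kappa>: "\<forall>x\<in>?X. \<kappa> (f B x) = \<kappa> x"
    "\<forall>c\<in>B. \<kappa> (arriving_dart D (split_point S c) True) = \<kappa> (arriving_dart D (split_point S c) False)"
    "\<forall>x y. \<kappa>\<^sub>0 x = \<kappa>\<^sub>0 y \<longrightarrow> \<kappa> x = \<kappa> y"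
    "2 * int (card (\<kappa>\<^sub>0 ` ?X)) - int (card (orbit (face_step D) ` ?X)) - int (card B)
      \<le> 2 * int (card (\<kappa> ` ?X)) - int (card (orbit (f B) ` ?X))"
    by (elim exE conjE) (rule that; assumption)
  have fin: "finite ?X" using diagram_facts(1)[OF D] by simp
  have perm: "f B permutes ?X" unfolding f_def
    by (rule permutes_compose[OF cross_over_permutes[OF D] face_step_permutes[OF D cl]]) (rule sub)
  have ab: "?a \<in> ?X" "?b \<in> ?X"
    using arriving_dart_mem[OF D] split_point_mem[OF D, of c S] insert by auto
  have f: "f (insert c B) = f B \<circ> transpose ?a ?b"
    unfolding f_def cross_over_insert[OF D insert(4) insert(2)] by (simp add: comp_assoc)
  let ?\<kappa>' = "join_labels \<kappa> ?a ?b"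
  have inv: "\<And>x. x \<in> ?X \<Longrightarrow> \<kappa> (f B x) = \<kappa> x" using \<kappa>(1) by blast
  have 1: "\<forall>x\<in>?X. ?\<kappa>' (f (insert c B) x) = ?\<kappa>' x"
    unfolding f using band_labels[where \<kappa> = \<kappa> and f = "f B", OF ab inv] by blast
  have 2: "\<forall>c'\<in>insert c B. ?\<kappa>' (arriving_dart D (split_point S c') True) = ?\<kappa>' (arriving_dart D (split_point S c') False)"
  proof
    fix c' assume "c' \<in> insert c B"
    then show "?\<kappa>' (arriving_dart D (split_point S c') True) = ?\<kappa>' (arriving_dart D (split_point S c') False)"
    proof
      assume "c' = c" then show ?thesis by (simp only: join_labels_joined)
    next
      assume "c' \<in> B" then show ?thesis using \<kappa>(2) by (intro join_labels_coarser) blast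
    qed
  qed
  have 3: "\<forall>x y. \<kappa>\<^sub>0 x = \<kappa>\<^sub>0 y \<longrightarrow> ?\<kappa>' x = ?\<kappa>' y" using \<kappa>(3) by (intro allI impI join_labels_coarser) blast
  have 4: "2 * int (card (?\<kappa>' ` ?X)) - int (card (orbit (f (insert c B)) ` ?X)) \<ge>
      2 * int (card (\<kappa> ` ?X)) - int (card (orbit (f B) ` ?X)) - 1"
    unfolding f by (rule band_euler[where \<kappa> = \<kappa>, OF fin perm ab inv])
  have "card (insert c B) = card B + 1" using insert by simp
  then have 5: "2 * int (card (\<kappa>\<^sub>0 ` ?X)) - int (card (orbit (face_step D) ` ?X)) - int (card (insert c B))
      \<le> 2 * int (card (?\<kappa>' ` ?X)) - int (card (orbit (f (insert c B)) ` ?X))" using 4 \<kappa>(4) by linarith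
  show ?case by (rule exI[of _ ?\<kappa>']) (intro conjI 1 2 3 5)
qed

lemma dart_strands:
  assumes D: "is_diagram D"
  shows "strands (points D \<times> UNIV) reverse_dart (reverse_dart \<circ> state_step D S)"
proof -
  let ?X = "points D \<times> (UNIV :: bool set)" and ?\<mu> = "smoothing (classical_crossings D) S"
  note st = strands_of_diagram[OF D, of S]
  have a: "arrival D x \<in> ?X" if "x \<in> ?X" for x using bij_betwE[OF arrival_bij[OF D]] that by blast
  have \<mu>: "?\<mu> e \<in> ?X \<and> ?\<mu> e \<noteq> e \<and> ?\<mu> (?\<mu> e) = e" if "e \<in> ?X" for e
    using strandsD[OF st that] by simp
  have \<alpha>: "arc_end (nxt D) (arc_end (nxt D) e) = e" if "e \<in> ?X" for e
    using strandsD[OF st that] by simp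
  have m: "arrival D (reverse_dart (state_step D S x)) = ?\<mu> (arrival D x)" if "x \<in> ?X" for x
  proof -
    have "arrival D (reverse_dart (state_step D S x)) = arc_end (nxt D) (arrival D (state_step D S x))"
      by (simp add: arc_end_arrival[OF D] reverse_dart_def)
    then show ?thesis using \<alpha> \<mu> a that by (simp add: arrival_state_step[OF D])
  qed
  have X: "reverse_dart (state_step D S x) \<in> ?X" if "x \<in> ?X" for x
    using permutes_in_image[OF state_step_permutes[OF D], of S x] that by (auto simp: reverse_dart_def mem_Times_iff)
  have inj: "x = y" if "arrival D x = arrival D y" "x \<in> ?X" "y \<in> ?X" for x y
    using arrival_bij[OF D] that by (meson bij_betw_def inj_onD)
  have "pairing ?X (reverse_dart \<circ> state_step D S)"
    unfolding pairing_def
  proof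
    fix x assume x: "x \<in> ?X"
    have "reverse_dart (state_step D S x) \<noteq> x" using m[OF x] \<mu>[OF a[OF x]] by metis
    moreover have "reverse_dart (state_step D S (reverse_dart (state_step D S x))) = x"
      by (rule inj) (use m[OF X[OF x]] m[OF x] \<mu>[OF a[OF x]] X x in simp_all)
    ultimately show "(reverse_dart \<circ> state_step D S) x \<in> ?X \<and> (reverse_dart \<circ> state_step D S) x \<noteq> x \<and>
        (reverse_dart \<circ> state_step D S) ((reverse_dart \<circ> state_step D S) x) = x" using X[OF x] by simp
  qed
  moreover have "pairing ?X reverse_dart" by (auto simp: pairing_def reverse_dart_def)
  ultimately show ?thesis using diagram_facts(1)[OF D] by (simp add: strands_def)
qed

lemma reverse_reverse_state_step: "reverse_dart \<circ> (reverse_dart \<circ> state_step D S) = state_step D S"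
  by (simp add: fun_eq_iff)

lemma orbit_reverse_dart:
  assumes D: "is_diagram D" and x: "x \<in> points D \<times> UNIV"
  shows "orbit (state_step D S) (reverse_dart x) = reverse_dart ` orbit (state_step D S) x"
    and "reverse_dart x \<notin> orbit (state_step D S) x"
  using walk_reverse[OF dart_strands[OF D] x] loop_not_reversed[OF dart_strands[OF D] x]
  unfolding reverse_reverse_state_step by blast+

text \<open>
  A traveller going back through a smoothing sees the opposite change of the potential.
\<close>

lemma cusp_sum_reverse:
  assumes D: "is_diagram D" and x: "x \<in> points D \<times> UNIV"
  shows "cusp_sum D S (reverse_dart (state_step D S x)) = - cusp_sum D S x"
proof -
  let ?X = "points D \<times> (UNIV :: bool set)" and ?\<mu> = "smoothing (classical_crossings D) S"
  note st = strands_of_diagram[OF D, of S]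
  have a: "arrival D x \<in> ?X" using bij_betwE[OF arrival_bij[OF D]] x by blast
  note \<mu> = strandsD(4)[OF st a] strandsD(6)[OF st a]
  have "arrival D (reverse_dart (state_step D S x)) = arc_end (nxt D) (arrival D (state_step D S x))"
    by (simp add: arc_end_arrival[OF D] reverse_dart_def)
  also have "\<dots> = ?\<mu> (arrival D x)"
    by (simp add: arrival_state_step[OF D] strandsD(3)[OF st \<mu>(1)])
  finally show ?thesis
    using potential_smoothing[OF D, of S x] potential_smoothing[OF D, of S "reverse_dart (state_step D S x)"] \<mu>(2)
    by simp
qed

lemma fst_orbit_loop:
  assumes D: "is_diagram D" and C: "C \<in> loops D S" and x: "fst x \<in> C"
  shows "fst ` orbit (state_step D S) x = C" and "x \<in> points D \<times> UNIV"
proof -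
  obtain p where p: "p \<in> points D" "C = fst ` orbit (state_step D S) (p, True)"
    using C by (auto simp: loops_def)
  show X: "x \<in> points D \<times> UNIV" using loops_subset(1)[OF D C] x by (cases x) auto
  obtain y where y: "y \<in> orbit (state_step D S) (p, True)" "fst x = fst y" using p x by auto
  have o: "orbit (state_step D S) y = orbit (state_step D S) (p, True)"
    by (rule orbit_same[OF state_step_permutation[OF D] y(1)])
  have "x = y \<or> y = reverse_dart x" using y(2) by (cases x; cases y) (auto simp: reverse_dart_def)
  then show "fst ` orbit (state_step D S) x = C"
  proof
    assume "y = reverse_dart x"
    then have "orbit (state_step D S) (p, True) = reverse_dart ` orbit (state_step D S) x"
      using orbit_reverse_dart(1)[OF D X] o by simp
    then show ?thesis using p(2) by (simp add: image_image)
  qed (use o p in simp)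
qed

lemma orbit_is_loop:
  assumes D: "is_diagram D" and x: "x \<in> points D \<times> UNIV"
  shows "fst ` orbit (state_step D S) x \<in> loops D S"
proof -
  let ?C = "fst ` orbit (state_step D S) (fst x, True)"
  have C: "?C \<in> loops D S" using x by (auto simp: loops_def)
  have "fst x \<in> ?C"
    by (rule image_eqI[OF _ permutation_self_in_orbit[OF state_step_permutation[OF D]]]) simp
  then have "fst ` orbit (state_step D S) x = ?C" by (rule fst_orbit_loop(1)[OF D C])
  then show ?thesis using C by (simp only:)
qed

lemma loop_directions:
  assumes D: "is_diagram D" and C: "C \<in> loops D S" and x: "fst x \<in> C" and y: "fst y \<in> C"
  shows "orbit (state_step D S) y = orbit (state_step D S) x \<or>
    orbit (state_step D S) y = orbit (state_step D S) (reverse_dart x)"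
proof -
  have "fst y \<in> fst ` orbit (state_step D S) x" using fst_orbit_loop(1)[OF D C x] y by simp
  then obtain z where z: "z \<in> orbit (state_step D S) x" "fst z = fst y" by auto
  have "y = z \<or> y = reverse_dart z" using z(2) by (cases z; cases y) (auto simp: reverse_dart_def)
  then show ?thesis
  proof
    assume "y = z" then show ?thesis using orbit_same[OF state_step_permutation[OF D] z(1)] by simp
  next
    assume "y = reverse_dart z"
    then have "y \<in> orbit (state_step D S) (reverse_dart x)"
      using orbit_reverse_dart(1)[OF D fst_orbit_loop(2)[OF D C x]] z(1) by simp
    then show ?thesis using orbit_same[OF state_step_permutation[OF D]] by blast
  qed
qed

text \<open>
  A loop has two sides, one for each direction of travel; they are different as no loop returns
  to an arc backwards.
\<close>

lemma two_orbits_per_loop: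
  assumes D: "is_diagram D"
  shows "2 * card (loops D S) \<le> card (orbit (state_step D S) ` (points D \<times> UNIV))"
proof -
  let ?T = "state_step D S" and ?X = "points D \<times> (UNIV :: bool set)"
  have "\<forall>C\<in>loops D S. \<exists>p. p \<in> C" using loops_subset(2)[OF D] by blast
  then obtain p where p: "\<And>C. C \<in> loops D S \<Longrightarrow> p C \<in> C" by metis
  let ?g = "\<lambda>(C, b). orbit ?T (p C, b)"
  have "inj_on ?g (loops D S \<times> UNIV)"
  proof (rule inj_onI, clarify)
    fix C b C' b' assume C: "C \<in> loops D S" "C' \<in> loops D S" and eq: "orbit ?T (p C, b) = orbit ?T (p C', b')"
    have "C = C'"
      using fst_orbit_loop(1)[OF D C(1), of "(p C, b)"] fst_orbit_loop(1)[OF D C(2), of "(p C', b')"] p C eq by simp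
    moreover have "b = b'"
    proof (rule ccontr)
      assume "b \<noteq> b'"
      then have "(p C, b') = reverse_dart (p C, b)" by (auto simp: reverse_dart_def)
      moreover have "(p C, b') \<in> orbit ?T (p C, b)"
        using eq \<open>C = C'\<close> permutation_self_in_orbit[OF state_step_permutation[OF D]] by simp
      ultimately show False
        using orbit_reverse_dart(2)[OF D fst_orbit_loop(2)[OF D C(1), of "(p C, b)"]] p[OF C(1)] by simp
    qed
    ultimately show "C = C' \<and> b = b'" by simp
  qed
  moreover have "?g ` (loops D S \<times> UNIV) \<subseteq> orbit ?T ` ?X"
    using p loops_subset(1)[OF D] by fastforce
  moreover have "finite (orbit ?T ` ?X)" using diagram_facts(1)[OF D] by simp
  ultimately have "card (loops D S \<times> (UNIV :: bool set)) \<le> card (orbit ?T ` ?X)"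
    by (metis card_image card_mono)
  then show ?thesis by (simp add: card_cartesian_product)
qed

text \<open>
  Undoes the cut along the loops in \<open>N\<close>: gluing the two sides of a loop joins the
  components at these sides, so that at most one component is lost for each loop.
\<close>

lemma join_loop_sides:
  fixes \<kappa> :: "nat \<times> bool \<Rightarrow> 'l"
  assumes D: "is_diagram D" and N: "finite N" "N \<subseteq> loops D S"
    and \<kappa>: "\<And>x. x \<in> points D \<times> UNIV \<Longrightarrow> \<kappa> (state_step D S x) = \<kappa> x"
  shows "\<exists>\<kappa>' :: nat \<times> bool \<Rightarrow> 'l. (\<forall>x y. \<kappa> x = \<kappa> y \<longrightarrow> \<kappa>' x = \<kappa>' y) \<and>
     (\<forall>C\<in>N. \<forall>x. fst x \<in> C \<longrightarrow> \<kappa>' (reverse_dart x) = \<kappa>' x) \<and>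
     card (\<kappa> ` (points D \<times> UNIV)) \<le> card (\<kappa>' ` (points D \<times> UNIV)) + card N"
  using N
proof (induct N)
  case empty then show ?case by (intro exI[of _ \<kappa>]) simp
next
  case (insert C N)
  let ?X = "points D \<times> (UNIV :: bool set)" and ?T = "state_step D S"
  have sub: "N \<subseteq> loops D S" using insert(4) by simp
  from insert(3)[OF this] obtain \<kappa>1 :: "nat \<times> bool \<Rightarrow> 'l" where k1: "\<forall>x y. \<kappa> x = \<kappa> y \<longrightarrow> \<kappa>1 x = \<kappa>1 y"
     "\<forall>C\<in>N. \<forall>x. fst x \<in> C \<longrightarrow> \<kappa>1 (reverse_dart x) = \<kappa>1 x"
     "card (\<kappa> ` ?X) \<le> card (\<kappa>1 ` ?X) + card N"
    by (elim exE conjE) (rule that; assumption)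
  have C: "C \<in> loops D S" using insert by simp
  obtain p where p: "p \<in> C" using loops_subset(2)[OF D C] by auto
  let ?a = "(p, True)" and ?b = "(p, False)"
  have X: "?a \<in> ?X" "?b \<in> ?X" using p loops_subset(1)[OF D C] by auto
  have b: "?b = reverse_dart ?a" by (simp add: reverse_dart_def)
  let ?k = "join_labels \<kappa>1 ?a ?b"
  have lab: "\<kappa>1 x = \<kappa>1 ?a \<or> \<kappa>1 x = \<kappa>1 ?b" if "fst x \<in> C" for x
  proof -
    have "x \<in> orbit ?T x" by (rule permutation_self_in_orbit[OF state_step_permutation[OF D]])
    then have "x \<in> orbit ?T ?a \<or> x \<in> orbit ?T ?b"
      using loop_directions[OF D C, of ?a x] p that b by auto
    then have "\<kappa> x = \<kappa> ?a \<or> \<kappa> x = \<kappa> ?b"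
      using label_orbit[where \<kappa> = \<kappa>, OF state_step_permutes[OF D] \<kappa> X(1)]
        label_orbit[where \<kappa> = \<kappa>, OF state_step_permutes[OF D] \<kappa> X(2)] by blast
    then show ?thesis using k1(1) by blast
  qed
  have "?k (reverse_dart x) = ?k x" if "fst x \<in> C" for x
    using lab[OF that] lab[of "reverse_dart x"] that by (auto simp: join_labels_def)
  moreover have "?k (reverse_dart x) = ?k x" if "C' \<in> N" "fst x \<in> C'" for x C'
    using k1(2) that by (intro join_labels_coarser) blast
  ultimately have "\<forall>C\<in>insert C N. \<forall>x. fst x \<in> C \<longrightarrow> ?k (reverse_dart x) = ?k x" by blast
  moreover have "\<forall>x y. \<kappa> x = \<kappa> y \<longrightarrow> ?k x = ?k y" using k1(1) by (intro allI impI join_labels_coarser) blast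
  moreover have "card (\<kappa>1 ` ?X) \<le> card (?k ` ?X) + 1"
    using card_join_labels[of ?X ?a ?b \<kappa>1] X diagram_facts(1)[OF D] by (auto split: if_splits)
  then have "card (\<kappa> ` ?X) \<le> card (?k ` ?X) + card (insert C N)" using k1(3) insert by simp
  ultimately show ?case by blast
qed

text \<open>The two sides of a loop in \<open>Y\<close> contribute opposite sums.\<close>

lemma cusp_sum_invariant_zero:
  assumes D: "is_diagram D" and Y: "Y \<subseteq> points D \<times> UNIV"
    and T: "\<And>x. x \<in> Y \<Longrightarrow> state_step D S x \<in> Y" and r: "\<And>x. x \<in> Y \<Longrightarrow> reverse_dart x \<in> Y"
  shows "(\<Sum>x\<in>Y. cusp_sum D S x) = 0"
proof -
  let ?h = "reverse_dart \<circ> state_step D S"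
  have h: "?h (?h x) = x" if "x \<in> Y" for x
    using strandsD(6)[OF dart_strands[OF D], of x S] that Y by blast
  have "bij_betw ?h Y Y"
    by (rule bij_betwI[of _ _ _ ?h]) (use T r h in auto)
  from sum.reindex_bij_betw[OF this, of "cusp_sum D S"]
  have "(\<Sum>x\<in>Y. cusp_sum D S x) = (\<Sum>x\<in>Y. cusp_sum D S (?h x))" by simp
  also have "\<dots> = (\<Sum>x\<in>Y. - cusp_sum D S x)"
  proof (intro sum.cong refl)
    fix x assume "x \<in> Y"
    then have "x \<in> points D \<times> UNIV" using Y by blast
    then show "cusp_sum D S (?h x) = - cusp_sum D S x" by (simp add: cusp_sum_reverse[OF D])
  qed
  finally show ?thesis by (simp add: sum_negf)
qed

text \<open>
  The boundary of a piece is null-homologous, which shows up here as a local cancellation. The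
  sum of the cusps is, up to a term that telescopes along the boundary circles, concentrated at
  the arrivals at split points of disoriented smoothings, with the sign of the direction of
  arrival. The two arrivals at such a point have opposite signs and belong to the same piece,
  since a channel connects them.
\<close>

lemma label_cusp_sum_zero:
  fixes \<kappa> :: "nat \<times> bool \<Rightarrow> 'l"
  assumes D: "is_diagram D" and cl: "\<forall>c\<in>crossings D. ckind c \<noteq> Virtual"
    and \<kappa>: "\<And>x. x \<in> points D \<times> UNIV \<Longrightarrow> \<kappa> (state_step D S x) = \<kappa> x"
    and bands: "\<And>c. c \<in> crossings D \<Longrightarrow>
      \<kappa> (arriving_dart D (split_point S c) True) = \<kappa> (arriving_dart D (split_point S c) False)"
  shows "(\<Sum>x\<in>{x \<in> points D \<times> UNIV. \<kappa> x = v}. cusp_sum D S x) = 0"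
proof -
  let ?X = "points D \<times> (UNIV :: bool set)" and ?T = "state_step D S"
  define Y where "Y = {x \<in> ?X. \<kappa> x = v}"
  (* The direction of travel, and its restriction to the arrivals at split points of
     disoriented smoothings. *)
  define \<epsilon> :: "nat \<times> bool \<Rightarrow> int" where "\<epsilon> x = (if snd x then 1 else - 1)" for x
  define \<phi> where "\<phi> x = (if \<exists>c\<in>crossings D. c \<notin> S \<and> head D x = pt1 c then \<epsilon> x else 0)" for x
  have fin: "finite Y" using diagram_facts(1)[OF D] by (simp add: Y_def)
  have cc: "classical_crossings D = crossings D" using cl by (auto simp: classical_crossings_def)
  have point: "2 * cusp_sum D S x = 4 * \<phi> x - (\<epsilon> x - \<epsilon> (?T x))" for x
  proof (cases "\<exists>c\<in>classical_crossings D. head D x \<in> ends c")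
    case True
    then obtain c where c: "c \<in> classical_crossings D" "head D x \<in> ends c" by auto
    have cX: "c \<in> crossings D" using c(1) cc by simp
    have u: "c' = c" if "c' \<in> crossings D" "head D x \<in> ends c'" for c'
      by (rule ends_unique[OF diagram_facts(4)[OF D] cX that(1) c(2) that(2)])
    have neq: "pt1 c \<noteq> pt2 c" using diagram_facts(4)[OF D] cX by (auto simp: proper_crossings_def)
    have \<phi>: "\<phi> x = (if c \<notin> S \<and> head D x = pt1 c then \<epsilon> x else 0)"
    proof -
      have "(\<exists>c\<in>crossings D. c \<notin> S \<and> head D x = pt1 c) \<longleftrightarrow> c \<notin> S \<and> head D x = pt1 c"
      proof
        assume "\<exists>c\<in>crossings D. c \<notin> S \<and> head D x = pt1 c"
        then obtain c' where c': "c' \<in> crossings D" "c' \<notin> S" "head D x = pt1 c'" by auto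
        then have "c' = c" by (intro u) (simp_all add: ends_def)
        then show "c \<notin> S \<and> head D x = pt1 c" using c' by simp
      qed (use cX in blast)
      then show ?thesis by (simp add: \<phi>_def)
    qed
    show ?thesis unfolding \<phi>
      by (simp add: cusp_sum_def \<epsilon>_def state_step_cases[OF D c])
  next
    case False
    then have "\<phi> x = 0" unfolding \<phi>_def cc by (auto simp: ends_def)
    then show ?thesis by (simp add: cusp_sum_def \<epsilon>_def state_step_marker[OF D False])
  qed
  have TY: "bij_betw ?T Y Y"
  proof -
    have "inj_on ?T Y" using permutes_inj[OF state_step_permutes[OF D]] by (auto intro: inj_on_subset)
    moreover have "?T x \<in> Y" if "x \<in> Y" for x
    proof -
      have x: "x \<in> ?X" "\<kappa> x = v" using that unfolding Y_def by blast+
      then have "?T x \<in> ?X" using permutes_in_image[OF state_step_permutes[OF D]] by blast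
      then show ?thesis using \<kappa>[OF x(1)] x(2) by (simp only: Y_def mem_Collect_eq)
    qed
    then have "?T ` Y \<subseteq> Y" by blast
    ultimately show ?thesis using endo_inj_surj[OF fin, of ?T] by (simp add: bij_betw_def)
  qed
  let ?g = "cross_over D S (crossings D)"
  have gY: "?g x \<in> Y" if "x \<in> Y" for x
  proof -
    have "?g x \<in> ?X" using permutes_in_image[OF cross_over_permutes[OF D order_refl], of S x] that by (simp add: Y_def)
    moreover have "\<kappa> (?g x) = \<kappa> x"
    proof (cases "head D x \<in> split_point S ` crossings D")
      case True
      then obtain c where c: "c \<in> crossings D" "head D x = split_point S c" by auto
      have "?g x = arriving_dart D (split_point S c) (\<not> snd x)" using True c by (simp add: cross_over_def)
      moreover have "x = arriving_dart D (split_point S c) (snd x)"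
        using arriving_dart_simps(3)[OF D, of x] c by simp
      ultimately show ?thesis using bands[OF c(1)] by (metis (full_types))
    qed (simp add: cross_over_def)
    ultimately show ?thesis using that by (simp add: Y_def)
  qed
  have "bij_betw ?g Y Y"
    by (rule bij_betwI[of _ _ _ ?g]) (use gY in \<open>auto simp: cross_over_cross_over[OF D]\<close>)
  from sum.reindex_bij_betw[OF this, of \<phi>] have "(\<Sum>x\<in>Y. \<phi> x) = (\<Sum>x\<in>Y. \<phi> (?g x))" by simp
  also have "\<dots> = (\<Sum>x\<in>Y. - \<phi> x)"
  proof (intro sum.cong refl)
    fix x
    show "\<phi> (?g x) = - \<phi> x"
    proof (cases "head D x \<in> split_point S ` crossings D")
      case True
      then show ?thesis by (simp add: cross_over_def \<phi>_def \<epsilon>_def D)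
    next
      case False
      then have "\<not> (\<exists>c\<in>crossings D. c \<notin> S \<and> head D x = pt1 c)" by (force simp: split_point_def)
      then have "\<phi> x = 0" unfolding \<phi>_def by (simp only: if_False)
      then show ?thesis using False by (simp add: cross_over_def)
    qed
  qed
  finally have "(\<Sum>x\<in>Y. \<phi> x) = 0" by (simp add: sum_negf)
  moreover have "(\<Sum>x\<in>Y. \<epsilon> x - \<epsilon> (?T x)) = 0"
    using sum.reindex_bij_betw[OF TY, of \<epsilon>] by (simp add: sum_subtractf)
  moreover have "2 * (\<Sum>x\<in>Y. cusp_sum D S x) = 4 * (\<Sum>x\<in>Y. \<phi> x) - (\<Sum>x\<in>Y. \<epsilon> x - \<epsilon> (?T x))"
    by (simp only: sum_distrib_left point sum_subtractf)
  ultimately show ?thesis by (simp add: Y_def)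
qed

text \<open>
  Neighbouring points are connected by boundary circles, by the two sides of an arc and by
  regions; it suffices to pass from arc to arc at a crossing, where the four corners belong to
  boundary circles.
\<close>

lemma surface_connected_const:
  assumes F: "is_surface_diagram F" and D: "D = pattern F"
    and cl: "\<forall>c\<in>crossings D. ckind c \<noteq> Virtual"
    and face: "\<And>x. x \<in> points D \<times> UNIV \<Longrightarrow> P (face_step D x) \<longleftrightarrow> P x"
    and sides: "\<And>x. x \<in> points D \<times> UNIV \<Longrightarrow> P (reverse_dart x) \<longleftrightarrow> P x"
    and region: "\<And>R x y. R \<in> regions F \<Longrightarrow> x \<in> \<Union>R \<Longrightarrow> y \<in> \<Union>R \<Longrightarrow> P x \<longleftrightarrow> P y"
    and xy: "x \<in> points D \<times> UNIV" "y \<in> points D \<times> UNIV"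
  shows "P x \<longleftrightarrow> P y"
proof -
  have dia: "is_diagram D" and part: "partition_on (boundary_circles D) (regions F)"
    and con: "surface_connected F" using F D by (auto simp: is_surface_diagram_def)
  note n = diagram_facts(2)[OF dia]
  have side: "P (p, b) \<longleftrightarrow> P (p, True)" if "p \<in> points D" for p b
    using sides[of "(p, True)"] that by (cases b) (auto simp: reverse_dart_def)
  have cross: "P (pt2 c, True) \<longleftrightarrow> P (pt1 c, True)" "P (inv (nxt D) q, True) \<longleftrightarrow> P (q, True)"
    if c: "c \<in> crossings D" "q \<in> ends c" for c q
  proof -
    have pts: "pt1 c \<in> points D" "pt2 c \<in> points D" "pt1 c \<noteq> pt2 c"
      using diagram_facts(4)[OF dia] c by (auto simp: proper_crossings_def ends_def)
    have ip: "inv (nxt D) p \<in> points D" if "p \<in> points D" for p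
      using permutes_in_image[OF permutes_inv[OF n]] that by simp
    have at: "crossing_at D (pt1 c) = Some c" "crossing_at D (pt2 c) = Some c"
      using crossing_at_Some[OF dia c(1)] by (auto simp: ends_def)
    have f1: "face_step D (inv (nxt D) (pt1 c), True) = (pt2 c, True)"
      using pts at permutes_inverses[OF n] by (simp add: face_step_def head_def leave_def other_def)
    have f2: "face_step D (pt2 c, False) = (pt1 c, True)"
      using pts at by (simp add: face_step_def head_def leave_def other_def)
    have f3: "face_step D (inv (nxt D) (pt2 c), True) = (inv (nxt D) (pt1 c), False)"
      using pts at permutes_inverses[OF n] by (simp add: face_step_def head_def leave_def other_def)
    show 1: "P (pt2 c, True) \<longleftrightarrow> P (pt1 c, True)"
      using face[of "(pt2 c, False)"] side[of "pt2 c" False] pts f2 by simp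
    have "P (inv (nxt D) (pt1 c), True) \<longleftrightarrow> P (pt2 c, True)"
      using face[of "(inv (nxt D) (pt1 c), True)"] f1 ip pts by simp
    moreover have "P (inv (nxt D) (pt2 c), True) \<longleftrightarrow> P (inv (nxt D) (pt1 c), True)"
      using face[of "(inv (nxt D) (pt2 c), True)"] side[of "inv (nxt D) (pt1 c)" False] f3 ip pts by simp
    ultimately show "P (inv (nxt D) q, True) \<longleftrightarrow> P (q, True)" using 1 c(2) by (auto simp: ends_def)
  qed
  have next_point: "P (nxt D p, True) \<longleftrightarrow> P (p, True)" if p: "p \<in> points D" for p
  proof (cases "\<exists>c\<in>crossings D. nxt D p \<in> ends c")
    case True
    then show ?thesis using cross(2)[of _ "nxt D p"] permutes_inverses[OF n] by auto
  next
    case False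
    then have "face_step D (p, True) = (nxt D p, True)"
      by (simp add: face_step_def crossing_at_def head_def leave_def)
    then show ?thesis using face[of "(p, True)"] p by simp
  qed
  have adj: "(p \<in> points D \<longleftrightarrow> q \<in> points D) \<and> (p \<in> points D \<longrightarrow> (P (p, True) \<longleftrightarrow> P (q, True)))"
    if a: "surface_adjacent F p q" for p q
  proof -
    consider "q = nxt D p" | c where "c \<in> crossings D" "p \<in> ends c" "q \<in> ends c"
      | R where "R \<in> regions F" "p \<in> fst ` \<Union>R" "q \<in> fst ` \<Union>R"
      using a D by (auto simp: surface_adjacent_def)
    then show ?thesis
    proof cases
      case 1
      then show ?thesis using next_point permutes_in_image[OF n] by auto
    next
      case 2
      then have "p \<in> points D" "q \<in> points D" using diagram_facts(4)[OF dia] by (auto simp: proper_crossings_def)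
      then show ?thesis using cross(1)[OF 2(1,2)] 2 by (auto simp: ends_def)
    next
      case 3
      obtain x where x: "p = fst x" "x \<in> \<Union>R" using 3(2) by (rule imageE)
      obtain y where y: "q = fst y" "y \<in> \<Union>R" using 3(3) by (rule imageE)
      have "\<Union>R \<subseteq> points D \<times> UNIV"
      proof
        fix z assume "z \<in> \<Union>R"
        then obtain O' where O': "O' \<in> R" "z \<in> O'" by auto
        then have "O' \<in> boundary_circles D" using partition_onD1[OF part] 3(1) by auto
        then obtain w where w: "w \<in> points D \<times> UNIV" "O' = orbit (face_step D) w"
          by (auto simp: boundary_circles_def)
        show "z \<in> points D \<times> UNIV"
          using permutes_orbit_subset[OF face_step_permutes[OF dia cl] w(1)] O'(2) w(2) by blast
      qed
      then have "x \<in> points D \<times> UNIV" "y \<in> points D \<times> UNIV" using x(2) y(2) by blast+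
      then have "p \<in> points D" "q \<in> points D" using x(1) y(1) by (simp_all add: mem_Times_iff)
      then show ?thesis
        using region[OF 3(1) x(2) y(2)] side[of p "snd x"] side[of q "snd y"] x(1) y(1) by simp
    qed
  qed
  have "equivclp (surface_adjacent F) p q \<Longrightarrow> p \<in> points D \<Longrightarrow> q \<in> points D \<and> (P (p, True) \<longleftrightarrow> P (q, True))" for p q
  proof (induct rule: equivclp_induct)
    case (step q r)
    then show ?case using adj[of q r] adj[of r q] by blast
  qed simp
  then have "P (p, True) \<longleftrightarrow> P (q, True)" if "p \<in> points D" "q \<in> points D" for p q
    using con that D unfolding surface_connected_def by blast
  then show ?thesis using xy side by (metis mem_Times_iff prod.collapse)
qed

text \<open>
  The pieces of the surface cut along the chosen loops \<open>\<C>\<close> are obtained by first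
  cutting along all loops of the state, where the walks are known explicitly, and then gluing
  along the loops that were not chosen.
\<close>

theorem genus_bound_state:
  assumes F: "is_surface_diagram F" and cl: "\<forall>c\<in>crossings (pattern F). ckind c \<noteq> Virtual"
    and \<C>: "\<C> \<subseteq> loops (pattern F) S" "\<C> \<noteq> {}" "inj_on (arrow_number (pattern F) S) \<C>"
    and pos: "\<And>C. C \<in> \<C> \<Longrightarrow> arrow_number (pattern F) S C > 0"
  shows "genus F \<ge> 1 \<and> (card \<C> = 1 \<or> card \<C> + 3 \<le> 3 * genus F)"
proof -
  define D where "D = pattern F"
  let ?X = "points D \<times> (UNIV :: bool set)" and ?T = "state_step D S"
  note \<C> = \<C>[folded D_def] and pos = pos[folded D_def] and cl = cl[folded D_def]
  have dia: "is_diagram D" and part: "partition_on (boundary_circles D) (regions F)"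
    using F by (auto simp: is_surface_diagram_def D_def)
  have fin: "finite ?X" using diagram_facts(1)[OF dia] by simp
  have finC: "finite (loops D S)" using diagram_facts(1)[OF dia] by (simp add: loops_def)
  have fin\<C>: "finite \<C>" by (rule finite_subset[OF \<C>(1) finC])
  have finK: "finite (crossings D)" by (rule finite_crossings[OF diagram_facts(1,4)[OF dia]])
  note permT = state_step_permutation[OF dia, of S]
  note TX = state_step_permutes[OF dia, of S]
  note facep = face_step_permutes[OF dia cl]
  have permF: "permutation (face_step D)"
    unfolding permutation_permutes by (intro exI[of _ ?X] conjI fin facep)

  (* The region on the left of a directed arc. *)
  define \<kappa>\<^sub>0 where "\<kappa>\<^sub>0 x = (THE R. R \<in> regions F \<and> orbit (face_step D) x \<in> R)" for x
  have uniq: "R = R'" if "R \<in> regions F" "R' \<in> regions F" "C \<in> R" "C \<in> R'" for R R' C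
    using partition_onD2[OF part] that by (auto simp: disjoint_def)
  have \<kappa>\<^sub>0_eq: "\<kappa>\<^sub>0 x = R" if "R \<in> regions F" "orbit (face_step D) x \<in> R" for x R
    unfolding \<kappa>\<^sub>0_def by (rule the_equality) (use that uniq in blast)+
  have \<kappa>\<^sub>0_reg: "\<kappa>\<^sub>0 x \<in> regions F" if x: "x \<in> ?X" for x
  proof -
    have "orbit (face_step D) x \<in> \<Union>(regions F)"
      using partition_onD1[OF part] x by (auto simp: boundary_circles_def)
    then obtain R where "R \<in> regions F" "orbit (face_step D) x \<in> R" by blast
    then show ?thesis using \<kappa>\<^sub>0_eq by metis
  qed
  have \<kappa>\<^sub>0_image: "\<kappa>\<^sub>0 ` ?X = regions F"
  proof
    show "\<kappa>\<^sub>0 ` ?X \<subseteq> regions F" using \<kappa>\<^sub>0_reg by blast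
    show "regions F \<subseteq> \<kappa>\<^sub>0 ` ?X"
    proof
      fix R assume R: "R \<in> regions F"
      then obtain C where C: "C \<in> R" using partition_onD3[OF part] by (metis all_not_in_conv)
      then have "C \<in> boundary_circles D" using R partition_onD1[OF part] by auto
      then obtain x where "x \<in> ?X" "C = orbit (face_step D) x" by (auto simp: boundary_circles_def)
      then show "R \<in> \<kappa>\<^sub>0 ` ?X" using \<kappa>\<^sub>0_eq[OF R] C by blast
    qed
  qed
  have \<kappa>\<^sub>0_region: "\<kappa>\<^sub>0 x = R" if xR: "R \<in> regions F" "x \<in> \<Union>R" for x R
  proof -
    obtain C where C: "C \<in> R" "x \<in> C" using xR(2) by auto
    then have "C \<in> boundary_circles D" using xR(1) partition_onD1[OF part] by auto
    then obtain z where "C = orbit (face_step D) z" by (auto simp: boundary_circles_def)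
    then have "orbit (face_step D) x = C" using orbit_same[OF permF, of x z] C(2) by simp
    then show ?thesis using \<kappa>\<^sub>0_eq[OF xR(1)] C(1) by simp
  qed
  have \<kappa>\<^sub>0_face: "\<kappa>\<^sub>0 (face_step D x) = \<kappa>\<^sub>0 x" for x
    using permutation_orbit_step[OF permF, of x] by (simp add: \<kappa>\<^sub>0_def)

  have step: "face_step D \<circ> cross_over D S (crossings D) = ?T"
    by (simp add: fun_eq_iff state_step_cross_over[OF dia cl])
  (* The piece on the left of a directed arc when the surface is cut along all loops. *)
  obtain \<kappa> :: "nat \<times> bool \<Rightarrow> (nat \<times> bool) set set" where \<kappa>: "\<forall>x\<in>?X. \<kappa> (?T x) = \<kappa> x"
    "\<forall>c\<in>crossings D. \<kappa> (arriving_dart D (split_point S c) True) = \<kappa> (arriving_dart D (split_point S c) False)"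
    "\<forall>x y. \<kappa>\<^sub>0 x = \<kappa>\<^sub>0 y \<longrightarrow> \<kappa> x = \<kappa> y"
    "2 * int (card (\<kappa>\<^sub>0 ` ?X)) - int (card (orbit (face_step D) ` ?X)) - int (card (crossings D))
      \<le> 2 * int (card (\<kappa> ` ?X)) - int (card (orbit ?T ` ?X))"
    using cut_labels[where S = S and \<kappa>\<^sub>0 = \<kappa>\<^sub>0, OF dia cl \<kappa>\<^sub>0_face finK order_refl]
    unfolding step by (elim exE conjE) (rule that; assumption)
  have \<kappa>T: "\<And>x. x \<in> ?X \<Longrightarrow> \<kappa> (?T x) = \<kappa> x" using \<kappa>(1) by blast
  define N where "N = loops D S - \<C>"
  have N: "finite N" "N \<subseteq> loops D S" using finC by (auto simp: N_def)
  (* The same for the surface cut along the chosen loops only. *)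
  obtain \<kappa>' :: "nat \<times> bool \<Rightarrow> (nat \<times> bool) set set" where k': "\<forall>x y. \<kappa> x = \<kappa> y \<longrightarrow> \<kappa>' x = \<kappa>' y"
     "\<forall>C\<in>N. \<forall>x. fst x \<in> C \<longrightarrow> \<kappa>' (reverse_dart x) = \<kappa>' x"
     "card (\<kappa> ` ?X) \<le> card (\<kappa>' ` ?X) + card N"
    by (rule join_loop_sides[where \<kappa> = \<kappa>, OF dia N, THEN exE], rule \<kappa>T, assumption,
        elim conjE, (rule that; assumption))
  have k'T: "\<kappa>' (?T x) = \<kappa>' x" if "x \<in> ?X" for x using k'(1) \<kappa>(1) that by blast
  have k'_bands: "\<kappa>' (arriving_dart D (split_point S c) True) = \<kappa>' (arriving_dart D (split_point S c) False)"
    if "c \<in> crossings D" for c using k'(1) \<kappa>(2) that by blast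
  have k'_orbit: "\<kappa>' y = \<kappa>' x" if "x \<in> ?X" "y \<in> orbit ?T x" for x y
    using label_orbit[where \<kappa> = \<kappa>', OF TX k'T that(1) that(2)] by simp

  (* \<open>\<O> v\<close> is the set of the boundary circles of the piece \<open>v\<close>:
     sides of chosen loops. *)
  define Y where "Y v = {x \<in> ?X. fst x \<in> \<Union>\<C> \<and> \<kappa>' x = v}" for v
  define \<O> where "\<O> v = orbit ?T ` Y v" for v
  have YX: "Y v \<subseteq> ?X" for v by (auto simp: Y_def)
  have same_loop: "C' = C" if "C \<in> loops D S" "C' \<in> loops D S" "p \<in> C" "p \<in> C'" for C C' p
    using fst_orbit_loop(1)[OF dia that(1), of "(p, True)"] fst_orbit_loop(1)[OF dia that(2), of "(p, True)"] that
    by simp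
  have fst_T: "fst (?T x) \<in> C" if "C \<in> loops D S" "fst x \<in> C" for x C
  proof -
    have "?T x \<in> orbit ?T x" by (rule orbit.base)
    then have "fst (?T x) \<in> fst ` orbit ?T x" by (rule imageI)
    then show ?thesis using fst_orbit_loop(1)[OF dia that] by simp
  qed
  have X_T: "?T x \<in> ?X" if "x \<in> ?X" for x using permutes_in_image[OF TX] that by blast
  have loop_of: "\<exists>C\<in>loops D S. fst x \<in> C" if x: "x \<in> ?X" for x
    using orbit_is_loop[OF dia x, of S] permutation_self_in_orbit[OF permT, of x] by blast
  have side: "\<kappa>' (reverse_dart x) = \<kappa>' x" if x: "x \<in> ?X" "fst x \<notin> \<Union>\<C>" for x
  proof -
    obtain C where "C \<in> loops D S" "fst x \<in> C" using loop_of[OF x(1)] by auto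
    moreover from this have "C \<in> N" using x(2) by (auto simp: N_def)
    ultimately show ?thesis using k'(2) by blast
  qed

  (* The loops that are not chosen lie in the interior of the piece with both sides and drop
     out. *)
  have sum_Y: "(\<Sum>x\<in>Y v. cusp_sum D S x) = 0" for v
  proof -
    let ?Z = "{x \<in> ?X. fst x \<notin> \<Union>\<C> \<and> \<kappa>' x = v}"
    have "(\<Sum>x\<in>?Z. cusp_sum D S x) = 0"
    proof (rule cusp_sum_invariant_zero[OF dia])
      fix x assume x: "x \<in> ?Z"
      then have xX: "x \<in> ?X" and xC: "fst x \<notin> \<Union>\<C>" and xv: "\<kappa>' x = v" by blast+
      have rX: "reverse_dart x \<in> ?X" using xX by (simp add: mem_Times_iff)
      show "reverse_dart x \<in> ?Z" using side[OF xX xC] xv xC rX by simp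
      obtain C where C: "C \<in> loops D S" "fst x \<in> C" using loop_of[OF xX] by auto
      have "fst (?T x) \<notin> \<Union>\<C>"
      proof
        assume "fst (?T x) \<in> \<Union>\<C>"
        then obtain C' where C': "C' \<in> \<C>" "fst (?T x) \<in> C'" by auto
        then have "C' = C" using same_loop[OF C(1), of C'] \<C>(1) fst_T[OF C] by blast
        then show False using C(2) C'(1) xC by blast
      qed
      then show "?T x \<in> ?Z" using X_T[OF xX] k'T[OF xX] xv by simp
    qed auto
    moreover have "(\<Sum>x\<in>{x \<in> ?X. \<kappa>' x = v}. cusp_sum D S x) = (\<Sum>x\<in>Y v. cusp_sum D S x) + (\<Sum>x\<in>?Z. cusp_sum D S x)"
    proof -
      have "{x \<in> ?X. \<kappa>' x = v} = Y v \<union> ?Z" "Y v \<inter> ?Z = {}" by (auto simp: Y_def)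
      moreover have "finite (Y v)" "finite ?Z" using fin finite_subset[OF YX] by auto
      ultimately show ?thesis by (simp add: sum.union_disjoint)
    qed
    moreover have "(\<Sum>x\<in>{x \<in> ?X. \<kappa>' x = v}. cusp_sum D S x) = 0"
      by (rule label_cusp_sum_zero[where \<kappa> = \<kappa>', OF dia cl]) (rule k'T k'_bands; assumption)+
    ultimately show ?thesis by simp
  qed
  have orbit_Y: "orbit ?T x \<subseteq> Y v" if x: "x \<in> Y v" for x v
  proof
    fix y assume y: "y \<in> orbit ?T x"
    have xX: "x \<in> ?X" using x YX by blast
    obtain C where C: "C \<in> \<C>" "fst x \<in> C" using x by (auto simp: Y_def)
    have "fst y \<in> C" using fst_orbit_loop(1)[OF dia _ C(2), of S] C(1) \<C>(1) y by blast
    moreover have "y \<in> ?X" using permutes_orbit_subset[OF TX xX] y by blast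
    ultimately show "y \<in> Y v" using k'_orbit[OF xX y] x C(1) by (auto simp: Y_def)
  qed
  have sum_O: "(\<Sum>C\<in>\<O> v. \<Sum>x\<in>C. cusp_sum D S x) = 0" for v
  proof -
    have "\<Union>(\<O> v) = Y v"
      using orbit_Y permutation_self_in_orbit[OF permT] unfolding \<O>_def by blast
    moreover have "\<forall>A\<in>\<O> v. finite A" using finite_orbit[OF permutation_self_in_orbit[OF permT]] by (auto simp: \<O>_def)
    moreover have "\<forall>A\<in>\<O> v. \<forall>B\<in>\<O> v. A \<noteq> B \<longrightarrow> A \<inter> B = {}"
      unfolding \<O>_def using orbit_same[OF permT] by blast
    ultimately show ?thesis using sum.Union_disjoint[of "\<O> v" "cusp_sum D S"] sum_Y[of v] by simp
  qed
  have fin\<O>: "finite (\<O> v)" for v unfolding \<O>_def using finite_subset[OF YX fin] by simp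
  have chosen: "\<exists>C\<in>\<C>. fst ` A = C \<and> \<bar>\<Sum>x\<in>A. cusp_sum D S x\<bar> = 2 * int (arrow_number D S C)"
    if A: "A \<in> \<O> v" for A v
  proof -
    obtain x where x: "x \<in> Y v" "A = orbit ?T x" using A by (auto simp: \<O>_def)
    then obtain C where C: "C \<in> \<C>" "fst x \<in> C" by (auto simp: Y_def)
    then have "C \<in> loops D S" using \<C>(1) by blast
    then show ?thesis using fst_orbit_loop(1)[OF dia _ C(2)] arrow_number_loop[OF dia _ C(2)] x(2) C(1) by blast
  qed

  (* At most two circles: they must be the two sides of one loop, so that no boundary leads
     out of the piece and it is the whole surface. *)
  have small: "card \<C> = 1 \<and> card (\<kappa>' ` ?X) = 1" if v: "card (\<O> v) \<le> 2" "v \<in> \<kappa>' ` ?X" for v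
  proof -
    have nonzero: "(\<Sum>x\<in>A. cusp_sum D S x) \<noteq> 0" if "A \<in> \<O> v" for A
      using chosen[OF that] pos by force
    have pair: "\<O> v = {A, B}" if "A \<in> \<O> v" "B \<in> \<O> v" "A \<noteq> B" for A B
      using card_subset_eq[OF fin\<O>, of "{A, B}" v] that v(1) card_mono[OF fin\<O>, of "{A, B}" v] by auto
    have same: "fst ` A = fst ` B" if AB: "A \<in> \<O> v" "B \<in> \<O> v" for A B
    proof (cases "A = B")
      case False
      then have "(\<Sum>x\<in>A. cusp_sum D S x) + (\<Sum>x\<in>B. cusp_sum D S x) = 0"
        using sum_O[of v] pair[OF AB False] by simp
      then have "\<bar>\<Sum>x\<in>A. cusp_sum D S x\<bar> = \<bar>\<Sum>x\<in>B. cusp_sum D S x\<bar>" by linarith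
      then show ?thesis using chosen[OF AB(1)] chosen[OF AB(2)] \<C>(3) by (auto simp: inj_on_eq_iff)
    qed simp
    have other: "\<exists>B\<in>\<O> v. B \<noteq> A" if "A \<in> \<O> v" for A
    proof (rule ccontr)
      assume "\<not> ?thesis"
      then have "\<O> v = {A}" using that by blast
      then show False using sum_O[of v] nonzero[OF that] by simp
    qed
    have turn: "\<kappa>' (reverse_dart x) = v" if x: "x \<in> ?X" "\<kappa>' x = v" for x
    proof (cases "fst x \<in> \<Union>\<C>")
      case True
      then have xY: "x \<in> Y v" using x by (simp add: Y_def)
      then have A: "orbit ?T x \<in> \<O> v" by (simp add: \<O>_def)
      obtain B where B: "B \<in> \<O> v" "B \<noteq> orbit ?T x" using other[OF A] by auto
      then obtain y where y: "y \<in> Y v" "B = orbit ?T y" by (auto simp: \<O>_def)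
      obtain C where C: "C \<in> \<C>" "fst x \<in> C" using True by auto
      have CL: "C \<in> loops D S" using C \<C>(1) by blast
      have "fst ` B = C" using same[OF A B(1)] fst_orbit_loop(1)[OF dia CL C(2)] by simp
      then have "fst y \<in> C" using permutation_self_in_orbit[OF permT, of y] y(2) by blast
      from loop_directions[OF dia CL C(2) this] B(2) y(2)
      have "reverse_dart x \<in> orbit ?T y" using permutation_self_in_orbit[OF permT, of "reverse_dart x"] by auto
      then have "\<kappa>' (reverse_dart x) = \<kappa>' y" using k'_orbit y(1) YX by blast
      then show ?thesis using y(1) by (simp add: Y_def)
    next
      case False
      then show ?thesis using side x by simp
    qed
    obtain x\<^sub>0 where x0: "x\<^sub>0 \<in> ?X" "\<kappa>' x\<^sub>0 = v" using v(2) by auto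
    have all_v: "\<kappa>' x = v" if xX: "x \<in> ?X" for x
    proof -
      have "\<kappa>' x = v \<longleftrightarrow> \<kappa>' x\<^sub>0 = v"
      proof (rule surface_connected_const[OF F D_def cl, where P = "\<lambda>x. \<kappa>' x = v"])
        show "\<kappa>' (face_step D x) = v \<longleftrightarrow> \<kappa>' x = v" for x
          using \<kappa>\<^sub>0_face[of x] \<kappa>(3) k'(1) by metis
        show "\<kappa>' (reverse_dart x) = v \<longleftrightarrow> \<kappa>' x = v" if "x \<in> ?X" for x
          using turn[OF that] turn[of "reverse_dart x"] that by (auto simp: mem_Times_iff)
        show "\<kappa>' x = v \<longleftrightarrow> \<kappa>' y = v" if "R \<in> regions F" "x \<in> \<Union>R" "y \<in> \<Union>R" for R x y
          using \<kappa>\<^sub>0_region[OF that(1,2)] \<kappa>\<^sub>0_region[OF that(1,3)] \<kappa>(3) k'(1) by metis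
      qed (rule xX x0(1))+
      then show ?thesis using x0(2) by simp
    qed
    have image: "\<kappa>' ` ?X = {v}" using all_v x0 by blast
    have single: "C = C'" if C: "C \<in> \<C>" "C' \<in> \<C>" for C C'
    proof -
      have L: "C \<in> loops D S" "C' \<in> loops D S" using C \<C>(1) by auto
      obtain p p' where p: "p \<in> C" "p' \<in> C'" using loops_subset(2)[OF dia] L by blast
      have "(p, True) \<in> Y v" "(p', True) \<in> Y v"
        using p C all_v loops_subset(1)[OF dia L(1)] loops_subset(1)[OF dia L(2)] by (auto simp: Y_def)
      then have "fst ` orbit ?T (p, True) = fst ` orbit ?T (p', True)" by (intro same) (auto simp: \<O>_def)
      then show ?thesis
        using fst_orbit_loop(1)[OF dia L(1), of "(p, True)"] fst_orbit_loop(1)[OF dia L(2), of "(p', True)"] p by simp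
    qed
    obtain C where "C \<in> \<C>" using \<C>(2) by blast
    then have "\<C> = {C}" using single[OF _ \<open>C \<in> \<C>\<close>] by blast
    then show ?thesis using image by simp
  qed

  (* Double counting of the sides of the chosen loops. *)
  have big: "3 * card (\<kappa>' ` ?X) \<le> 2 * card \<C>" if "\<And>v. v \<in> \<kappa>' ` ?X \<Longrightarrow> 3 \<le> card (\<O> v)"
  proof -
    let ?V = "\<kappa>' ` ?X"
    have "card ?V * 3 \<le> (\<Sum>v\<in>?V. card (\<O> v))" using sum_bounded_below[of ?V 3 "\<lambda>v. card (\<O> v)"] that by simp
    also have "\<dots> = card (\<Union>v\<in>?V. \<O> v)"
    proof (rule card_UN_disjoint[symmetric])
      show "\<forall>v\<in>?V. \<forall>w\<in>?V. v \<noteq> w \<longrightarrow> \<O> v \<inter> \<O> w = {}"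
      proof (intro ballI impI)
        fix v w assume "v \<in> ?V" "w \<in> ?V" "v \<noteq> w"
        show "\<O> v \<inter> \<O> w = {}"
        proof (rule ccontr)
          assume "\<O> v \<inter> \<O> w \<noteq> {}"
          then obtain x y where xy: "x \<in> Y v" "y \<in> Y w" "orbit ?T x = orbit ?T y" by (auto simp: \<O>_def)
          then have "y \<in> orbit ?T x" using permutation_self_in_orbit[OF permT, of y] by simp
          then have "y \<in> Y v" using orbit_Y[OF xy(1)] by blast
          then show False using xy(2) \<open>v \<noteq> w\<close> by (simp add: Y_def)
        qed
      qed
    qed (use fin fin\<O> in auto)
    also have "\<dots> \<le> card (\<C> \<times> (UNIV :: bool set))"
    proof -
      have "\<forall>C\<in>\<C>. \<exists>p. p \<in> C" using loops_subset(2)[OF dia] \<C>(1) by blast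
      then obtain p where p: "\<And>C. C \<in> \<C> \<Longrightarrow> p C \<in> C" by metis
      have "(\<Union>v\<in>?V. \<O> v) \<subseteq> (\<lambda>z. orbit ?T (p (fst z), snd z)) ` (\<C> \<times> UNIV)"
      proof
        fix A assume "A \<in> (\<Union>v\<in>?V. \<O> v)"
        then obtain v x where x: "x \<in> Y v" "A = orbit ?T x" by (auto simp: \<O>_def)
        then obtain C where C: "C \<in> \<C>" "fst x \<in> C" by (auto simp: Y_def)
        have CL: "C \<in> loops D S" using C \<C>(1) by blast
        have "A = orbit ?T (p C, True) \<or> A = orbit ?T (p C, False)"
          using loop_directions[OF dia CL, of "(p C, True)" x] p[OF C(1)] C(2) x(2)
          by (simp add: reverse_dart_def)
        then show "A \<in> (\<lambda>z. orbit ?T (p (fst z), snd z)) ` (\<C> \<times> UNIV)"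
          using C(1) by (elim disjE) (rule image_eqI[of _ _ "(C, True)"] image_eqI[of _ _ "(C, False)"]; simp)+
      qed
      then have "card (\<Union>v\<in>?V. \<O> v) \<le> card ((\<lambda>z. orbit ?T (p (fst z), snd z)) ` (\<C> \<times> (UNIV :: bool set)))"
        using fin\<C> by (intro card_mono) auto
      also have "\<dots> \<le> card (\<C> \<times> (UNIV :: bool set))" using fin\<C> by (intro card_image_le) auto
      finally show ?thesis .
    qed
    finally show ?thesis by (simp add: card_cartesian_product)
  qed

  (* Giving all regions genus zero can only raise the Euler characteristic. Then regions and
     crossings are exchanged for pieces, circles for sides of loops, and the remaining loops
     are glued. *)
  have euler: "euler_char F \<le> 2 * int (card (\<kappa>' ` ?X)) - 2 * int (card \<C>)"
  proof -
    have finreg: "finite (regions F)" using \<kappa>\<^sub>0_image fin by (metis finite_imageI)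
    have circles: "boundary_circles D = orbit (face_step D) ` ?X" by (simp add: boundary_circles_def)
    have "(\<Sum>R\<in>regions F. 2 - 2 * int (region_genus F R) - int (card R)) \<le> (\<Sum>R\<in>regions F. 2 - int (card R))"
      by (intro sum_mono) simp
    also have "\<dots> = 2 * int (card (regions F)) - int (\<Sum>R\<in>regions F. card R)"
      by (simp add: sum_subtractf)
    also have "(\<Sum>R\<in>regions F. card R) = card (boundary_circles D)"
    proof -
      have "finite R" if "R \<in> regions F" for R
        using that partition_onD1[OF part] circles fin by (metis Union_upper finite_imageI finite_subset)
      then show ?thesis
        using card_Union_disjoint[of "regions F"] partition_onD1[OF part] partition_onD2[OF part]
        by (simp add: disjoint_def pairwise_def disjnt_def)
    qed
    finally have "euler_char F \<le> 2 * int (card (regions F)) - int (card (boundary_circles D)) - int (card (crossings D))"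
      by (simp add: euler_char_def D_def)
    also have "\<dots> \<le> 2 * int (card (\<kappa> ` ?X)) - int (card (orbit ?T ` ?X))"
      using \<kappa>(4) by (simp add: \<kappa>\<^sub>0_image circles)
    also have "\<dots> \<le> 2 * int (card (\<kappa> ` ?X)) - 2 * int (card (loops D S))"
      using two_orbits_per_loop[OF dia, of S] by linarith
    also have "\<dots> \<le> 2 * int (card (\<kappa>' ` ?X)) - 2 * int (card \<C>)"
    proof -
      have "card N + card \<C> = card (loops D S)"
        unfolding N_def using card_Diff_subset[OF fin\<C> \<C>(1)] card_mono[OF finC \<C>(1)] by simp
      then show ?thesis using k'(3) by linarith
    qed
    finally show ?thesis .
  qed
  have g: "int (genus F) \<ge> 1 - int (card (\<kappa>' ` ?X)) + int (card \<C>)"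
    using euler unfolding genus_def by linarith
  have n: "card \<C> \<ge> 1" using \<C>(2) fin\<C> by (simp add: Suc_leI card_gt_0_iff)
  show ?thesis
  proof (cases "\<forall>v\<in>\<kappa>' ` ?X. 3 \<le> card (\<O> v)")
    case True
    then show ?thesis using big g n by force
  next
    case False
    then obtain v where v: "v \<in> \<kappa>' ` ?X" "\<not> 3 \<le> card (\<O> v)" by blast
    then have "card (\<O> v) \<le> 2" by linarith
    from small[OF this v(1)] show ?thesis using g by simp
  qed
qed

section \<open>The minimal genus\<close>

lemma state_value_single:
  "finite (loops D S) \<Longrightarrow> state_value D S = Poly_Mapping.single
     (0, \<Sum>C\<in>loops D S. if arrow_number D S C = 0 then 0 else Poly_Mapping.single (arrow_number D S C) 1) 1"
proof -
  have "(\<Prod>C\<in>B. loop_value D S C) = Poly_Mapping.single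
     (0, \<Sum>C\<in>B. if arrow_number D S C = 0 then 0 else Poly_Mapping.single (arrow_number D S C) 1) 1"
    if "finite B" for B
    using that
  proof (induct B)
    case empty
    then show ?case by (simp add: zero_prod_def[symmetric])
  next
    case (insert C B)
    then show ?case
      by (simp add: loop_value_def K_var_def mult_single plus_prod_def)
  qed
  then show "finite (loops D S) \<Longrightarrow> ?thesis" by (simp add: state_value_def)
qed

lemma K_occurs_d_poly_power: "K_occurs (d_poly ^ k * f) \<mu> \<longleftrightarrow> K_occurs f \<mu>"
  by (induct k) (simp_all add: mult.assoc K_occurs_d_poly)

lemma K_occurs_sum: "K_occurs (\<Sum>S\<in>B. g S) \<mu> \<Longrightarrow> \<exists>S\<in>B. K_occurs (g S) \<mu>"
  unfolding K_occurs_def lookup_sum by (meson sum.not_neutral_contains_not_neutral)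

text \<open>
  A monomial that survives in the sum occurs in the contribution of some state, which is a
  Laurent polynomial in \<open>A\<close> times a single monomial.
\<close>

lemma K_occurs_loops:
  assumes D: "is_diagram D" and occ: "K_occurs (arrow_polynomial D) \<mu>"
  shows "\<exists>S. \<mu> = (\<Sum>C\<in>loops D S. if arrow_number D S C = 0 then 0
                  else Poly_Mapping.single (arrow_number D S C) 1)"
proof -
  obtain S where "K_occurs (A_pow (coeff_exponent D S) * d_poly ^ (card (loops D S) - 1) * state_value D S) \<mu>"
    using K_occurs_sum[OF occ[unfolded arrow_polynomial_def]] by blast
  then have "K_occurs (state_value D S) \<mu>"
    by (simp only: mult.assoc K_occurs_A_pow K_occurs_d_poly_power)
  moreover have "finite (loops D S)" using diagram_facts(1)[OF D] by (simp add: loops_def)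
  ultimately show ?thesis
    by (auto simp: state_value_single K_occurs_def lookup_single when_def split: if_splits)
qed

text \<open>
  Distinct indices are arrow numbers of distinct loops, one for each factor of the monomial.
\<close>

lemma genus_bound:
  fixes n :: nat and i :: "nat \<Rightarrow> nat"
  assumes F: "is_surface_diagram F" and cl: "\<forall>c\<in>crossings (pattern F). ckind c \<noteq> Virtual"
    and n: "n \<ge> 1" and i: "\<forall>j\<in>{1..n}. i j \<ge> 1" and inj: "inj_on i {1..n}"
    and occ: "K_occurs (arrow_polynomial (pattern F)) (\<Sum>j\<in>{1..n}. Poly_Mapping.single (i j) 1)"
  shows "genus F \<ge> 1 \<and> (n = 1 \<or> n + 3 \<le> 3 * genus F)"
proof -
  let ?D = "pattern F"
  have D: "is_diagram ?D" using F by (simp add: is_surface_diagram_def)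
  obtain S where S: "(\<Sum>j\<in>{1..n}. Poly_Mapping.single (i j) (1 :: nat)) =
      (\<Sum>C\<in>loops ?D S. if arrow_number ?D S C = 0 then 0 else Poly_Mapping.single (arrow_number ?D S C) 1)"
    using K_occurs_loops[OF D occ] by auto
  have "\<exists>C\<in>loops ?D S. arrow_number ?D S C = i j" if j: "j \<in> {1..n}" for j
  proof -
    have "Poly_Mapping.lookup (\<Sum>j\<in>{1..n}. Poly_Mapping.single (i j) (1 :: nat)) (i j) \<noteq> 0"
      using j by (auto simp: lookup_sum lookup_single when_def)
    then have "(\<Sum>C\<in>loops ?D S. Poly_Mapping.lookup (if arrow_number ?D S C = 0 then 0
        else Poly_Mapping.single (arrow_number ?D S C) (1 :: nat)) (i j)) \<noteq> 0"
      unfolding S lookup_sum .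
    then obtain C where "C \<in> loops ?D S" "Poly_Mapping.lookup (if arrow_number ?D S C = 0 then 0
        else Poly_Mapping.single (arrow_number ?D S C) (1 :: nat)) (i j) \<noteq> 0"
      by (rule sum.not_neutral_contains_not_neutral)
    then show ?thesis by (auto simp: lookup_single when_def split: if_splits)
  qed
  then obtain C where C: "\<And>j. j \<in> {1..n} \<Longrightarrow> C j \<in> loops ?D S \<and> arrow_number ?D S (C j) = i j" by metis
  have "inj_on C {1..n}" using C inj by (metis inj_on_def)
  then have card: "card (C ` {1..n}) = n" by (simp add: card_image)
  have "genus F \<ge> 1 \<and> (card (C ` {1..n}) = 1 \<or> card (C ` {1..n}) + 3 \<le> 3 * genus F)"
  proof (rule genus_bound_state[OF F cl])
    show "C ` {1..n} \<subseteq> loops ?D S" using C by blast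
    show "C ` {1..n} \<noteq> {}" using n by simp
    show "inj_on (arrow_number ?D S) (C ` {1..n})"
    proof (rule inj_onI)
      fix A B assume A: "A \<in> C ` {1..n}" and B: "B \<in> C ` {1..n}"
        and eq: "arrow_number ?D S A = arrow_number ?D S B"
      obtain j k where jk: "j \<in> {1..n}" "A = C j" "k \<in> {1..n}" "B = C k" using A B by blast
      then have "i j = i k" using eq C[of j] C[of k] by simp
      then show "A = B" using inj_onD[OF inj _ jk(1,3)] jk by simp
    qed
    show "arrow_number ?D S A > 0" if A: "A \<in> C ` {1..n}" for A
    proof -
      obtain j where j: "j \<in> {1..n}" "A = C j" using A by blast
      then show ?thesis using C[OF j(1)] bspec[OF i j(1)] by simp
    qed
  qed
  then show ?thesis unfolding card .
qed

text \<open>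
  A single region glued to all boundary circles makes the surface connected. The minimal genus
  is a least element and has its meaning only because there is such a representation.
\<close>

lemma representation_exists:
  assumes L: "virtual_link_diagram L"
  shows "\<exists>F. represents F L"
proof -
  let ?D = "forget_virtual L"
  define F where "F = \<lparr>pattern = ?D, regions = {boundary_circles ?D}, region_genus = \<lambda>_. 0\<rparr>"
  have "is_diagram L" by (rule virtual_link_diagram_is_diagram[OF L])
  then have D: "is_diagram ?D"
    by (auto simp: is_diagram_def forget_virtual_def classical_crossings_def)
  have cl: "\<forall>c\<in>crossings ?D. ckind c \<noteq> Virtual" by (simp add: forget_virtual_def classical_crossings_def)
  have perm: "permutation (face_step ?D)"
    unfolding permutation_permutes
    by (rule exI[of _ "points ?D \<times> UNIV"]) (simp add: face_step_permutes[OF D cl] diagram_facts(1)[OF D])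
  have mem: "p \<in> fst ` \<Union>(boundary_circles ?D)" if "p \<in> points ?D" for p
  proof (rule image_eqI[of _ _ "(p, True)"])
    show "(p, True) \<in> \<Union>(boundary_circles ?D)"
      using that permutation_self_in_orbit[OF perm, of "(p, True)"] by (force simp: boundary_circles_def)
  qed simp
  have "surface_adjacent F p q" if "p \<in> points ?D" "q \<in> points ?D" for p q
    using mem[OF that(1)] mem[OF that(2)] by (simp add: surface_adjacent_def F_def)
  then have "surface_connected F"
    unfolding surface_connected_def by (auto simp: F_def intro: r_into_equivclp)
  moreover have "partition_on (boundary_circles ?D) {boundary_circles ?D}"
    using diagram_facts(3)[OF D] by (auto simp: partition_on_def boundary_circles_def)
  ultimately have "is_surface_diagram F" using D by (simp add: is_surface_diagram_def F_def)
  moreover have "virtual_equivalent L L" "same_diagram ?D ?D"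
    by (simp_all add: virtual_equivalent_def same_diagram_def)
  ultimately have "represents F L" unfolding represents_def using L cl by (auto simp: F_def)
  then show ?thesis by blast
qed

theorem theorem4p5:
  fixes L :: diagram and n :: nat and i :: "nat \<Rightarrow> nat"
  assumes "virtual_link_diagram L"
    and "n \<ge> 1"
    and "\<forall>j\<in>{1..n}. i j \<ge> 1"
    and "\<forall>j\<in>{1..n}. \<forall>k\<in>{1..n}. j \<noteq> k \<longrightarrow> i j \<noteq> i k"
    and "has_K_summand (arrow_polynomial L) n i"
  shows "(n > 1 \<longrightarrow> minimal_genus L \<ge> 1) \<and>
         (\<forall>g::nat. g > 0 \<and> int n \<ge> 3 * int g - 3 \<longrightarrow> minimal_genus L \<ge> g)"
proof -
  obtain F\<^sub>0 where "represents F\<^sub>0 L" using representation_exists[OF assms(1)] by blast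
  then have "\<exists>g F. represents F L \<and> genus F = g" by blast
  then have "\<exists>F. represents F L \<and> genus F = minimal_genus L"
    unfolding minimal_genus_def by (rule LeastI_ex)
  then obtain F where F: "represents F L" "genus F = minimal_genus L" by blast
  have "K_occurs (arrow_polynomial L) (\<Sum>j\<in>{1..n}. Poly_Mapping.single (i j) 1)"
    using assms(5) by (simp add: has_K_summand_def K_occurs_def)
  then have "K_occurs (arrow_polynomial (pattern F)) (\<Sum>j\<in>{1..n}. Poly_Mapping.single (i j) 1)"
    using K_occurs_representation[OF virtual_link_diagram_is_diagram[OF assms(1)] F(1)] by simp
  moreover have "inj_on i {1..n}" using assms(4) by (auto simp: inj_on_def)
  moreover have "is_surface_diagram F" "\<forall>c\<in>crossings (pattern F). ckind c \<noteq> Virtual"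
    using F(1) by (simp_all add: represents_def)
  ultimately have bound: "genus F \<ge> 1 \<and> (n = 1 \<or> n + 3 \<le> 3 * genus F)"
    using genus_bound assms(2,3) by blast
  show ?thesis
  proof (intro conjI allI impI)
    show "minimal_genus L \<ge> 1" using bound F(2) by simp
    show "minimal_genus L \<ge> g" if "g > 0 \<and> int n \<ge> 3 * int g - 3" for g :: nat
      using bound that unfolding F(2) by linarith
  qed
qed

end
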